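(* Let $N$ be a smooth manifold of dimension $n\ge 2$ and let $D$ be a torsion-free affine connection on $N$ which preserves a volume form. Denote local coordinates on $N$ by $x^A$ ($A=1,\dots,n$) and the induced canonical fibre coordinates on $T^*N$ by $p_A$. Let $\Gamma_A{}^C{}_B$ be the Christoffel symbols of $D$ and $\mathrm{Ric}_{AB}$ its Ricci curvature. Let $$g = 2\,dx^A\odot dp_A-2\,\Gamma_A{}^C{}_B\,p_C\,dx^A\odot dx^B$$ be the Patterson--Walker metric induced on $T^*N$ by $D$ (a globally defined pseudo-Riemannian metric of signature $(n,n)$). Then the metric $\mathbf g$ on $\mathbf M=\mathbb R_+\times T^*N\times\mathbb R$, with coordinates $t\in\mathbb R_+$, $(x^A,p_A)$ on $T^*N$, and $\rho\in\mathbb R$, given by $$\mathbf g=2\rho\, dt\odot dt+2t\,dt\odot d\rho+t^2\Big(2\,dx^A\odot dp_A-2p_C\Gamma_A{}^C{}_B\,dx^A\odot dx^B+\frac{2\rho}{n-1}\mathrm{Ric}_{AB}\,dx^A\odot dx^B\Big)$$ is a globally Ricci-flat Fefferman--Graham ambient metric for the conformal class $[g]$.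
   Context: Summation over repeated indices is understood, and $\alpha\odot\beta=\tfrac12(\alpha\otimes\beta+\beta\otimes\alpha)$. The Christoffel symbols are defined by $D_{\partial_A}\partial_B=\Gamma_A{}^C{}_B\,\partial_C$. The Ricci curvature of $D$ is $\mathrm{Ric}(Y,Z)=\mathrm{tr}\big(X\mapsto R(X,Y)Z\big)$ with $R(X,Y)Z=D_XD_YZ-D_YD_XZ-D_{[X,Y]}Z$; it is symmetric because $D$ is torsion-free and preserves a volume form. Given a pseudo-Riemannian manifold $(M,g)$ of signature $(p,q)$, a globally Ricci-flat Fefferman--Graham ambient metric for the conformal class $[g]$ is a pseudo-Riemannian metric $\mathbf g$ of signature $(p+1,q+1)$ on $\mathbf M=\mathbb R_+\times M\times\mathbb R$, with coordinates $(t,x,\rho)$, of the form $$\mathbf g=t^2 g_{ij}(x,\rho)\,dx^i\odot dx^j+2\rho\,dt\odot dt+2t\,dt\odot d\rho,$$ where $g_{ij}(x,0)\,dx^i\odot dx^j=g$ and $\mathrm{Ric}(\mathbf g)=0$ on all of $\mathbf M$ (not only asymptotically at $\rho=0$). *)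

theory Defs
  imports "HOL-Analysis.Analysis"
begin

section \<open>Smooth maps between open subsets of normed spaces\<close>

text \<open>
  The following predicates are meant for open \<open>S\<close>.
\<close>

primrec Ck_on ::
  "nat \<Rightarrow> ('a::real_normed_vector \<Rightarrow> 'b::real_normed_vector) \<Rightarrow> 'a set \<Rightarrow> bool" where
  "Ck_on 0 f S \<longleftrightarrow> continuous_on S f"
| "Ck_on (Suc k) f S \<longleftrightarrow>
     f differentiable_on S \<and> (\<forall>v. Ck_on k (\<lambda>x. frechet_derivative f (at x) v) S)"

definition smooth_on ::
  "'a set \<Rightarrow> ('a::real_normed_vector \<Rightarrow> 'b::real_normed_vector) \<Rightarrow> bool" where
  "smooth_on S f \<longleftrightarrow> (\<forall>k. Ck_on k f S)"


section \<open>Smooth manifolds\<close>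

text \<open>
  A chart is a pair of a domain and a coordinate map; only the values of the coordinate map on
  the domain matter. A manifold is given by an atlas (not necessarily a maximal one): its
  underlying set is the union of the chart domains, and its topology is the one for which
  the charts are homeomorphisms onto open subsets of the model space.
\<close>

type_synonym ('m, 'e) chart = "'m set \<times> ('m \<Rightarrow> 'e)"

definition points :: "('m, 'e) chart set \<Rightarrow> 'm set" where
  "points A = (\<Union>\<kappa>\<in>A. fst \<kappa>)"

abbreviation chart_inv :: "('m, 'e) chart \<Rightarrow> 'e \<Rightarrow> 'm" where
  "chart_inv \<kappa> \<equiv> inv_into (fst \<kappa>) (snd \<kappa>)"

definition smooth_atlas :: "('m, 'e::euclidean_space) chart set \<Rightarrow> bool" where
  "smooth_atlas A \<longleftrightarrow>
     (\<forall>\<kappa>\<in>A. inj_on (snd \<kappa>) (fst \<kappa>) \<and> open (snd \<kappa> ` fst \<kappa>)) \<and>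
     (\<forall>\<kappa>\<in>A. \<forall>\<kappa>'\<in>A. open (snd \<kappa> ` (fst \<kappa> \<inter> fst \<kappa>')) \<and>
        smooth_on (snd \<kappa> ` (fst \<kappa> \<inter> fst \<kappa>')) (snd \<kappa>' \<circ> chart_inv \<kappa>))"

definition manifold_topology :: "('m, 'e::euclidean_space) chart set \<Rightarrow> 'm topology" where
  "manifold_topology A =
     topology (\<lambda>W. W \<subseteq> points A \<and> (\<forall>\<kappa>\<in>A. open (snd \<kappa> ` (fst \<kappa> \<inter> W))))"

lemma openin_manifold_topology:
  assumes "smooth_atlas A"
  shows "openin (manifold_topology A) W \<longleftrightarrow>
    W \<subseteq> points A \<and> (\<forall>\<kappa>\<in>A. open (snd \<kappa> ` (fst \<kappa> \<inter> W)))"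
proof -
  let ?P = "\<lambda>W. W \<subseteq> points A \<and> (\<forall>\<kappa>\<in>A. open (snd \<kappa> ` (fst \<kappa> \<inter> W)))"
  have "?P (S \<inter> T)" if "?P S" "?P T" for S T
  proof (intro conjI ballI)
    show "S \<inter> T \<subseteq> points A" using that by blast
    fix \<kappa> assume \<kappa>: "\<kappa> \<in> A"
    then have inj: "inj_on (snd \<kappa>) (fst \<kappa>)" using assms by (simp add: smooth_atlas_def)
    have "snd \<kappa> ` (fst \<kappa> \<inter> (S \<inter> T)) = snd \<kappa> ` (fst \<kappa> \<inter> S) \<inter> snd \<kappa> ` (fst \<kappa> \<inter> T)"
      using inj by (auto dest: inj_onD)
    then show "open (snd \<kappa> ` (fst \<kappa> \<inter> (S \<inter> T)))" using that \<kappa> by (simp add: open_Int)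
  qed
  moreover have "?P (\<Union>\<K>)" if "\<forall>K\<in>\<K>. ?P K" for \<K>
  proof (intro conjI ballI)
    show "\<Union>\<K> \<subseteq> points A" using that by blast
    fix \<kappa> assume \<kappa>: "\<kappa> \<in> A"
    have "snd \<kappa> ` (fst \<kappa> \<inter> \<Union>\<K>) = (\<Union>K\<in>\<K>. snd \<kappa> ` (fst \<kappa> \<inter> K))" by blast
    then show "open (snd \<kappa> ` (fst \<kappa> \<inter> \<Union>\<K>))" using that \<kappa> by (simp add: open_UN)
  qed
  ultimately have "istopology ?P" unfolding istopology_def by blast
  then show ?thesis unfolding manifold_topology_def by (simp add: topology_inverse')
qed

definition smooth_manifold :: "('m, 'e::euclidean_space) chart set \<Rightarrow> bool" where
  "smooth_manifold A \<longleftrightarrow> smooth_atlas A \<and>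
     Hausdorff_space (manifold_topology A) \<and> second_countable (manifold_topology A)"

definition jac ::
  "('m, 'e::euclidean_space) chart \<Rightarrow> ('m, 'e) chart \<Rightarrow> 'm \<Rightarrow> 'e \<Rightarrow> 'e" where
  "jac \<kappa> \<kappa>' x = frechet_derivative (snd \<kappa>' \<circ> chart_inv \<kappa>) (at (snd \<kappa> x))"

text \<open>
  The derivative of \<open>f\<close> at \<open>x\<close>, taken in the chart \<open>\<kappa>\<close>, in the direction whose components with
  respect to \<open>\<kappa>\<close> are \<open>v\<close>.
\<close>

definition chart_deriv ::
  "('m, 'e::euclidean_space) chart \<Rightarrow> ('m \<Rightarrow> 'b::real_normed_vector) \<Rightarrow> 'm \<Rightarrow> 'e \<Rightarrow> 'b" where
  "chart_deriv \<kappa> f x v = frechet_derivative (f \<circ> chart_inv \<kappa>) (at (snd \<kappa> x)) v"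

definition smooth_fun ::
  "('m, 'e::euclidean_space) chart set \<Rightarrow> 'm set \<Rightarrow> ('m \<Rightarrow> real) \<Rightarrow> bool" where
  "smooth_fun A W f \<longleftrightarrow> (\<forall>\<kappa>\<in>A. smooth_on (snd \<kappa> ` (fst \<kappa> \<inter> W)) (f \<circ> chart_inv \<kappa>))"


section \<open>Vector fields, connections, curvature\<close>

text \<open>
  Tensors are families of components indexed by the charts, subject to the usual transformation
  law: \<open>X \<kappa> x\<close> is the vector of components at \<open>x\<close> of the vector field \<open>X\<close> in the chart \<open>\<kappa>\<close>. The
  values outside the region \<open>W\<close> under consideration, for \<open>x\<close> outside the domain of \<open>\<kappa>\<close>, and for
  \<open>\<kappa>\<close> outside the atlas are irrelevant.
\<close>

type_synonym ('m, 'e) field = "('m, 'e) chart \<Rightarrow> 'm \<Rightarrow> 'e"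

definition vector_field ::
  "('m, 'e::euclidean_space) chart set \<Rightarrow> 'm set \<Rightarrow> ('m, 'e) field \<Rightarrow> bool" where
  "vector_field A W X \<longleftrightarrow>
     (\<forall>\<kappa>\<in>A. smooth_on (snd \<kappa> ` (fst \<kappa> \<inter> W)) (X \<kappa> \<circ> chart_inv \<kappa>)) \<and>
     (\<forall>\<kappa>\<in>A. \<forall>\<kappa>'\<in>A. \<forall>x \<in> fst \<kappa> \<inter> fst \<kappa>' \<inter> W. X \<kappa>' x = jac \<kappa> \<kappa>' x (X \<kappa> x))"

definition field_eq ::
  "('m, 'e) chart set \<Rightarrow> 'm set \<Rightarrow> ('m, 'e) field \<Rightarrow> ('m, 'e) field \<Rightarrow> bool" where
  "field_eq A W X Y \<longleftrightarrow> (\<forall>\<kappa>\<in>A. \<forall>x \<in> fst \<kappa> \<inter> W. X \<kappa> x = Y \<kappa> x)"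

text \<open>
  The vector field on the domain of \<open>\<kappa>\<close> with constant components \<open>v\<close> with respect to \<open>\<kappa>\<close>.
\<close>

definition coord_field ::
  "('m, 'e::euclidean_space) chart \<Rightarrow> 'e \<Rightarrow> ('m, 'e) field" where
  "coord_field \<kappa> v = (\<lambda>\<kappa>' x. jac \<kappa> \<kappa>' x v)"

definition lie_bracket ::
  "('m, 'e::euclidean_space) field \<Rightarrow> ('m, 'e) field \<Rightarrow> ('m, 'e) field" where
  "lie_bracket X Y =
     (\<lambda>\<kappa> x. chart_deriv \<kappa> (Y \<kappa>) x (X \<kappa> x) - chart_deriv \<kappa> (X \<kappa>) x (Y \<kappa> x))"

text \<open>
  A connection acts on the vector fields on every open set, compatibly with restriction; this
  is what makes sense of covariant derivatives of coordinate fields.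
\<close>

type_synonym ('m, 'e) connection = "('m, 'e) field \<Rightarrow> ('m, 'e) field \<Rightarrow> ('m, 'e) field"

definition affine_connection ::
  "('m, 'e::euclidean_space) chart set \<Rightarrow> ('m, 'e) connection \<Rightarrow> bool" where
  "affine_connection A D \<longleftrightarrow>
     (\<forall>W X Y. openin (manifold_topology A) W \<longrightarrow> vector_field A W X \<longrightarrow> vector_field A W Y \<longrightarrow>
        vector_field A W (D X Y) \<and>
        (\<forall>X' Y'. vector_field A W X' \<longrightarrow> vector_field A W Y' \<longrightarrow>
           (field_eq A W X X' \<longrightarrow> field_eq A W Y Y' \<longrightarrow> field_eq A W (D X Y) (D X' Y')) \<and>
           field_eq A W (D (\<lambda>\<kappa> x. X \<kappa> x + X' \<kappa> x) Y) (\<lambda>\<kappa> x. D X Y \<kappa> x + D X' Y \<kappa> x) \<and>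
           field_eq A W (D X (\<lambda>\<kappa> x. Y \<kappa> x + Y' \<kappa> x)) (\<lambda>\<kappa> x. D X Y \<kappa> x + D X Y' \<kappa> x)) \<and>
        (\<forall>f. smooth_fun A W f \<longrightarrow>
           field_eq A W (D (\<lambda>\<kappa> x. f x *\<^sub>R X \<kappa> x) Y) (\<lambda>\<kappa> x. f x *\<^sub>R D X Y \<kappa> x) \<and>
           field_eq A W (D X (\<lambda>\<kappa> x. f x *\<^sub>R Y \<kappa> x))
             (\<lambda>\<kappa> x. chart_deriv \<kappa> f x (X \<kappa> x) *\<^sub>R Y \<kappa> x + f x *\<^sub>R D X Y \<kappa> x)))"

definition torsion_free ::
  "('m, 'e::euclidean_space) chart set \<Rightarrow> ('m, 'e) connection \<Rightarrow> bool" where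
  "torsion_free A D \<longleftrightarrow>
     (\<forall>W X Y. openin (manifold_topology A) W \<longrightarrow> vector_field A W X \<longrightarrow> vector_field A W Y \<longrightarrow>
        field_eq A W (\<lambda>\<kappa> x. D X Y \<kappa> x - D Y X \<kappa> x) (lie_bracket X Y))"

definition curvature ::
  "('m, 'e::euclidean_space) connection \<Rightarrow>
    ('m, 'e) field \<Rightarrow> ('m, 'e) field \<Rightarrow> ('m, 'e) field \<Rightarrow> ('m, 'e) field" where
  "curvature D X Y Z =
     (\<lambda>\<kappa> x. D X (D Y Z) \<kappa> x - D Y (D X Z) \<kappa> x - D (lie_bracket X Y) Z \<kappa> x)"

text \<open>
  \<open>ricci D \<kappa> x u v\<close> is \<open>Ric(Y,Z) = tr (X \<mapsto> R(X,Y)Z)\<close> at \<open>x\<close>, where \<open>Y\<close>, \<open>Z\<close> have components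
  \<open>u\<close>, \<open>v\<close> in the chart \<open>\<kappa>\<close>; the trace is computed in the coordinate frame of \<open>\<kappa>\<close>.
\<close>

definition ricci ::
  "('m, 'e::euclidean_space) connection \<Rightarrow> ('m, 'e) chart \<Rightarrow> 'm \<Rightarrow> 'e \<Rightarrow> 'e \<Rightarrow> real" where
  "ricci D \<kappa> x u v =
     (\<Sum>b\<in>Basis. curvature D (coord_field \<kappa> b) (coord_field \<kappa> u) (coord_field \<kappa> v) \<kappa> x \<bullet> b)"

text \<open>
  \<open>christoffel D \<kappa> x a c b\<close> is the symbol with lower indices \<open>a\<close>, \<open>b\<close> and upper index \<open>c\<close>:
  the \<open>c\<close>-component of the covariant derivative of the \<open>b\<close>-th coordinate field along the
  \<open>a\<close>-th one.
\<close>

definition christoffel ::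
  "('m, real^'n) connection \<Rightarrow> ('m, real^'n) chart \<Rightarrow> 'm \<Rightarrow> 'n \<Rightarrow> 'n \<Rightarrow> 'n \<Rightarrow> real" where
  "christoffel D \<kappa> x a c b =
     D (coord_field \<kappa> (axis a 1)) (coord_field \<kappa> (axis b 1)) \<kappa> x $ c"

definition ricci_comp ::
  "('m, real^'n) connection \<Rightarrow> ('m, real^'n) chart \<Rightarrow> 'm \<Rightarrow> 'n \<Rightarrow> 'n \<Rightarrow> real" where
  "ricci_comp D \<kappa> x a b = ricci D \<kappa> x (axis a 1) (axis b 1)"


section \<open>Volume forms\<close>

text \<open>
  A volume form is a nowhere vanishing form of top degree; its arguments are families of
  vectors indexed by \<open>'n\<close>.
\<close>

type_synonym ('m, 'n) top_form =
  "('m, real^'n) chart \<Rightarrow> 'm \<Rightarrow> ('n \<Rightarrow> real^'n) \<Rightarrow> real"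

definition volume_form :: "('m, real^'n) chart set \<Rightarrow> ('m, 'n) top_form \<Rightarrow> bool" where
  "volume_form A \<omega> \<longleftrightarrow>
     (\<forall>\<kappa>\<in>A. \<forall>x \<in> fst \<kappa>.
        (\<forall>V i. linear (\<lambda>u. \<omega> \<kappa> x (V(i := u)))) \<and>
        (\<forall>V i j. i \<noteq> j \<longrightarrow> V i = V j \<longrightarrow> \<omega> \<kappa> x V = 0) \<and>
        (\<exists>V. \<omega> \<kappa> x V \<noteq> 0)) \<and>
     (\<forall>\<kappa>\<in>A. \<forall>V. smooth_on (snd \<kappa> ` fst \<kappa>) (\<lambda>y. \<omega> \<kappa> (chart_inv \<kappa> y) V)) \<and>
     (\<forall>\<kappa>\<in>A. \<forall>\<kappa>'\<in>A. \<forall>x \<in> fst \<kappa> \<inter> fst \<kappa>'. \<forall>V.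
        \<omega> \<kappa>' x (\<lambda>i. jac \<kappa> \<kappa>' x (V i)) = \<omega> \<kappa> x V)"

definition preserves_form ::
  "('m, real^'n) chart set \<Rightarrow> ('m, real^'n) connection \<Rightarrow> ('m, 'n) top_form \<Rightarrow> bool" where
  "preserves_form A D \<omega> \<longleftrightarrow>
     (\<forall>W X Y. openin (manifold_topology A) W \<longrightarrow> vector_field A W X \<longrightarrow>
        (\<forall>i. vector_field A W (Y i)) \<longrightarrow>
        (\<forall>\<kappa>\<in>A. \<forall>x \<in> fst \<kappa> \<inter> W.
           chart_deriv \<kappa> (\<lambda>y. \<omega> \<kappa> y (\<lambda>i. Y i \<kappa> y)) x (X \<kappa> x) =
             (\<Sum>j\<in>UNIV. \<omega> \<kappa> x ((\<lambda>i. Y i \<kappa> x)(j := D X (Y j) \<kappa> x)))))"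


section \<open>Pseudo-Riemannian metrics\<close>

type_synonym ('m, 'e) tensor2 = "('m, 'e) chart \<Rightarrow> 'm \<Rightarrow> 'e \<Rightarrow> 'e \<Rightarrow> real"

definition has_signature ::
  "('e::euclidean_space \<Rightarrow> 'e \<Rightarrow> real) \<Rightarrow> nat \<Rightarrow> nat \<Rightarrow> bool" where
  "has_signature \<beta> p q \<longleftrightarrow>
     (\<exists>P Q. P \<inter> Q = {} \<and> independent (P \<union> Q) \<and> span (P \<union> Q) = UNIV \<and>
        card P = p \<and> card Q = q \<and>
        (\<forall>u\<in>P. \<beta> u u = 1) \<and> (\<forall>u\<in>Q. \<beta> u u = -1) \<and>
        (\<forall>u \<in> P \<union> Q. \<forall>v \<in> P \<union> Q. u \<noteq> v \<longrightarrow> \<beta> u v = 0))"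

definition pseudo_riemannian_manifold ::
  "('m, 'e::euclidean_space) chart set \<Rightarrow> nat \<Rightarrow> nat \<Rightarrow> ('m, 'e) tensor2 \<Rightarrow> bool" where
  "pseudo_riemannian_manifold A p q g \<longleftrightarrow> smooth_manifold A \<and>
     (\<forall>\<kappa>\<in>A. \<forall>u v. smooth_on (snd \<kappa> ` fst \<kappa>) (\<lambda>y. g \<kappa> (chart_inv \<kappa> y) u v)) \<and>
     (\<forall>\<kappa>\<in>A. \<forall>\<kappa>'\<in>A. \<forall>x \<in> fst \<kappa> \<inter> fst \<kappa>'. \<forall>u v.
        g \<kappa>' x (jac \<kappa> \<kappa>' x u) (jac \<kappa> \<kappa>' x v) = g \<kappa> x u v) \<and>
     (\<forall>\<kappa>\<in>A. \<forall>x \<in> fst \<kappa>.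
        bilinear (g \<kappa> x) \<and> (\<forall>u v. g \<kappa> x u v = g \<kappa> x v u) \<and> has_signature (g \<kappa> x) p q)"

definition levi_civita ::
  "('m, 'e::euclidean_space) chart set \<Rightarrow> ('m, 'e) tensor2 \<Rightarrow> ('m, 'e) connection \<Rightarrow> bool" where
  "levi_civita A g D \<longleftrightarrow> affine_connection A D \<and> torsion_free A D \<and>
     (\<forall>W X Y Z. openin (manifold_topology A) W \<longrightarrow>
        vector_field A W X \<longrightarrow> vector_field A W Y \<longrightarrow> vector_field A W Z \<longrightarrow>
        (\<forall>\<kappa>\<in>A. \<forall>x \<in> fst \<kappa> \<inter> W.
           chart_deriv \<kappa> (\<lambda>y. g \<kappa> y (Y \<kappa> y) (Z \<kappa> y)) x (X \<kappa> x) =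
             g \<kappa> x (D X Y \<kappa> x) (Z \<kappa> x) + g \<kappa> x (Y \<kappa> x) (D X Z \<kappa> x)))"

text \<open>
  For a pseudo-Riemannian metric the Levi-Civita connection is unique (up to irrelevant values),
  so the existential quantifier picks out the Ricci curvature of the metric.
\<close>

definition ricci_flat ::
  "('m, 'e::euclidean_space) chart set \<Rightarrow> ('m, 'e) tensor2 \<Rightarrow> bool" where
  "ricci_flat A g \<longleftrightarrow>
     (\<exists>D. levi_civita A g D \<and> (\<forall>\<kappa>\<in>A. \<forall>x \<in> fst \<kappa>. \<forall>u v. ricci D \<kappa> x u v = 0))"


section \<open>Fefferman--Graham ambient metrics\<close>

definition sym_prod ::
  "('e \<Rightarrow> real) \<Rightarrow> ('e \<Rightarrow> real) \<Rightarrow> 'e \<Rightarrow> 'e \<Rightarrow> real" (infixl "\<odot>" 75) where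
  "(\<alpha> \<odot> \<beta>) u v = (\<alpha> u * \<beta> v + \<beta> u * \<alpha> v) / 2"

text \<open>
  The atlas of \<open>{0<..} \<times> M \<times> UNIV\<close> with coordinates \<open>(t, x, \<rho>)\<close>. The coordinate differentials
  are the functionals \<open>d_t\<close>, \<open>d_rho\<close> and \<open>\<lambda>w. d_base w \<bullet> i\<close> for \<open>i \<in> Basis\<close>.
\<close>

definition ambient_chart ::
  "('m, 'e) chart \<Rightarrow> (real \<times> 'm \<times> real, real \<times> 'e \<times> real) chart" where
  "ambient_chart \<kappa> = ({0<..} \<times> fst \<kappa> \<times> UNIV, \<lambda>(t, x, \<rho>). (t, snd \<kappa> x, \<rho>))"

definition ambient_atlas ::
  "('m, 'e) chart set \<Rightarrow> (real \<times> 'm \<times> real, real \<times> 'e \<times> real) chart set" where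
  "ambient_atlas A = ambient_chart ` A"

definition d_t :: "real \<times> 'e \<times> real \<Rightarrow> real" where
  "d_t = (\<lambda>(a, b, c). a)"

definition d_base :: "real \<times> 'e \<times> real \<Rightarrow> 'e" where
  "d_base = (\<lambda>(a, b, c). b)"

definition d_rho :: "real \<times> 'e \<times> real \<Rightarrow> real" where
  "d_rho = (\<lambda>(a, b, c). c)"

text \<open>
  In the following definition, \<open>h \<kappa> x \<rho> i j\<close> are the coefficients of the \<open>\<rho>\<close>-dependent family of
  metrics on \<open>M\<close> in the coordinates given by \<open>\<kappa>\<close>.
\<close>

definition ricci_flat_FG_ambient_metric ::
  "('m, 'e::euclidean_space) chart set \<Rightarrow> nat \<Rightarrow> nat \<Rightarrow> ('m, 'e) tensor2 \<Rightarrow>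
    (real \<times> 'm \<times> real, real \<times> 'e \<times> real) tensor2 \<Rightarrow> bool" where
  "ricci_flat_FG_ambient_metric A p q g G \<longleftrightarrow>
     pseudo_riemannian_manifold A p q g \<and>
     pseudo_riemannian_manifold (ambient_atlas A) (p + 1) (q + 1) G \<and>
     (\<exists>h. \<forall>\<kappa>\<in>A. \<forall>x \<in> fst \<kappa>.
        (\<forall>u v. g \<kappa> x u v =
           (\<Sum>i\<in>Basis. \<Sum>j\<in>Basis. h \<kappa> x 0 i j * ((\<lambda>w. w \<bullet> i) \<odot> (\<lambda>w. w \<bullet> j)) u v)) \<and>
        (\<forall>t>0. \<forall>\<rho> u v. G (ambient_chart \<kappa>) (t, x, \<rho>) u v =
           t\<^sup>2 * (\<Sum>i\<in>Basis. \<Sum>j\<in>Basis.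
             h \<kappa> x \<rho> i j * ((\<lambda>w. d_base w \<bullet> i) \<odot> (\<lambda>w. d_base w \<bullet> j)) u v)
           + 2 * \<rho> * (d_t \<odot> d_t) u v
           + 2 * t * (d_t \<odot> d_rho) u v)) \<and>
     ricci_flat (ambient_atlas A) G"


section \<open>The cotangent bundle\<close>

text \<open>
  A covector at \<open>x\<close> is a family of components indexed by the charts around \<open>x\<close>, with the
  transformation law dual to that of vectors. Its value is fixed to be \<open>0\<close> at the other charts,
  so that distinct families are distinct covectors. With \<open>'e = real^'n\<close>, the canonical fibre
  coordinate \<open>p_a\<close> of \<open>\<xi>\<close> with respect to \<open>\<kappa>\<close> is \<open>\<xi> \<kappa> $ a = \<xi> \<kappa> \<bullet> axis a 1\<close>.
\<close>

type_synonym ('m, 'e) covector = "('m, 'e) chart \<Rightarrow> 'e"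

definition cotangent_space ::
  "('m, 'e::euclidean_space) chart set \<Rightarrow> 'm \<Rightarrow> ('m, 'e) covector set" where
  "cotangent_space A x =
     {\<xi>. (\<forall>\<kappa>\<in>A. \<forall>\<kappa>'\<in>A. x \<in> fst \<kappa> \<inter> fst \<kappa>' \<longrightarrow> (\<forall>v. \<xi> \<kappa>' \<bullet> jac \<kappa> \<kappa>' x v = \<xi> \<kappa> \<bullet> v)) \<and>
         (\<forall>\<kappa>. \<not> (\<kappa> \<in> A \<and> x \<in> fst \<kappa>) \<longrightarrow> \<xi> \<kappa> = 0)}"

definition cotangent_chart ::
  "('m, 'e::euclidean_space) chart set \<Rightarrow> ('m, 'e) chart \<Rightarrow>
    ('m \<times> ('m, 'e) covector, 'e \<times> 'e) chart" where
  "cotangent_chart A \<kappa> =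
     ({(x, \<xi>). x \<in> fst \<kappa> \<and> \<xi> \<in> cotangent_space A x}, \<lambda>(x, \<xi>). (snd \<kappa> x, \<xi> \<kappa>))"

definition cotangent_atlas ::
  "('m, 'e::euclidean_space) chart set \<Rightarrow> ('m \<times> ('m, 'e) covector, 'e \<times> 'e) chart set" where
  "cotangent_atlas A = cotangent_chart A ` A"

definition dx :: "'n \<Rightarrow> (real^'n) \<times> (real^'n) \<Rightarrow> real" where
  "dx a = (\<lambda>(x, p). x $ a)"

definition dp :: "'n \<Rightarrow> (real^'n) \<times> (real^'n) \<Rightarrow> real" where
  "dp a = (\<lambda>(x, p). p $ a)"

lemma zero_in_cotangent_space: "(\<lambda>_. 0) \<in> cotangent_space A x"
  by (simp add: cotangent_space_def)

lemma inj_cotangent_chart: "inj (cotangent_chart A)"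
proof (rule injI)
  fix \<kappa> \<kappa>' assume eq: "cotangent_chart A \<kappa> = cotangent_chart A \<kappa>'"
  have "x \<in> fst \<kappa> \<longleftrightarrow> x \<in> fst \<kappa>'" for x
    using eq zero_in_cotangent_space[of A x] by (auto simp: cotangent_chart_def set_eq_iff)
  moreover have "snd \<kappa> x = snd \<kappa>' x" for x
  proof -
    have "snd (cotangent_chart A \<kappa>) (x, \<lambda>_. 0) = snd (cotangent_chart A \<kappa>') (x, \<lambda>_. 0)"
      using eq by simp
    then show ?thesis by (simp add: cotangent_chart_def)
  qed
  ultimately show "\<kappa> = \<kappa>'" by (auto intro!: prod_eqI)
qed

lemma inj_ambient_chart: "inj ambient_chart"
proof (rule injI)
  fix \<kappa> \<kappa>' :: "('m, 'e) chart" assume eq: "ambient_chart \<kappa> = ambient_chart \<kappa>'"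
  have "x \<in> fst \<kappa> \<longleftrightarrow> x \<in> fst \<kappa>'" for x
  proof -
    have "(1, x, 0) \<in> fst (ambient_chart \<kappa>) \<longleftrightarrow> (1, x, 0) \<in> fst (ambient_chart \<kappa>')" using eq by simp
    then show ?thesis by (simp add: ambient_chart_def)
  qed
  moreover have "snd \<kappa> x = snd \<kappa>' x" for x
  proof -
    have "snd (ambient_chart \<kappa>) (1, x, 0) = snd (ambient_chart \<kappa>') (1, x, 0)"
      using eq by simp
    then show ?thesis by (simp add: ambient_chart_def)
  qed
  ultimately show "\<kappa> = \<kappa>'" by (auto intro!: prod_eqI)
qed


section \<open>The Patterson--Walker metric and its ambient metric\<close>

text \<open>
  Both are given by their components in the canonical charts; as \<open>cotangent_chart A\<close> and
  \<open>ambient_chart\<close> are injective, the underlying chart of the base manifold can be recovered,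
  see the two lemmas below. That these components fit together to tensors is not built in.
\<close>

definition patterson_walker ::
  "('m, real^'n) chart set \<Rightarrow> ('m, real^'n) connection \<Rightarrow>
    ('m \<times> ('m, real^'n) covector, (real^'n) \<times> (real^'n)) tensor2" where
  "patterson_walker A D = (\<lambda>K (x, \<xi>) u v.
     let \<kappa> = inv (cotangent_chart A) K in
       (\<Sum>a\<in>UNIV. 2 * (dx a \<odot> dp a) u v)
       - (\<Sum>a\<in>UNIV. \<Sum>b\<in>UNIV. \<Sum>c\<in>UNIV.
            2 * christoffel D \<kappa> x a c b * (\<xi> \<kappa> $ c) * (dx a \<odot> dx b) u v))"

definition patterson_walker_ambient ::
  "('m, real^'n) chart set \<Rightarrow> ('m, real^'n) connection \<Rightarrow>
    (real \<times> ('m \<times> ('m, real^'n) covector) \<times> real,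
     real \<times> ((real^'n) \<times> (real^'n)) \<times> real) tensor2" where
  "patterson_walker_ambient A D = (\<lambda>K (t, (x, \<xi>), \<rho>) u v.
     let \<kappa> = inv (cotangent_chart A) (inv ambient_chart K);
         u' = d_base u; v' = d_base v in
       2 * \<rho> * (d_t \<odot> d_t) u v + 2 * t * (d_t \<odot> d_rho) u v
       + t\<^sup>2 *
         ((\<Sum>a\<in>UNIV. 2 * (dx a \<odot> dp a) u' v')
          - (\<Sum>a\<in>UNIV. \<Sum>b\<in>UNIV. \<Sum>c\<in>UNIV.
               2 * (\<xi> \<kappa> $ c) * christoffel D \<kappa> x a c b * (dx a \<odot> dx b) u' v')
          + (\<Sum>a\<in>UNIV. \<Sum>b\<in>UNIV.
               2 * \<rho> / (real CARD('n) - 1) * ricci_comp D \<kappa> x a b * (dx a \<odot> dx b) u' v')))"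

lemma patterson_walker_cotangent_chart:
  "patterson_walker A D (cotangent_chart A \<kappa>) (x, \<xi>) u v =
     (\<Sum>a\<in>UNIV. 2 * (dx a \<odot> dp a) u v)
     - (\<Sum>a\<in>UNIV. \<Sum>b\<in>UNIV. \<Sum>c\<in>UNIV.
          2 * christoffel D \<kappa> x a c b * (\<xi> \<kappa> $ c) * (dx a \<odot> dx b) u v)"
  by (simp add: patterson_walker_def inv_f_f[OF inj_cotangent_chart])

lemma patterson_walker_ambient_chart:
  fixes D :: "('m, real^'n) connection"
  shows "patterson_walker_ambient A D (ambient_chart (cotangent_chart A \<kappa>)) (t, (x, \<xi>), \<rho>) u v =
     2 * \<rho> * (d_t \<odot> d_t) u v + 2 * t * (d_t \<odot> d_rho) u v
     + t\<^sup>2 *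
       ((\<Sum>a\<in>UNIV. 2 * (dx a \<odot> dp a) (d_base u) (d_base v))
        - (\<Sum>a\<in>UNIV. \<Sum>b\<in>UNIV. \<Sum>c\<in>UNIV.
             2 * (\<xi> \<kappa> $ c) * christoffel D \<kappa> x a c b * (dx a \<odot> dx b) (d_base u) (d_base v))
        + (\<Sum>a\<in>UNIV. \<Sum>b\<in>UNIV.
             2 * \<rho> / (real CARD('n) - 1) * ricci_comp D \<kappa> x a b
               * (dx a \<odot> dx b) (d_base u) (d_base v)))"
  by (simp add: patterson_walker_ambient_def Let_def
      inv_f_f[OF inj_cotangent_chart] inv_f_f[OF inj_ambient_chart])

end

theory Submission
  imports Defs
begin

text \<open>
  Let \<open>n\<close> be the dimension of the base and \<open>S(u,v) = (Ric(u,v) + Ric(v,u)) / (n-1)\<close>. In the canonical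
  coordinates \<open>(t, (y, p), \<rho>)\<close> the ambient metric is
  \<open>2\<rho> dt\<^sup>2 + 2t dt d\<rho> + t\<^sup>2 (2 dy dp + h)\<close>, where the horizontal form
  \<open>h(u,v) = \<rho> S(u,v) - 2 p\<cdot>\<Gamma>(u,v)\<close> is affine in \<open>p\<close> and \<open>\<rho>\<close>. The \<open>p\<close>-directions are isotropic,
  so \<open>h\<close> enters the inverse metric linearly and the Christoffel symbols can be written down in closed
  form (\<open>chr\<close>); \<open>ambient_compatible\<close> verifies that they preserve the metric. In the Ricci curvature,
  which is \<open>div \<Gamma> - d(tr \<Gamma>) + tr \<Gamma>(\<cdot>, \<Gamma>) - tr (\<Gamma> \<Gamma>)\<close> for the ambient symbols, no term
  containing \<open>p\<close> or \<open>\<rho>\<close> survives: as endomorphisms, the Christoffel symbols contain \<open>p\<close> and \<open>\<rho>\<close> only in the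
  blocks that map the \<open>y\<close>-directions to the \<open>p\<close>- and \<open>\<rho>\<close>-directions, and the blocks back are zero. The
  \<open>y\<close>-block and the \<open>p\<close>-block contribute one copy of the Ricci curvature of the base each, the terms
  with \<open>1/t\<^sup>2\<close> cancel, and \<open>S\<close> appears with the coefficient
  \<open>-1/2 - (2n+1)/2 + 2 = -(n-1)\<close>. Hence the result is \<open>Ric(u,v) + Ric(v,u) - (n-1) S(u,v) = 0\<close>
  (\<open>ricci_chr\<close>).

  What remains is to pass from charts to the manifold. The components of the metric fit together because the
  second derivatives of a transition map, which enter through the fibre coordinates of the cotangent bundle,
  are the inhomogeneous term in the transformation law of Christoffel symbols
  (\<open>walker_metric_change_chart\<close>), and because curvature is a tensor (\<open>curvature_in_chart\<close>). The
  ambient Christoffel symbols fit together to a connection by the uniqueness of the Levi-Civita connection,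
  in the form of a statement about transformation laws (\<open>christoffel_change_chart\<close>). The signature is
  read off from a hyperbolic basis (\<open>has_signature_hyperbolic_basis\<close>), and the total spaces inherit
  the Hausdorff property and a countable basis from the base (\<open>smooth_manifold_total_space\<close>).
\<close>

section \<open>Calculus of smooth maps\<close>

lemma Ck_on_transform:
  assumes "open S" "Ck_on k f S" "\<And>x. x \<in> S \<Longrightarrow> f x = g x"
  shows "Ck_on k g S"
  using assms(2,3)
proof (induction k arbitrary: f g)
  case 0
  then show ?case using continuous_on_cong[of S S f g] by simp
next
  case (Suc k)
  have f: "(f has_derivative frechet_derivative f (at x)) (at x)" if "x \<in> S" for x
    using Suc.prems(1) that unfolding Ck_on.simps(2) differentiable_on_eq_differentiable_at[OF assms(1)]
      frechet_derivative_works[symmetric] by blast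
  have g: "(g has_derivative frechet_derivative f (at x)) (at x)" if "x \<in> S" for x
    by (rule has_derivative_transform_within_open[OF f[OF that] assms(1) that Suc.prems(2)])
  have "g differentiable_on S"
    unfolding differentiable_on_eq_differentiable_at[OF assms(1)]
    using differentiableI[OF g] by blast
  moreover have "Ck_on k (\<lambda>x. frechet_derivative g (at x) v) S" for v
  proof (rule Suc.IH[of "\<lambda>x. frechet_derivative f (at x) v"])
    show "Ck_on k (\<lambda>x. frechet_derivative f (at x) v) S" using Suc.prems(1) by simp
    show "frechet_derivative f (at x) v = frechet_derivative g (at x) v" if "x \<in> S" for x
      by (rule fun_cong[OF frechet_derivative_at[OF g[OF that]]])
  qed
  ultimately show ?case by simp
qed

lemma Ck_on_subset: "Ck_on k f S \<Longrightarrow> T \<subseteq> S \<Longrightarrow> Ck_on k f T"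
  by (induction k arbitrary: f) (auto intro: continuous_on_subset differentiable_on_subset)

lemma Ck_on_Suc_imp: "Ck_on (Suc k) f S \<Longrightarrow> Ck_on k f S"
proof (induction k arbitrary: f)
  case 0
  then show ?case by (simp add: differentiable_imp_continuous_on)
next
  case (Suc k)
  then show ?case unfolding Ck_on.simps(2)[of "Suc k"] Ck_on.simps(2)[of k f] by blast
qed

lemma Ck_on_const: "Ck_on k (\<lambda>_. c) S"
proof (induction k arbitrary: c)
  case (Suc k)
  then show ?case by simp
qed simp

lemma Ck_on_SucI:
  assumes S: "open S" and D: "\<And>x. x \<in> S \<Longrightarrow> (f has_derivative f' x) (at x)"
    and C: "\<And>v. Ck_on k (\<lambda>x. f' x v) S"
  shows "Ck_on (Suc k) f S"
proof -
  have "f differentiable_on S"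
    unfolding differentiable_on_eq_differentiable_at[OF S] using differentiableI[OF D] by blast
  moreover have "Ck_on k (\<lambda>x. frechet_derivative f (at x) v) S" for v
    by (rule Ck_on_transform[OF S C[of v]]) (simp add: frechet_derivative_at[OF D, symmetric])
  ultimately show ?thesis by simp
qed

lemma Ck_on_derivative:
  assumes "open S" "Ck_on (Suc k) f S" "x \<in> S"
  shows "(f has_derivative frechet_derivative f (at x)) (at x)"
  using assms(2,3) unfolding Ck_on.simps(2) differentiable_on_eq_differentiable_at[OF assms(1)]
    frechet_derivative_works[symmetric] by blast

lemma Ck_on_bounded_linear:
  assumes "open S" "bounded_linear L"
  shows "Ck_on k L S"
proof (cases k)
  case 0
  then show ?thesis using assms by (simp add: linear_continuous_on)
next
  case (Suc k')
  then show ?thesis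
    using Ck_on_SucI[OF assms(1), of L "\<lambda>_. L" k'] assms(2)
    by (simp add: bounded_linear_imp_has_derivative Ck_on_const)
qed

lemma Ck_on_add:
  assumes S: "open S" shows "Ck_on k f S \<Longrightarrow> Ck_on k g S \<Longrightarrow> Ck_on k (\<lambda>x. f x + g x) S"
proof (induction k arbitrary: f g)
  case 0
  then show ?case by (simp add: continuous_on_add)
next
  case (Suc k)
  show ?case
    by (rule Ck_on_SucI[OF S has_derivative_add[OF Ck_on_derivative[OF S Suc.prems(1)]
            Ck_on_derivative[OF S Suc.prems(2)]]])
      (use Suc in auto)
qed

lemma Ck_on_bilinear:
  assumes S: "open S" and B: "bounded_bilinear B"
  shows "Ck_on k f S \<Longrightarrow> Ck_on k g S \<Longrightarrow> Ck_on k (\<lambda>x. B (f x) (g x)) S"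
proof (induction k arbitrary: f g)
  case 0
  then show ?case by (simp add: bounded_bilinear.continuous_on[OF B])
next
  case (Suc k)
  show ?case
  proof (rule Ck_on_SucI[OF S bounded_bilinear.FDERIV[OF B Ck_on_derivative[OF S Suc.prems(1)]
            Ck_on_derivative[OF S Suc.prems(2)]]])
    show "Ck_on k (\<lambda>x. B (f x) (frechet_derivative g (at x) v)
        + B (frechet_derivative f (at x) v) (g x)) S" for v
      by (intro Ck_on_add[OF S] Suc.IH Ck_on_Suc_imp[OF Suc.prems(1)] Ck_on_Suc_imp[OF Suc.prems(2)])
        (use Suc.prems in auto)
  qed auto
qed

lemma Ck_on_sum:
  assumes "open S" "\<And>i. i \<in> I \<Longrightarrow> Ck_on k (f i) S"
  shows "Ck_on k (\<lambda>x. \<Sum>i\<in>I. f i x) S"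
  using assms(2)
  by (induction I rule: infinite_finite_induct) (auto intro: Ck_on_const Ck_on_add[OF assms(1)])

lemma linear_eq_sum_Basis:
  fixes L :: "'a::euclidean_space \<Rightarrow> 'b::real_normed_vector"
  assumes "linear L" shows "L v = (\<Sum>b\<in>Basis. (v \<bullet> b) *\<^sub>R L b)"
proof -
  have "L v = L (\<Sum>b\<in>Basis. (v \<bullet> b) *\<^sub>R b)" by (simp add: euclidean_representation)
  also have "\<dots> = (\<Sum>b\<in>Basis. (v \<bullet> b) *\<^sub>R L b)"
    by (simp add: linear_sum[OF assms] linear_scale[OF assms])
  finally show ?thesis .
qed

text \<open>
  The chain rule applies the derivative of \<open>g\<close> to a vector that varies. Expanding this vector in the basis
  turns the derivative into a sum of functions of the form \<open>frechet_derivative g (at (f x)) b\<close> with fixed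
  \<open>b\<close>, to which the induction hypothesis applies.
\<close>

lemma Ck_on_compose:
  fixes f :: "'a::real_normed_vector \<Rightarrow> 'b::euclidean_space"
    and g :: "'b \<Rightarrow> 'c::real_normed_vector"
  assumes S: "open S" and T: "open T" and sub: "f ` S \<subseteq> T"
  shows "Ck_on k f S \<Longrightarrow> Ck_on k g T \<Longrightarrow> Ck_on k (\<lambda>x. g (f x)) S"
proof (induction k arbitrary: g)
  case 0
  then show ?case using sub continuous_on_compose2 by auto
next
  case (Suc k)
  show ?case
  proof (rule Ck_on_SucI[OF S])
    fix x assume x: "x \<in> S"
    then have fx: "f x \<in> T" using sub by blast
    show "((\<lambda>x. g (f x)) has_derivative (\<lambda>v. \<Sum>b\<in>Basis.
        (frechet_derivative f (at x) v \<bullet> b) *\<^sub>R frechet_derivative g (at (f x)) b)) (at x)"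
    proof -
      have dg: "(g has_derivative frechet_derivative g (at (f x))) (at (f x))"
        by (rule Ck_on_derivative[OF T Suc.prems(2) fx])
      have "((\<lambda>x. g (f x)) has_derivative
          (\<lambda>v. frechet_derivative g (at (f x)) (frechet_derivative f (at x) v))) (at x)"
        by (rule has_derivative_compose[OF Ck_on_derivative[OF S Suc.prems(1) x] dg])
      moreover have "(\<lambda>v. frechet_derivative g (at (f x)) (frechet_derivative f (at x) v)) =
          (\<lambda>v. \<Sum>b\<in>Basis.
            (frechet_derivative f (at x) v \<bullet> b) *\<^sub>R frechet_derivative g (at (f x)) b)"
        by (rule ext) (rule linear_eq_sum_Basis[OF has_derivative_linear[OF dg]])
      ultimately show ?thesis by (rule back_subst)
    qed
  next
    fix v
    have "Ck_on k (\<lambda>x. frechet_derivative f (at x) v \<bullet> b) S" for b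
      using Ck_on_bilinear[OF S bounded_bilinear_inner _ Ck_on_const] Suc.prems by auto
    moreover have "Ck_on k (\<lambda>x. frechet_derivative g (at (f x)) b) S" for b
      by (rule Suc.IH[OF Ck_on_Suc_imp[OF Suc.prems(1)], of "\<lambda>z. frechet_derivative g (at z) b"])
        (use Suc.prems in auto)
    ultimately show "Ck_on k (\<lambda>x. \<Sum>b\<in>Basis.
        (frechet_derivative f (at x) v \<bullet> b) *\<^sub>R frechet_derivative g (at (f x)) b) S"
      by (intro Ck_on_sum[OF S] Ck_on_bilinear[OF S bounded_bilinear_scaleR])
  qed
qed

lemma Ck_on_inverse:
  fixes f :: "'a::real_normed_vector \<Rightarrow> real"
  assumes S: "open S" and nz: "\<And>x. x \<in> S \<Longrightarrow> f x \<noteq> 0"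
  shows "Ck_on k f S \<Longrightarrow> Ck_on k (\<lambda>x. inverse (f x)) S"
proof (induction k)
  case 0
  then show ?case using nz by (simp add: continuous_on_inverse)
next
  case (Suc k)
  note IH = Suc.IH[OF Ck_on_Suc_imp[OF Suc.prems]]
  show ?case
  proof (rule Ck_on_SucI[OF S Deriv.has_derivative_inverse[OF nz Ck_on_derivative[OF S Suc.prems]]])
    fix v
    have df: "Ck_on k (\<lambda>x. frechet_derivative f (at x) v) S"
      using Suc.prems by simp
    have "Ck_on k (\<lambda>x. (-1) * ((inverse (f x) * frechet_derivative f (at x) v) * inverse (f x))) S"
      by (intro Ck_on_bilinear[OF S bounded_bilinear_mult] Ck_on_const IH df)
    then show "Ck_on k (\<lambda>x. - (inverse (f x) * frechet_derivative f (at x) v * inverse (f x))) S"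
      by simp
  qed auto
qed

lemma smooth_on_transform:
  "open S \<Longrightarrow> smooth_on S f \<Longrightarrow> (\<And>x. x \<in> S \<Longrightarrow> f x = g x) \<Longrightarrow> smooth_on S g"
  unfolding smooth_on_def using Ck_on_transform by blast

lemma smooth_on_cong:
  "open S \<Longrightarrow> (\<And>x. x \<in> S \<Longrightarrow> f x = g x) \<Longrightarrow> smooth_on S f \<longleftrightarrow> smooth_on S g"
  using smooth_on_transform[of S f g] smooth_on_transform[of S g f] by auto

lemma smooth_on_subset: "smooth_on S f \<Longrightarrow> T \<subseteq> S \<Longrightarrow> smooth_on T f"
  unfolding smooth_on_def using Ck_on_subset by blast

lemma smooth_on_const [simp]: "smooth_on S (\<lambda>_. c)"
  by (simp add: smooth_on_def Ck_on_const)

lemma smooth_on_bounded_linear: "open S \<Longrightarrow> bounded_linear L \<Longrightarrow> smooth_on S L"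
  by (simp add: smooth_on_def Ck_on_bounded_linear)

lemma smooth_on_add:
  "open S \<Longrightarrow> smooth_on S f \<Longrightarrow> smooth_on S g \<Longrightarrow> smooth_on S (\<lambda>x. f x + g x)"
  by (simp add: smooth_on_def Ck_on_add)

lemma smooth_on_bilinear:
  "open S \<Longrightarrow> bounded_bilinear B \<Longrightarrow> smooth_on S f \<Longrightarrow> smooth_on S g \<Longrightarrow>
    smooth_on S (\<lambda>x. B (f x) (g x))"
  by (simp add: smooth_on_def Ck_on_bilinear)

lemmas smooth_on_mult = smooth_on_bilinear[OF _ bounded_bilinear_mult]
lemmas smooth_on_scaleR = smooth_on_bilinear[OF _ bounded_bilinear_scaleR]
lemmas smooth_on_inner = smooth_on_bilinear[OF _ bounded_bilinear_inner]

lemma smooth_on_uminus: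
  assumes "open S" "smooth_on S f" shows "smooth_on S (\<lambda>x. - f x)"
  using smooth_on_scaleR[OF assms(1) smooth_on_const[where c="-1"] assms(2)] by simp

lemma smooth_on_diff:
  assumes "open S" "smooth_on S f" "smooth_on S g" shows "smooth_on S (\<lambda>x. f x - g x)"
  using smooth_on_add[OF assms(1,2) smooth_on_uminus[OF assms(1,3)]] by simp

lemma smooth_on_sum:
  "open S \<Longrightarrow> (\<And>i. i \<in> I \<Longrightarrow> smooth_on S (f i)) \<Longrightarrow> smooth_on S (\<lambda>x. \<Sum>i\<in>I. f i x)"
  by (simp add: smooth_on_def Ck_on_sum)

lemma smooth_on_compose:
  fixes f :: "'a::real_normed_vector \<Rightarrow> 'b::euclidean_space"
  assumes "open S" "open T" "smooth_on S f" "smooth_on T g" "\<And>x. x \<in> S \<Longrightarrow> f x \<in> T"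
  shows "smooth_on S (\<lambda>x. g (f x))"
  unfolding smooth_on_def
proof
  have "f ` S \<subseteq> T" using assms(5) by blast
  then show "Ck_on k (\<lambda>x. g (f x)) S" for k
    by (rule Ck_on_compose[OF assms(1,2)]) (use assms(3,4) in \<open>simp_all add: smooth_on_def\<close>)
qed

lemma smooth_on_linear_compose:
  fixes f :: "'a::real_normed_vector \<Rightarrow> 'b::euclidean_space"
  assumes "open S" "bounded_linear L" "smooth_on S f"
  shows "smooth_on S (\<lambda>x. L (f x))"
  by (rule smooth_on_compose[OF assms(1) open_UNIV assms(3) smooth_on_bounded_linear[OF _ assms(2)]])
    auto

lemma smooth_on_inverse:
  fixes f :: "'a::real_normed_vector \<Rightarrow> real"
  shows "open S \<Longrightarrow> (\<And>x. x \<in> S \<Longrightarrow> f x \<noteq> 0) \<Longrightarrow> smooth_on S f \<Longrightarrow> smooth_on S (\<lambda>x. inverse (f x))"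
  by (simp add: smooth_on_def Ck_on_inverse)

lemma smooth_on_Pair:
  fixes f :: "'a::real_normed_vector \<Rightarrow> 'b::euclidean_space" and g :: "'a \<Rightarrow> 'c::euclidean_space"
  assumes S: "open S" and "smooth_on S f" "smooth_on S g"
  shows "smooth_on S (\<lambda>x. (f x, g x))"
proof -
  have "bounded_linear (\<lambda>a::'b. (a, 0::'c))" "bounded_linear (\<lambda>b::'c. (0::'b, b))"
    by (intro bounded_linear_Pair bounded_linear_ident bounded_linear_zero)+
  from smooth_on_add[OF S smooth_on_linear_compose[OF S this(1) assms(2)]
      smooth_on_linear_compose[OF S this(2) assms(3)]]
  show ?thesis by simp
qed

lemma smooth_on_imp_has_derivative:
  "open S \<Longrightarrow> smooth_on S f \<Longrightarrow> x \<in> S \<Longrightarrow>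
    (f has_derivative frechet_derivative f (at x)) (at x)"
  unfolding smooth_on_def using Ck_on_derivative by blast

lemma smooth_on_imp_differentiable:
  "open S \<Longrightarrow> smooth_on S f \<Longrightarrow> x \<in> S \<Longrightarrow> f differentiable at x"
  using smooth_on_imp_has_derivative differentiable_def by blast

lemma smooth_on_imp_continuous_on: "smooth_on S f \<Longrightarrow> continuous_on S f"
  unfolding smooth_on_def using Ck_on.simps(1) by blast

lemma smooth_on_derivative:
  "smooth_on S f \<Longrightarrow> smooth_on S (\<lambda>x. frechet_derivative f (at x) v)"
  unfolding smooth_on_def using Ck_on.simps(2) by blast

lemma smooth_on_derivative_along:
  fixes f :: "'a::euclidean_space \<Rightarrow> 'b::real_normed_vector"
  assumes S: "open S" and f: "smooth_on S f" and h: "smooth_on S h"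
  shows "smooth_on S (\<lambda>x. frechet_derivative f (at x) (h x))"
proof (rule smooth_on_transform[OF S])
  show "smooth_on S (\<lambda>x. \<Sum>b\<in>Basis. (h x \<bullet> b) *\<^sub>R frechet_derivative f (at x) b)"
    by (intro smooth_on_sum smooth_on_scaleR smooth_on_inner smooth_on_derivative S f h smooth_on_const)
  show "(\<Sum>b\<in>Basis. (h x \<bullet> b) *\<^sub>R frechet_derivative f (at x) b) =
      frechet_derivative f (at x) (h x)" if "x \<in> S" for x
    by (rule linear_eq_sum_Basis[OF
          has_derivative_linear[OF smooth_on_imp_has_derivative[OF S f that]], symmetric])
qed

lemma frechet_derivative_inner_left:
  fixes f :: "'a::real_normed_vector \<Rightarrow> 'b::real_inner"
  assumes "f differentiable at x"
  shows "frechet_derivative (\<lambda>y. f y \<bullet> w) (at x) v = frechet_derivative f (at x) v \<bullet> w"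
proof -
  have "((\<lambda>y. f y \<bullet> w) has_derivative (\<lambda>v. frechet_derivative f (at x) v \<bullet> w)) (at x)"
    using assms by (intro has_derivative_inner_left) (simp add: frechet_derivative_works)
  from frechet_derivative_at[OF this, symmetric] show ?thesis by simp
qed

lemma line_has_real_derivative:
  fixes f :: "'a::real_normed_vector \<Rightarrow> real"
  assumes "(f has_derivative f') (at (p + s *\<^sub>R u))"
  shows "((\<lambda>s. f (p + s *\<^sub>R u)) has_real_derivative f' u) (at s)"
proof -
  have "((\<lambda>s. p + s *\<^sub>R u) has_derivative (\<lambda>h. h *\<^sub>R u)) (at s)"
    by (auto intro!: derivative_eq_intros)
  from has_derivative_compose[OF this assms]
  have "((\<lambda>s. f (p + s *\<^sub>R u)) has_derivative (\<lambda>h. f' (h *\<^sub>R u))) (at s)" .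
  then show ?thesis
    using linear_scale[OF has_derivative_linear[OF assms]]
    by (simp add: has_field_derivative_def mult_commute_abs)
qed

text \<open>
  The second difference of a function in two directions is, by the mean value theorem applied
  in either order, a mixed derivative at a nearby point; continuity of the mixed derivatives
  then forces them to agree.
\<close>

lemma second_difference_mean_value:
  fixes f :: "'a::real_normed_vector \<Rightarrow> real"
  assumes S: "open S" and f: "Ck_on 2 f S" and s: "s > 0"
    and sub: "\<And>a b. 0 \<le> a \<Longrightarrow> a \<le> s \<Longrightarrow> 0 \<le> b \<Longrightarrow> b \<le> s \<Longrightarrow> x + a *\<^sub>R u + b *\<^sub>R v \<in> S"
  obtains a b where "0 < a" "a < s" "0 < b" "b < s"
    "f (x + s *\<^sub>R u + s *\<^sub>R v) - f (x + s *\<^sub>R u) - f (x + s *\<^sub>R v) + f x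
      = s\<^sup>2 * frechet_derivative (\<lambda>y. frechet_derivative f (at y) u)
          (at (x + a *\<^sub>R u + b *\<^sub>R v)) v"
proof -
  let ?f' = "\<lambda>y. frechet_derivative f (at y)"
  have f1: "Ck_on (Suc 1) f S" using f by (simp add: numeral_2_eq_2)
  have f2: "Ck_on (Suc 0) (\<lambda>y. ?f' y u) S" using f by (simp add: numeral_2_eq_2)
  have d1: "((\<lambda>a. f (x + a *\<^sub>R u + s *\<^sub>R v) - f (x + a *\<^sub>R u)) has_real_derivative
      ?f' (x + a *\<^sub>R u + s *\<^sub>R v) u - ?f' (x + a *\<^sub>R u) u) (at a)" if a: "0 \<le> a" "a \<le> s" for a
  proof -
    have "x + a *\<^sub>R u + s *\<^sub>R v \<in> S" "x + a *\<^sub>R u \<in> S"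
      using sub[of a s] sub[of a 0] a s by auto
    then have "(f has_derivative ?f' ((x + s *\<^sub>R v) + a *\<^sub>R u)) (at ((x + s *\<^sub>R v) + a *\<^sub>R u))"
      "(f has_derivative ?f' (x + a *\<^sub>R u)) (at (x + a *\<^sub>R u))"
      using Ck_on_derivative[OF S f1] by (simp_all add: ac_simps)
    from DERIV_diff[OF line_has_real_derivative[OF this(1)] line_has_real_derivative[OF this(2)]]
    show ?thesis by (simp add: ac_simps)
  qed
  obtain a where a: "0 < a" "a < s"
    and eq1: "(f (x + s *\<^sub>R u + s *\<^sub>R v) - f (x + s *\<^sub>R u)) - (f (x + 0 *\<^sub>R u + s *\<^sub>R v) - f (x + 0 *\<^sub>R u))
      = (s - 0) * (?f' (x + a *\<^sub>R u + s *\<^sub>R v) u - ?f' (x + a *\<^sub>R u) u)"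
    using MVT2[OF s d1] by blast
  have d2: "((\<lambda>b. ?f' (x + a *\<^sub>R u + b *\<^sub>R v) u) has_real_derivative
      frechet_derivative (\<lambda>y. ?f' y u) (at (x + a *\<^sub>R u + b *\<^sub>R v)) v) (at b)"
    if "0 \<le> b" "b \<le> s" for b
    by (rule line_has_real_derivative[OF Ck_on_derivative[OF S f2 sub]]) (use a that in auto)
  obtain b where b: "0 < b" "b < s"
    and eq2: "?f' (x + a *\<^sub>R u + s *\<^sub>R v) u - ?f' (x + a *\<^sub>R u + 0 *\<^sub>R v) u
      = (s - 0) * frechet_derivative (\<lambda>y. ?f' y u) (at (x + a *\<^sub>R u + b *\<^sub>R v)) v"
    using MVT2[OF s d2] by blast
  show thesis
    by (rule that[OF a b]) (use eq1 eq2 in \<open>simp add: power2_eq_square algebra_simps\<close>)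
qed

lemma symmetric_second_derivative_real:
  fixes f :: "'a::real_normed_vector \<Rightarrow> real"
  assumes S: "open S" and f: "Ck_on 2 f S" and x: "x \<in> S"
  shows "frechet_derivative (\<lambda>y. frechet_derivative f (at y) u) (at x) v =
    frechet_derivative (\<lambda>y. frechet_derivative f (at y) v) (at x) u" (is "?A x = ?B x")
proof -
  have cont: "continuous_on S ?A" "continuous_on S ?B"
    using f by (simp_all add: numeral_2_eq_2)
  have "\<bar>?A x - ?B x\<bar> < e" if e: "e > 0" for e
  proof -
    have "(?A \<longlongrightarrow> ?A x) (nhds x)" "(?B \<longlongrightarrow> ?B x) (nhds x)"
      using cont x tendsto_at_iff_tendsto_nhds[of ?A x] tendsto_at_iff_tendsto_nhds[of ?B x]
      by (simp_all only: continuous_on_eq_continuous_at[OF S] isCont_def)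
    then have "\<forall>\<^sub>F y in nhds x. dist (?A y) (?A x) < e/2" "\<forall>\<^sub>F y in nhds x. dist (?B y) (?B x) < e/2"
      using e by (simp_all only: tendsto_iff half_gt_zero)
    moreover have "\<forall>\<^sub>F y in nhds x. y \<in> S" using S x eventually_nhds_in_open by blast
    ultimately have "\<forall>\<^sub>F y in nhds x. y \<in> S \<and> dist (?A y) (?A x) < e/2 \<and> dist (?B y) (?B x) < e/2"
      by (intro eventually_conj)
    then obtain d where d: "d > 0"
      "\<And>y. dist y x < d \<Longrightarrow> y \<in> S \<and> dist (?A y) (?A x) < e/2 \<and> dist (?B y) (?B x) < e/2"
      by (auto simp: eventually_nhds_metric)
    define K where "K = norm u + norm v + 1"
    define s where "s = d / (2 * K)"
    have pos: "K > 0" by (simp add: K_def add_nonneg_pos)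
    have s: "s > 0" using d(1) pos by (simp add: s_def)
    have near: "dist (x + a *\<^sub>R w + b *\<^sub>R z) x < d"
      if "0 \<le> a" "a \<le> s" "0 \<le> b" "b \<le> s" "{w, z} = {u, v}" for a b w z
    proof -
      have "dist (x + a *\<^sub>R w + b *\<^sub>R z) x = norm (a *\<^sub>R w + b *\<^sub>R z)"
        by (simp add: dist_norm algebra_simps)
      also have "\<dots> \<le> a * norm w + b * norm z"
        using norm_triangle_ineq[of "a *\<^sub>R w" "b *\<^sub>R z"] that by simp
      also have "\<dots> \<le> s * norm w + s * norm z"
        using that by (intro add_mono mult_right_mono) auto
      also have "\<dots> \<le> s * K"
        using that(5) s by (auto simp: K_def doubleton_eq_iff algebra_simps)
      also have "\<dots> = d / 2" using pos by (simp add: s_def)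
      also have "\<dots> < d" using d(1) by simp
      finally show ?thesis .
    qed
    obtain a b where ab: "0 < a" "a < s" "0 < b" "b < s"
      and A: "f (x + s *\<^sub>R u + s *\<^sub>R v) - f (x + s *\<^sub>R u) - f (x + s *\<^sub>R v) + f x
        = s\<^sup>2 * ?A (x + a *\<^sub>R u + b *\<^sub>R v)"
      by (rule second_difference_mean_value[OF S f s, of x u v]) (use near[of _ _ u v] d(2) in blast)+
    obtain a' b' where ab': "0 < a'" "a' < s" "0 < b'" "b' < s"
      and B: "f (x + s *\<^sub>R v + s *\<^sub>R u) - f (x + s *\<^sub>R v) - f (x + s *\<^sub>R u) + f x
        = s\<^sup>2 * ?B (x + a' *\<^sub>R v + b' *\<^sub>R u)"
      by (rule second_difference_mean_value[OF S f s, of x v u])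
        (use near[of _ _ v u, OF _ _ _ _ insert_commute] d(2) in blast)+
    have "s\<^sup>2 * ?A (x + a *\<^sub>R u + b *\<^sub>R v) = s\<^sup>2 * ?B (x + a' *\<^sub>R v + b' *\<^sub>R u)"
      unfolding A[symmetric] B[symmetric] by (simp add: algebra_simps)
    then have "?A (x + a *\<^sub>R u + b *\<^sub>R v) = ?B (x + a' *\<^sub>R v + b' *\<^sub>R u)" using s by simp
    moreover have "dist (?A (x + a *\<^sub>R u + b *\<^sub>R v)) (?A x) < e/2"
      using near[of a b u v] ab d(2) by simp
    moreover have "dist (?B (x + a' *\<^sub>R v + b' *\<^sub>R u)) (?B x) < e/2"
      using near[of a' b' v u] ab' d(2) by (simp add: insert_commute)
    ultimately show ?thesis unfolding dist_real_def by linarith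
  qed
  from this[of "\<bar>?A x - ?B x\<bar>"] show ?thesis by auto
qed

lemma symmetric_second_derivative:
  fixes f :: "'a::real_normed_vector \<Rightarrow> 'b::euclidean_space"
  assumes S: "open S" and f: "smooth_on S f" and x: "x \<in> S"
  shows "frechet_derivative (\<lambda>y. frechet_derivative f (at y) u) (at x) v =
    frechet_derivative (\<lambda>y. frechet_derivative f (at y) v) (at x) u"
proof (rule euclidean_eqI)
  fix b :: 'b
  have fb: "smooth_on S (\<lambda>y. f y \<bullet> b)" by (intro smooth_on_inner S f smooth_on_const)
  have eq: "frechet_derivative (\<lambda>y. frechet_derivative f (at y) u) (at x) v \<bullet> b
      = frechet_derivative (\<lambda>y. frechet_derivative (\<lambda>y. f y \<bullet> b) (at y) u) (at x) v" for u v
  proof -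
    have du: "smooth_on S (\<lambda>y. frechet_derivative f (at y) u)" by (rule smooth_on_derivative[OF f])
    have "frechet_derivative (\<lambda>y. frechet_derivative f (at y) u) (at x) v \<bullet> b
        = frechet_derivative (\<lambda>y. frechet_derivative f (at y) u \<bullet> b) (at x) v"
      by (simp add: frechet_derivative_inner_left smooth_on_imp_differentiable[OF S du x])
    also have "\<dots> = frechet_derivative (\<lambda>y. frechet_derivative (\<lambda>y. f y \<bullet> b) (at y) u) (at x) v"
    proof (rule fun_cong[OF frechet_derivative_transform_within_open[OF _ S x]])
      show "(\<lambda>y. frechet_derivative f (at y) u \<bullet> b) differentiable at x"
        by (intro smooth_on_imp_differentiable[OF S _ x] smooth_on_inner S du smooth_on_const)
    qed (simp add: frechet_derivative_inner_left smooth_on_imp_differentiable[OF S f])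
    finally show ?thesis .
  qed
  show "frechet_derivative (\<lambda>y. frechet_derivative f (at y) u) (at x) v \<bullet> b =
    frechet_derivative (\<lambda>y. frechet_derivative f (at y) v) (at x) u \<bullet> b"
    unfolding eq using fb S x by (intro symmetric_second_derivative_real) (auto simp: smooth_on_def)
qed

lemma linear_derivative_of_linear_family:
  fixes L :: "'a::real_normed_vector \<Rightarrow> 'b::real_vector \<Rightarrow> 'c::real_normed_vector"
  assumes S: "open S" "x \<in> S" and lin: "\<And>y. y \<in> S \<Longrightarrow> linear (L y)"
    and diff: "\<And>v. (\<lambda>y. L y v) differentiable at x"
  shows "linear (\<lambda>v. frechet_derivative (\<lambda>y. L y v) (at x) u)"
proof -
  let ?D = "\<lambda>v. frechet_derivative (\<lambda>y. L y v) (at x)"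
  have D: "((\<lambda>y. L y v) has_derivative ?D v) (at x)" for v
    using diff frechet_derivative_works by blast
  show ?thesis
  proof (rule linearI)
    fix v w and c :: real
    have "((\<lambda>y. L y (v + w)) has_derivative (\<lambda>u. ?D v u + ?D w u)) (at x)"
      by (rule has_derivative_transform_within_open[OF has_derivative_add[OF D D] S])
        (simp add: linear_add[OF lin])
    from frechet_derivative_at[OF this, symmetric] show "?D (v + w) u = ?D v u + ?D w u" by simp
    have "((\<lambda>y. L y (c *\<^sub>R v)) has_derivative (\<lambda>u. c *\<^sub>R ?D v u)) (at x)"
      by (rule has_derivative_transform_within_open[OF has_derivative_scaleR_right[OF D] S])
        (simp add: linear_scale[OF lin])
    from frechet_derivative_at[OF this, symmetric] show "?D (c *\<^sub>R v) u = c *\<^sub>R ?D v u" by simp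
  qed
qed

text \<open>
  Product rule for a family of linear maps evaluated on a moving vector. In finite dimensions
  differentiability of such a family can be tested on each fixed vector, which is how the smoothness of
  tensor fields is expressed here.
\<close>

lemma has_derivative_linear_family:
  fixes L :: "'a::real_normed_vector \<Rightarrow> 'b::euclidean_space \<Rightarrow> 'c::real_normed_vector"
  assumes S: "open S" "x \<in> S" and lin: "\<And>y. y \<in> S \<Longrightarrow> linear (L y)"
    and diff: "\<And>v. (\<lambda>y. L y v) differentiable at x"
    and V: "(V has_derivative V') (at x)"
  shows "((\<lambda>y. L y (V y)) has_derivative
    (\<lambda>u. frechet_derivative (\<lambda>y. L y (V x)) (at x) u + L x (V' u))) (at x)"
proof -
  let ?D = "\<lambda>v. frechet_derivative (\<lambda>y. L y v) (at x)"
  have D: "((\<lambda>y. L y v) has_derivative ?D v) (at x)" for v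
    using diff frechet_derivative_works by blast
  have L_eq: "L y v = (\<Sum>b\<in>Basis. (v \<bullet> b) *\<^sub>R L y b)" if "y \<in> S" for y v
    by (rule linear_eq_sum_Basis[OF lin[OF that]])
  have D_eq: "?D v u = (\<Sum>b\<in>Basis. (v \<bullet> b) *\<^sub>R ?D b u)" for v u
    by (rule linear_eq_sum_Basis[OF linear_derivative_of_linear_family[OF S lin diff]])
  have "((\<lambda>y. \<Sum>b\<in>Basis. (V y \<bullet> b) *\<^sub>R L y b) has_derivative
      (\<lambda>u. \<Sum>b\<in>Basis. (V x \<bullet> b) *\<^sub>R ?D b u + (V' u \<bullet> b) *\<^sub>R L x b)) (at x)"
    by (intro has_derivative_sum has_derivative_scaleR has_derivative_inner_left V D)
  then have "((\<lambda>y. \<Sum>b\<in>Basis. (V y \<bullet> b) *\<^sub>R L y b) has_derivative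
      (\<lambda>u. ?D (V x) u + L x (V' u))) (at x)"
    by (simp add: sum.distrib D_eq[of "V x"] L_eq[OF S(2), of "V' _"])
  then show ?thesis
    by (rule has_derivative_transform_within_open[OF _ S]) (simp add: L_eq[symmetric])
qed

lemma has_derivative_bilinear_family:
  fixes B :: "'a::real_normed_vector \<Rightarrow> 'b::euclidean_space \<Rightarrow> 'd::euclidean_space
    \<Rightarrow> 'c::real_normed_vector"
  assumes S: "open S" "x \<in> S" and lin: "\<And>y. y \<in> S \<Longrightarrow> bilinear (B y)"
    and diff: "\<And>v w. (\<lambda>y. B y v w) differentiable at x"
    and V: "(V has_derivative V') (at x)" and W: "(W has_derivative W') (at x)"
  shows "((\<lambda>y. B y (V y) (W y)) has_derivative
    (\<lambda>u. frechet_derivative (\<lambda>y. B y (V x) (W x)) (at x) u + B x (V' u) (W x) + B x (V x) (W' u))) (at x)"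
proof -
  have 1: "((\<lambda>y. B y v (W y)) has_derivative
      (\<lambda>u. frechet_derivative (\<lambda>y. B y v (W x)) (at x) u + B x v (W' u))) (at x)" for v
    by (rule has_derivative_linear_family[OF S _ diff W]) (use lin in \<open>auto simp: bilinear_def\<close>)
  have 2: "((\<lambda>y. B y (V y) (W y)) has_derivative
      (\<lambda>u. frechet_derivative (\<lambda>y. B y (V x) (W y)) (at x) u + B x (V' u) (W x))) (at x)"
    by (rule has_derivative_linear_family[OF S, where L = "\<lambda>y v. B y v (W y)", OF _ _ V])
      (use lin differentiableI[OF 1] in \<open>auto simp: bilinear_def\<close>)
  show ?thesis
    using 2 unfolding frechet_derivative_at[OF 1[of "V x"], symmetric] by (simp add: algebra_simps)
qed

section \<open>Functions and vector fields in charts\<close>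

lemma field_chart_inv [simp]: "y \<in> snd k ` fst k \<Longrightarrow> snd k (chart_inv k y) = y"
  by (rule f_inv_into_f)

lemma frechet_derivative_cong:
  assumes "open S" "x \<in> S" "\<And>y. y \<in> S \<Longrightarrow> f y = g y"
  shows "frechet_derivative f (at x) = frechet_derivative g (at x)"
proof -
  have "(f has_derivative f') (at x) \<longleftrightarrow> (g has_derivative f') (at x)" for f'
    using has_derivative_transform_within_open[OF _ assms(1,2), of f f' UNIV g]
      has_derivative_transform_within_open[OF _ assms(1,2), of g f' UNIV f] assms(3) by auto
  then show ?thesis by (simp add: frechet_derivative_def)
qed

text \<open>
  Smoothness with respect to a single chart, for functions with values in a normed space. The components
  of a tensor in the chart \<open>k\<close> are smooth in this sense only.
\<close>

definition smooth_in :: "('m, 'e::euclidean_space) chart \<Rightarrow> 'm set \<Rightarrow> ('m \<Rightarrow> 'b::real_normed_vector) \<Rightarrow> bool"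
  where "smooth_in k W f \<longleftrightarrow> smooth_on (snd k ` (fst k \<inter> W)) (f \<circ> chart_inv k)"

locale atlas =
  fixes A :: "('m, 'e::euclidean_space) chart set"
  assumes atlas: "smooth_atlas A"
begin

abbreviation opn :: "'m set \<Rightarrow> bool" where "opn \<equiv> openin (manifold_topology A)"

lemma chart_inv [simp]: "k \<in> A \<Longrightarrow> x \<in> fst k \<Longrightarrow> chart_inv k (snd k x) = x"
  using atlas by (auto simp: smooth_atlas_def)

lemma opn_iff: "opn W \<longleftrightarrow> W \<subseteq> points A \<and> (\<forall>k\<in>A. open (snd k ` (fst k \<inter> W)))"
  by (rule openin_manifold_topology[OF atlas])

lemma open_image: "k \<in> A \<Longrightarrow> opn W \<Longrightarrow> open (snd k ` (fst k \<inter> W))"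
  by (simp add: opn_iff)

lemma opn_domain: "k \<in> A \<Longrightarrow> opn (fst k)"
  using atlas by (auto simp: opn_iff smooth_atlas_def points_def)

lemma opn_Int: "opn V \<Longrightarrow> opn W \<Longrightarrow> opn (V \<inter> W)"
  by (rule openin_Int)

lemma smooth_in_cong:
  assumes "k \<in> A" "opn W" "\<And>x. x \<in> fst k \<Longrightarrow> x \<in> W \<Longrightarrow> f x = g x"
  shows "smooth_in k W f \<longleftrightarrow> smooth_in k W g"
  unfolding smooth_in_def by (rule smooth_on_cong[OF open_image[OF assms(1,2)]]) (use assms in auto)

lemma smooth_in_subset: "smooth_in k W f \<Longrightarrow> V \<subseteq> W \<Longrightarrow> smooth_in k V f"
  unfolding smooth_in_def by (erule smooth_on_subset) blast

lemma smooth_in_const: "smooth_in k W (\<lambda>_. c)"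
  by (simp add: smooth_in_def comp_def)

lemma smooth_in_add:
  "k \<in> A \<Longrightarrow> opn W \<Longrightarrow> smooth_in k W f \<Longrightarrow> smooth_in k W g \<Longrightarrow> smooth_in k W (\<lambda>x. f x + g x)"
  unfolding smooth_in_def comp_def by (intro smooth_on_add open_image)

lemma smooth_in_scaleR:
  "k \<in> A \<Longrightarrow> opn W \<Longrightarrow> smooth_in k W f \<Longrightarrow> smooth_in k W g \<Longrightarrow> smooth_in k W (\<lambda>x. f x *\<^sub>R g x)"
  unfolding smooth_in_def comp_def by (intro smooth_on_scaleR open_image)

lemma smooth_in_inner:
  "k \<in> A \<Longrightarrow> opn W \<Longrightarrow> smooth_in k W f \<Longrightarrow> smooth_in k W g \<Longrightarrow> smooth_in k W (\<lambda>x. f x \<bullet> g x)"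
  unfolding smooth_in_def comp_def by (intro smooth_on_inner open_image)

lemma smooth_in_sum:
  "k \<in> A \<Longrightarrow> opn W \<Longrightarrow> (\<And>i. i \<in> I \<Longrightarrow> smooth_in k W (f i)) \<Longrightarrow> smooth_in k W (\<lambda>x. \<Sum>i\<in>I. f i x)"
  unfolding smooth_in_def comp_def by (intro smooth_on_sum open_image)

lemma smooth_in_imp_has_derivative:
  assumes "k \<in> A" "opn W" "smooth_in k W f" "x \<in> fst k" "x \<in> W"
  shows "((f \<circ> chart_inv k) has_derivative chart_deriv k f x) (at (snd k x))"
  unfolding chart_deriv_def[abs_def]
  by (rule smooth_on_imp_has_derivative[OF open_image[OF assms(1,2)]])
    (use assms in \<open>auto simp: smooth_in_def\<close>)

lemma smooth_in_imp_differentiable: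
  "k \<in> A \<Longrightarrow> opn W \<Longrightarrow> smooth_in k W f \<Longrightarrow> x \<in> fst k \<Longrightarrow> x \<in> W \<Longrightarrow>
    (f \<circ> chart_inv k) differentiable at (snd k x)"
  using smooth_in_imp_has_derivative differentiableI by blast

lemma chart_deriv_eqI:
  "((f \<circ> chart_inv k) has_derivative f') (at (snd k x)) \<Longrightarrow> chart_deriv k f x v = f' v"
  unfolding chart_deriv_def by (simp add: frechet_derivative_at[symmetric])

lemma linear_chart_deriv:
  "k \<in> A \<Longrightarrow> opn W \<Longrightarrow> smooth_in k W f \<Longrightarrow> x \<in> fst k \<Longrightarrow> x \<in> W \<Longrightarrow> linear (chart_deriv k f x)"
  using smooth_in_imp_has_derivative has_derivative_linear by blast

lemma chart_deriv_cong:
  assumes "k \<in> A" "opn W" "x \<in> fst k" "x \<in> W" "\<And>y. y \<in> fst k \<Longrightarrow> y \<in> W \<Longrightarrow> f y = g y"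
  shows "chart_deriv k f x = chart_deriv k g x"
  unfolding chart_deriv_def[abs_def] using assms
  by (subst frechet_derivative_cong[OF open_image[OF assms(1,2)], of _ "f \<circ> chart_inv k" "g \<circ> chart_inv k"]) auto

lemma chart_deriv_const [simp]: "chart_deriv k (\<lambda>_. c) x v = 0"
  by (simp add: chart_deriv_def comp_def)

lemma chart_deriv_add:
  assumes "k \<in> A" "opn W" "smooth_in k W f" "smooth_in k W g" "x \<in> fst k" "x \<in> W"
  shows "chart_deriv k (\<lambda>y. f y + g y) x v = chart_deriv k f x v + chart_deriv k g x v"
  using has_derivative_add[OF smooth_in_imp_has_derivative[OF assms(1-3,5,6)]
      smooth_in_imp_has_derivative[OF assms(1,2,4-6)]]
  by (intro chart_deriv_eqI) (simp add: comp_def)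

lemma chart_deriv_inner:
  fixes f :: "'m \<Rightarrow> 'b::real_inner"
  assumes "k \<in> A" "opn W" "smooth_in k W f" "x \<in> fst k" "x \<in> W"
  shows "chart_deriv k (\<lambda>y. f y \<bullet> b) x v = chart_deriv k f x v \<bullet> b"
  using frechet_derivative_inner_left[OF smooth_in_imp_differentiable[OF assms]]
  by (simp add: chart_deriv_def comp_def)

lemma smooth_in_chart_deriv:
  assumes "k \<in> A" "opn W" "smooth_in k W f" "smooth_in k W X"
  shows "smooth_in k W (\<lambda>x. chart_deriv k f x (X x))"
proof -
  note op = open_image[OF assms(1,2)]
  have "smooth_on (snd k ` (fst k \<inter> W))
      (\<lambda>y. frechet_derivative (f \<circ> chart_inv k) (at y) ((X \<circ> chart_inv k) y))"
    by (rule smooth_on_derivative_along[OF op]) (use assms in \<open>simp_all only: smooth_in_def\<close>)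
  then show ?thesis
    unfolding smooth_in_def
    by (rule smooth_on_transform[OF op]) (use assms in \<open>auto simp: chart_deriv_def\<close>)
qed

lemma chart_deriv_symmetric:
  fixes f :: "'m \<Rightarrow> 'b::euclidean_space"
  assumes "k \<in> A" "opn W" "smooth_in k W f" "x \<in> fst k" "x \<in> W"
  shows "chart_deriv k (\<lambda>y. chart_deriv k f y v) x u = chart_deriv k (\<lambda>y. chart_deriv k f y u) x v"
proof -
  let ?S = "snd k ` (fst k \<inter> W)" and ?f = "f \<circ> chart_inv k"
  note op = open_image[OF assms(1,2)]
  have x: "snd k x \<in> ?S" using assms by blast
  have "chart_deriv k (\<lambda>y. chart_deriv k f y v) x u =
      frechet_derivative (\<lambda>y. frechet_derivative ?f (at y) v) (at (snd k x)) u" for u v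
    unfolding chart_deriv_def
    by (rule fun_cong[OF frechet_derivative_cong[OF op x]]) (use assms in auto)
  then show ?thesis
    using symmetric_second_derivative[OF op _ x, of ?f] assms(3) by (simp add: smooth_in_def)
qed

lemma linear_chart_deriv_family:
  fixes L :: "'m \<Rightarrow> 'b::real_vector \<Rightarrow> 'c::real_normed_vector"
  assumes "k \<in> A" "opn W" "x \<in> fst k" "x \<in> W"
    and lin: "\<And>y. y \<in> fst k \<Longrightarrow> y \<in> W \<Longrightarrow> linear (L y)"
    and L: "\<And>v. smooth_in k W (\<lambda>y. L y v)"
  shows "linear (\<lambda>v. chart_deriv k (\<lambda>y. L y v) x u)"
  unfolding chart_deriv_def comp_def
  by (rule linear_derivative_of_linear_family[OF open_image[OF assms(1,2)]])
    (use assms smooth_in_imp_differentiable[OF assms(1,2) L] in \<open>auto simp: comp_def\<close>)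

lemma chart_deriv_linear_family:
  fixes L :: "'m \<Rightarrow> 'b::euclidean_space \<Rightarrow> 'c::real_normed_vector"
  assumes "k \<in> A" "opn W" "x \<in> fst k" "x \<in> W"
    and lin: "\<And>y. y \<in> fst k \<Longrightarrow> y \<in> W \<Longrightarrow> linear (L y)"
    and L: "\<And>v. smooth_in k W (\<lambda>y. L y v)" and V: "smooth_in k W V"
  shows "chart_deriv k (\<lambda>y. L y (V y)) x u =
    chart_deriv k (\<lambda>y. L y (V x)) x u + L x (chart_deriv k V x u)"
proof -
  have "((\<lambda>z. L (chart_inv k z) ((V \<circ> chart_inv k) z)) has_derivative
      (\<lambda>u. frechet_derivative (\<lambda>z. L (chart_inv k z) ((V \<circ> chart_inv k) (snd k x))) (at (snd k x)) u
        + L (chart_inv k (snd k x)) (chart_deriv k V x u))) (at (snd k x))"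
    by (rule has_derivative_linear_family[OF open_image[OF assms(1,2)]])
      (use assms smooth_in_imp_differentiable[OF assms(1,2) L] smooth_in_imp_has_derivative[OF assms(1,2) V]
        in \<open>auto simp: comp_def\<close>)
  from frechet_derivative_at[OF this, symmetric] show ?thesis
    using assms by (simp add: chart_deriv_def comp_def)
qed

lemma chart_deriv_bilinear_family:
  fixes B :: "'m \<Rightarrow> 'b::euclidean_space \<Rightarrow> 'd::euclidean_space \<Rightarrow> 'c::real_normed_vector"
  assumes "k \<in> A" "opn W" "x \<in> fst k" "x \<in> W"
    and lin: "\<And>y. y \<in> fst k \<Longrightarrow> y \<in> W \<Longrightarrow> bilinear (B y)"
    and B: "\<And>v w. smooth_in k W (\<lambda>y. B y v w)" and V: "smooth_in k W V" and Z: "smooth_in k W Z"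
  shows "chart_deriv k (\<lambda>y. B y (V y) (Z y)) x u =
    chart_deriv k (\<lambda>y. B y (V x) (Z x)) x u + B x (chart_deriv k V x u) (Z x)
      + B x (V x) (chart_deriv k Z x u)"
proof -
  have "((\<lambda>z. B (chart_inv k z) ((V \<circ> chart_inv k) z) ((Z \<circ> chart_inv k) z)) has_derivative
      (\<lambda>u. frechet_derivative (\<lambda>z. B (chart_inv k z) ((V \<circ> chart_inv k) (snd k x))
          ((Z \<circ> chart_inv k) (snd k x))) (at (snd k x)) u
        + B (chart_inv k (snd k x)) (chart_deriv k V x u) ((Z \<circ> chart_inv k) (snd k x))
        + B (chart_inv k (snd k x)) ((V \<circ> chart_inv k) (snd k x)) (chart_deriv k Z x u)))
      (at (snd k x))"
    by (rule has_derivative_bilinear_family[OF open_image[OF assms(1,2)]])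
      (use assms smooth_in_imp_differentiable[OF assms(1,2) B] smooth_in_imp_has_derivative[OF assms(1,2) V]
        smooth_in_imp_has_derivative[OF assms(1,2) Z] in \<open>auto simp: comp_def\<close>)
  from frechet_derivative_at[OF this, symmetric] show ?thesis
    using assms by (simp add: chart_deriv_def comp_def)
qed

lemma smooth_in_linear_family:
  fixes L :: "'m \<Rightarrow> 'b::euclidean_space \<Rightarrow> 'c::real_normed_vector"
  assumes "k \<in> A" "opn W" "\<And>y. y \<in> fst k \<Longrightarrow> y \<in> W \<Longrightarrow> linear (L y)"
    and "\<And>v. smooth_in k W (\<lambda>y. L y v)" "smooth_in k W V"
  shows "smooth_in k W (\<lambda>y. L y (V y))"
proof -
  have "smooth_in k W (\<lambda>y. \<Sum>b\<in>Basis. (V y \<bullet> b) *\<^sub>R L y b)"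
    by (intro smooth_in_sum smooth_in_scaleR smooth_in_inner smooth_in_const assms)
  then show ?thesis
    by (subst smooth_in_cong[OF assms(1,2) linear_eq_sum_Basis[OF assms(3)]]) auto
qed

lemma smooth_in_bilinear_family:
  fixes B :: "'m \<Rightarrow> 'b::euclidean_space \<Rightarrow> 'd::euclidean_space \<Rightarrow> 'c::real_normed_vector"
  assumes "k \<in> A" "opn W" "\<And>y. y \<in> fst k \<Longrightarrow> y \<in> W \<Longrightarrow> bilinear (B y)"
    and "\<And>v w. smooth_in k W (\<lambda>y. B y v w)" "smooth_in k W V" "smooth_in k W Z"
  shows "smooth_in k W (\<lambda>y. B y (V y) (Z y))"
proof (rule smooth_in_linear_family[OF assms(1,2) _ _ assms(5)])
  show "linear (\<lambda>v. B y v (Z y))" if "y \<in> fst k" "y \<in> W" for y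
    using assms(3)[OF that] by (simp add: bilinear_def)
  show "smooth_in k W (\<lambda>y. B y v (Z y))" for v
    by (rule smooth_in_linear_family[OF assms(1,2) _ assms(4,6)])
      (use assms(3) in \<open>simp add: bilinear_def\<close>)
qed

lemma smooth_in_change_chart:
  fixes f :: "'m \<Rightarrow> 'b::real_normed_vector"
  assumes "k \<in> A" "k' \<in> A" "opn W" "W \<subseteq> fst k" "smooth_in k W f"
  shows "smooth_in k' W f"
proof -
  let ?S = "snd k' ` (fst k' \<inter> W)"
  have "smooth_on ?S (\<lambda>y. (f \<circ> chart_inv k) ((snd k \<circ> chart_inv k') y))"
  proof (rule smooth_on_compose[OF open_image[OF assms(2,3)] open_image[OF assms(1,3)]])
    show "smooth_on ?S (snd k \<circ> chart_inv k')"
      by (rule smooth_on_subset[of "snd k' ` (fst k' \<inter> fst k)"])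
        (use atlas assms in \<open>auto simp: smooth_atlas_def\<close>)
    show "smooth_on (snd k ` (fst k \<inter> W)) (f \<circ> chart_inv k)"
      using assms(5) by (simp only: smooth_in_def)
  qed (use assms in auto)
  then show ?thesis
    unfolding smooth_in_def
    by (rule smooth_on_transform[OF open_image[OF assms(2,3)]]) (use assms in auto)
qed

lemma smooth_in_coordinates: "k \<in> A \<Longrightarrow> k' \<in> A \<Longrightarrow> smooth_in k (fst k') (snd k')"
  using atlas by (auto simp: smooth_atlas_def smooth_in_def)

lemma chart_deriv_coordinate_function:
  assumes "k \<in> A" "x \<in> fst k"
  shows "chart_deriv k (\<lambda>x. F (snd k x)) x v = frechet_derivative F (at (snd k x)) v"
  unfolding chart_deriv_def comp_def
  by (rule fun_cong[OF frechet_derivative_cong[OF open_image[OF assms(1) opn_domain[OF assms(1)]]]])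
    (use assms in auto)

lemma smooth_in_coordinate_function:
  assumes "k \<in> A" "smooth_on (snd k ` fst k) F"
  shows "smooth_in k (fst k) (\<lambda>x. F (snd k x))"
  unfolding smooth_in_def comp_def
  by (rule smooth_on_transform[OF open_image[OF assms(1) opn_domain[OF assms(1)]], of F])
    (use assms in auto)

text \<open>
  The Jacobian of a change of charts is the derivative of the new coordinates; in this way the rules
  for derivatives of functions in a chart apply to it.
\<close>

lemma jac_eq_chart_deriv: "jac k k' x v = chart_deriv k (snd k') x v"
  by (simp add: jac_def chart_deriv_def)

lemma chart_deriv_change_chart:
  assumes "k \<in> A" "k' \<in> A" "opn W" "x \<in> W" "x \<in> fst k" "x \<in> fst k'" "smooth_in k' W f"
  shows "chart_deriv k f x v = chart_deriv k' f x (jac k k' x v)"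
proof (rule chart_deriv_eqI)
  let ?V = "W \<inter> fst k'"
  have V: "opn ?V" by (intro opn_Int opn_domain assms)
  have 1: "((snd k' \<circ> chart_inv k) has_derivative jac k k' x) (at (snd k x))"
    using smooth_in_imp_has_derivative[OF assms(1) opn_domain smooth_in_coordinates] assms
    by (simp add: jac_eq_chart_deriv[abs_def])
  have 2: "((f \<circ> chart_inv k') has_derivative chart_deriv k' f x) (at ((snd k' \<circ> chart_inv k) (snd k x)))"
    using smooth_in_imp_has_derivative[of k' W f x] assms by simp
  from has_derivative_compose[OF 1 2]
  show "((f \<circ> chart_inv k) has_derivative (\<lambda>v. chart_deriv k' f x (jac k k' x v))) (at (snd k x))"
    by (rule has_derivative_transform_within_open[OF _ open_image[OF assms(1) V]]) (use assms in auto)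
qed

lemma jac_compose:
  assumes "k \<in> A" "k' \<in> A" "k'' \<in> A" "x \<in> fst k" "x \<in> fst k'" "x \<in> fst k''"
  shows "jac k' k'' x (jac k k' x v) = jac k k'' x v"
  using chart_deriv_change_chart[OF assms(1,2) opn_domain[OF assms(3)] _ _ _ smooth_in_coordinates] assms
  by (simp add: jac_eq_chart_deriv)

lemma jac_self [simp]:
  assumes "k \<in> A" "x \<in> fst k" shows "jac k k x v = v"
  unfolding jac_eq_chart_deriv
proof (rule chart_deriv_eqI)
  show "((snd k \<circ> chart_inv k) has_derivative (\<lambda>v. v)) (at (snd k x))"
    by (rule has_derivative_transform_within_open[OF has_derivative_ident open_image[OF assms(1)
            opn_domain[OF assms(1)]]]) (use assms in auto)
qed

lemma jac_inverse:
  "k \<in> A \<Longrightarrow> k' \<in> A \<Longrightarrow> x \<in> fst k \<Longrightarrow> x \<in> fst k' \<Longrightarrow> jac k' k x (jac k k' x v) = v"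
  by (simp add: jac_compose)

lemma linear_jac:
  "k \<in> A \<Longrightarrow> k' \<in> A \<Longrightarrow> x \<in> fst k \<Longrightarrow> x \<in> fst k' \<Longrightarrow> linear (jac k k' x)"
  using linear_chart_deriv[OF _ opn_domain smooth_in_coordinates]
  by (simp add: jac_eq_chart_deriv[abs_def])

lemma smooth_in_jac:
  "k \<in> A \<Longrightarrow> k' \<in> A \<Longrightarrow> smooth_in k (fst k') (\<lambda>x. jac k k' x v)"
  unfolding jac_eq_chart_deriv
  by (intro smooth_in_chart_deriv opn_domain smooth_in_coordinates smooth_in_const)

lemma vector_field_iff:
  "vector_field A W X \<longleftrightarrow> (\<forall>k\<in>A. smooth_in k W (X k)) \<and>
    (\<forall>k\<in>A. \<forall>k'\<in>A. \<forall>x \<in> fst k \<inter> fst k' \<inter> W. X k' x = jac k k' x (X k x))"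
  by (simp add: vector_field_def smooth_in_def)

lemma vector_field_subset: "vector_field A W X \<Longrightarrow> V \<subseteq> W \<Longrightarrow> vector_field A V X"
  unfolding vector_field_iff using smooth_in_subset by blast

lemma vector_field_smooth_in: "vector_field A W X \<Longrightarrow> k \<in> A \<Longrightarrow> smooth_in k W (X k)"
  by (simp add: vector_field_iff)

lemma vector_field_jac:
  "vector_field A W X \<Longrightarrow> k \<in> A \<Longrightarrow> k' \<in> A \<Longrightarrow> x \<in> fst k \<Longrightarrow> x \<in> fst k' \<Longrightarrow> x \<in> W \<Longrightarrow>
    X k' x = jac k k' x (X k x)"
  unfolding vector_field_iff by blast

lemma vector_field_cong:
  assumes "opn W" "field_eq A W X Y" "vector_field A W X" shows "vector_field A W Y"
proof -
  have eq: "X k x = Y k x" if "k \<in> A" "x \<in> fst k" "x \<in> W" for k x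
    using assms(2) that by (simp add: field_eq_def)
  then have "smooth_in k W (Y k)" if "k \<in> A" for k
    using smooth_in_cong[OF that assms(1), of "X k" "Y k"] vector_field_smooth_in[OF assms(3) that] that
    by simp
  moreover have "Y k' x = jac k k' x (Y k x)"
    if "k \<in> A" "k' \<in> A" "x \<in> fst k \<inter> fst k' \<inter> W" for k k' x
    using vector_field_jac[OF assms(3) that(1,2), of x] eq[OF that(1), of x] eq[OF that(2), of x] that(3)
    by simp
  ultimately show ?thesis unfolding vector_field_iff by blast
qed

lemma smooth_fun_iff: "smooth_fun A W f \<longleftrightarrow> (\<forall>k\<in>A. smooth_in k W f)"
  by (simp add: smooth_fun_def smooth_in_def)

lemma smooth_fun_in_chart:
  "k \<in> A \<Longrightarrow> opn W \<Longrightarrow> W \<subseteq> fst k \<Longrightarrow> smooth_in k W f \<Longrightarrow> smooth_fun A W f"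
  unfolding smooth_fun_iff using smooth_in_change_chart by blast

lemma vector_field_add:
  assumes "opn W" "vector_field A W X" "vector_field A W Y"
  shows "vector_field A W (\<lambda>k x. X k x + Y k x)"
  unfolding vector_field_iff
proof (intro conjI ballI)
  show "smooth_in k W (\<lambda>x. X k x + Y k x)" if "k \<in> A" for k
    by (intro smooth_in_add that assms vector_field_smooth_in)
  show "X k' x + Y k' x = jac k k' x (X k x + Y k x)"
    if "k \<in> A" "k' \<in> A" "x \<in> fst k \<inter> fst k' \<inter> W" for k k' x
    using that vector_field_jac[OF assms(2) that(1,2)] vector_field_jac[OF assms(3) that(1,2)]
    by (simp add: linear_add[OF linear_jac])
qed

lemma vector_field_scaleR:
  assumes "opn W" "smooth_fun A W f" "vector_field A W X"
  shows "vector_field A W (\<lambda>k x. f x *\<^sub>R X k x)"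
  unfolding vector_field_iff
proof (intro conjI ballI)
  show "smooth_in k W (\<lambda>x. f x *\<^sub>R X k x)" if "k \<in> A" for k
    using assms that by (intro smooth_in_scaleR vector_field_smooth_in) (auto simp: smooth_fun_iff)
  show "f x *\<^sub>R X k' x = jac k k' x (f x *\<^sub>R X k x)"
    if "k \<in> A" "k' \<in> A" "x \<in> fst k \<inter> fst k' \<inter> W" for k k' x
    using that vector_field_jac[OF assms(3) that(1,2)] by (simp add: linear_scale[OF linear_jac])
qed

lemma vector_field_zero: "vector_field A W (\<lambda>_ _. 0)"
  unfolding vector_field_iff by (auto simp: smooth_in_const linear_0[OF linear_jac])

lemma vector_field_sum:
  assumes "opn W" "\<And>i. i \<in> I \<Longrightarrow> smooth_fun A W (f i)" "\<And>i. i \<in> I \<Longrightarrow> vector_field A W (X i)"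
  shows "vector_field A W (\<lambda>k x. \<Sum>i\<in>I. f i x *\<^sub>R X i k x)"
  using assms(2,3)
proof (induction I rule: infinite_finite_induct)
  case (insert i I)
  then show ?case
    using vector_field_add[OF assms(1) vector_field_scaleR[OF assms(1), of "f i" "X i"]] by simp
qed (simp_all add: vector_field_zero)

lemma vector_field_coord_field:
  assumes "k \<in> A" shows "vector_field A (fst k) (coord_field k v)"
  unfolding vector_field_iff coord_field_def
proof (intro conjI ballI)
  fix k' assume k': "k' \<in> A"
  let ?W = "fst k \<inter> fst k'"
  have W: "opn ?W" by (intro opn_Int opn_domain assms k')
  have "smooth_in k' ?W (\<lambda>x. jac k k' x v)"
    by (rule smooth_in_change_chart[OF assms k' W _ smooth_in_subset[OF smooth_in_jac]])
      (use assms k' in auto)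
  then show "smooth_in k' (fst k) (\<lambda>x. jac k k' x v)"
    by (simp add: smooth_in_def Int_left_commute Int_commute)
qed (use assms in \<open>auto simp: jac_compose\<close>)

lemma coord_field_own_chart: "k \<in> A \<Longrightarrow> x \<in> fst k \<Longrightarrow> coord_field k v k x = v"
  by (simp add: coord_field_def)

end

section \<open>Connections in charts\<close>

text \<open>
  The Christoffel symbols of a connection as a vector-valued bilinear form, without reference to a basis of
  the model space. The model space is \<open>real^'n\<close> for the base, but a product for the total space.
\<close>

definition conn_form ::
  "('m, 'e::euclidean_space) connection \<Rightarrow> ('m, 'e) chart \<Rightarrow> 'm \<Rightarrow> 'e \<Rightarrow> 'e \<Rightarrow> 'e" where
  "conn_form D k x u v = D (coord_field k u) (coord_field k v) k x"

definition curv_form ::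
  "('m, 'e::euclidean_space) connection \<Rightarrow> ('m, 'e) chart \<Rightarrow> 'm \<Rightarrow> 'e \<Rightarrow> 'e \<Rightarrow> 'e \<Rightarrow> 'e" where
  "curv_form D k x u v w =
     chart_deriv k (\<lambda>y. conn_form D k y v w) x u - chart_deriv k (\<lambda>y. conn_form D k y u w) x v
     + conn_form D k x u (conn_form D k x v w) - conn_form D k x v (conn_form D k x u w)"

lemma trace_conjugate:
  fixes L :: "'e::euclidean_space \<Rightarrow> 'e"
  assumes "linear J" "linear K" "linear L" "\<And>v. K (J v) = v"
  shows "(\<Sum>b\<in>Basis. J (L (K b)) \<bullet> b) = (\<Sum>b\<in>Basis. L b \<bullet> b)"
proof -
  have "(\<Sum>b\<in>Basis. J (L (K b)) \<bullet> b) = (\<Sum>b\<in>Basis. \<Sum>c\<in>Basis. (L (K b) \<bullet> c) * (J c \<bullet> b))"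
    by (subst linear_eq_sum_Basis[OF assms(1)]) (simp add: inner_sum_left)
  also have "\<dots> = (\<Sum>c\<in>Basis. \<Sum>b\<in>Basis. (L (K b) \<bullet> c) * (J c \<bullet> b))"
    by (rule sum.swap)
  also have "\<dots> = (\<Sum>c\<in>Basis. L (K (J c)) \<bullet> c)"
  proof (rule sum.cong[OF refl])
    fix c :: 'e
    have lin: "linear (\<lambda>v. L (K v))" using linear_compose[OF assms(2,3)] by (simp add: comp_def)
    show "(\<Sum>b\<in>Basis. (L (K b) \<bullet> c) * (J c \<bullet> b)) = L (K (J c)) \<bullet> c"
      by (subst linear_eq_sum_Basis[OF lin, of "J c"]) (simp add: inner_sum_left mult.commute)
  qed
  finally show ?thesis by (simp add: assms(4))
qed

locale connection = atlas A for A :: "('m, 'e::euclidean_space) chart set" +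
  fixes D :: "('m, 'e) connection"
  assumes connection: "affine_connection A D"
begin

lemma vector_field_D: "opn W \<Longrightarrow> vector_field A W X \<Longrightarrow> vector_field A W Y \<Longrightarrow> vector_field A W (D X Y)"
  using connection unfolding affine_connection_def by blast

lemma D_cong:
  assumes "opn W" "vector_field A W X" "vector_field A W Y" "vector_field A W X'" "vector_field A W Y'"
    and "field_eq A W X X'" "field_eq A W Y Y'" "k \<in> A" "x \<in> fst k" "x \<in> W"
  shows "D X Y k x = D X' Y' k x"
proof -
  have "field_eq A W (D X Y) (D X' Y')"
    using connection assms(1-7) unfolding affine_connection_def by blast
  then show ?thesis using assms(8-10) by (simp add: field_eq_def)
qed

lemma D_add_left:
  assumes "opn W" "vector_field A W X" "vector_field A W Y" "vector_field A W X'"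
    and "k \<in> A" "x \<in> fst k" "x \<in> W"
  shows "D (\<lambda>k x. X k x + X' k x) Y k x = D X Y k x + D X' Y k x"
proof -
  have "field_eq A W (D (\<lambda>k x. X k x + X' k x) Y) (\<lambda>k x. D X Y k x + D X' Y k x)"
    using connection assms(1-4) unfolding affine_connection_def by blast
  then show ?thesis using assms(5-7) by (simp add: field_eq_def)
qed

lemma D_add_right:
  assumes "opn W" "vector_field A W X" "vector_field A W Y" "vector_field A W Y'"
    and "k \<in> A" "x \<in> fst k" "x \<in> W"
  shows "D X (\<lambda>k x. Y k x + Y' k x) k x = D X Y k x + D X Y' k x"
proof -
  have "field_eq A W (D X (\<lambda>k x. Y k x + Y' k x)) (\<lambda>k x. D X Y k x + D X Y' k x)"
    using connection assms(1-4) unfolding affine_connection_def by blast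
  then show ?thesis using assms(5-7) by (simp add: field_eq_def)
qed

lemma D_scaleR_left:
  assumes "opn W" "vector_field A W X" "vector_field A W Y" "smooth_fun A W f"
    and "k \<in> A" "x \<in> fst k" "x \<in> W"
  shows "D (\<lambda>k x. f x *\<^sub>R X k x) Y k x = f x *\<^sub>R D X Y k x"
proof -
  have "field_eq A W (D (\<lambda>k x. f x *\<^sub>R X k x) Y) (\<lambda>k x. f x *\<^sub>R D X Y k x)"
    using connection assms(1-4) unfolding affine_connection_def by blast
  then show ?thesis using assms(5-7) by (simp add: field_eq_def)
qed

lemma D_scaleR_right:
  assumes "opn W" "vector_field A W X" "vector_field A W Y" "smooth_fun A W f"
    and "k \<in> A" "x \<in> fst k" "x \<in> W"
  shows "D X (\<lambda>k x. f x *\<^sub>R Y k x) k x = chart_deriv k f x (X k x) *\<^sub>R Y k x + f x *\<^sub>R D X Y k x"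
proof -
  have "field_eq A W (D X (\<lambda>k x. f x *\<^sub>R Y k x))
      (\<lambda>k x. chart_deriv k f x (X k x) *\<^sub>R Y k x + f x *\<^sub>R D X Y k x)"
    using connection assms(1-4) unfolding affine_connection_def by blast
  then show ?thesis using assms(5-7) by (simp add: field_eq_def)
qed

lemma smooth_fun_const: "smooth_fun A W (\<lambda>_. c)"
  by (simp add: smooth_fun_iff smooth_in_const)

lemma D_zero_left:
  assumes "opn W" "vector_field A W Y" "k \<in> A" "x \<in> fst k" "x \<in> W"
  shows "D (\<lambda>_ _. 0) Y k x = 0"
  using D_scaleR_left[OF assms(1) vector_field_zero assms(2) smooth_fun_const assms(3-5), of 0] by simp

lemma D_zero_right:
  assumes "opn W" "vector_field A W X" "k \<in> A" "x \<in> fst k" "x \<in> W"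
  shows "D X (\<lambda>_ _. 0) k x = 0"
  using D_scaleR_right[OF assms(1,2) vector_field_zero smooth_fun_const assms(3-5), of 0] by simp

lemma D_sum_left:
  assumes "opn W" "vector_field A W Y" "k \<in> A" "x \<in> fst k" "x \<in> W"
    and "\<And>i. i \<in> I \<Longrightarrow> smooth_fun A W (f i)" "\<And>i. i \<in> I \<Longrightarrow> vector_field A W (X i)"
  shows "D (\<lambda>k x. \<Sum>i\<in>I. f i x *\<^sub>R X i k x) Y k x = (\<Sum>i\<in>I. f i x *\<^sub>R D (X i) Y k x)"
  using assms(6,7)
proof (induction I rule: infinite_finite_induct)
  case (insert i I)
  have "D (\<lambda>k x. f i x *\<^sub>R X i k x + (\<Sum>i\<in>I. f i x *\<^sub>R X i k x)) Y k x
      = D (\<lambda>k x. f i x *\<^sub>R X i k x) Y k x + D (\<lambda>k x. \<Sum>i\<in>I. f i x *\<^sub>R X i k x) Y k x"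
    by (rule D_add_left[OF assms(1) vector_field_scaleR[OF assms(1)] assms(2)
          vector_field_sum[OF assms(1)] assms(3-5)]) (use insert.prems in auto)
  then show ?case
    using insert D_scaleR_left[OF assms(1) _ assms(2) _ assms(3-5), of "X i" "f i"] by simp
qed (simp_all add: D_zero_left[OF assms(1-5)])

lemma D_sum_right:
  assumes "opn W" "vector_field A W X" "k \<in> A" "x \<in> fst k" "x \<in> W"
    and "\<And>i. i \<in> I \<Longrightarrow> smooth_fun A W (f i)" "\<And>i. i \<in> I \<Longrightarrow> vector_field A W (Y i)"
  shows "D X (\<lambda>k x. \<Sum>i\<in>I. f i x *\<^sub>R Y i k x) k x =
    (\<Sum>i\<in>I. chart_deriv k (f i) x (X k x) *\<^sub>R Y i k x + f i x *\<^sub>R D X (Y i) k x)"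
  using assms(6,7)
proof (induction I rule: infinite_finite_induct)
  case (insert i I)
  have "D X (\<lambda>k x. f i x *\<^sub>R Y i k x + (\<Sum>i\<in>I. f i x *\<^sub>R Y i k x)) k x
      = D X (\<lambda>k x. f i x *\<^sub>R Y i k x) k x + D X (\<lambda>k x. \<Sum>i\<in>I. f i x *\<^sub>R Y i k x) k x"
    by (rule D_add_right[OF assms(1,2) vector_field_scaleR[OF assms(1)]
          vector_field_sum[OF assms(1)] assms(3-5)]) (use insert.prems in auto)
  then show ?case
    using insert D_scaleR_right[OF assms(1,2) _ _ assms(3-5), of "Y i" "f i"] by simp
qed (simp_all add: D_zero_right[OF assms(1-5)])

lemma bilinear_conn_form:
  assumes k: "k \<in> A" "x \<in> fst k"
  shows "bilinear (conn_form D k x)"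
proof -
  let ?W = "fst k" and ?c = "coord_field k"
  have W: "opn ?W" by (rule opn_domain[OF k(1)])
  note vf = vector_field_coord_field[OF k(1)]
  have add: "field_eq A ?W (?c (u + v)) (\<lambda>k x. ?c u k x + ?c v k x)" for u v
    by (auto simp: field_eq_def coord_field_def linear_add[OF linear_jac[OF k(1)]])
  have scale: "field_eq A ?W (?c (r *\<^sub>R u)) (\<lambda>k x. (\<lambda>_. r) x *\<^sub>R ?c u k x)" for r u
    by (auto simp: field_eq_def coord_field_def linear_scale[OF linear_jac[OF k(1)]])
  have refl: "field_eq A ?W X X" for X by (simp add: field_eq_def)
  note vf_add = vector_field_add[OF W vf vf] and vf_scale = vector_field_scaleR[OF W smooth_fun_const vf]
  show ?thesis
    unfolding bilinear_def conn_form_def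
  proof (intro conjI allI)
    fix w
    show "linear (\<lambda>u. D (?c w) (?c u) k x)"
      using D_cong[OF W vf vf vf vf_add refl add k k(2)] D_cong[OF W vf vf vf vf_scale refl scale k k(2)]
        D_add_right[OF W vf vf vf k k(2)] D_scaleR_right[OF W vf vf smooth_fun_const k k(2)]
      by (intro linearI) simp_all
    show "linear (\<lambda>u. D (?c u) (?c w) k x)"
      using D_cong[OF W vf vf vf_add vf add refl k k(2)] D_cong[OF W vf vf vf_scale vf scale refl k k(2)]
        D_add_left[OF W vf vf vf k k(2)] D_scaleR_left[OF W vf vf smooth_fun_const k k(2)]
      by (intro linearI) simp_all
  qed
qed

lemma smooth_in_conn_form: "k \<in> A \<Longrightarrow> smooth_in k (fst k) (\<lambda>x. conn_form D k x u v)"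
  unfolding conn_form_def
  by (rule vector_field_smooth_in[OF vector_field_D[OF opn_domain vector_field_coord_field
          vector_field_coord_field]])

text \<open>
  A connection is local because it acts compatibly on all open sets; on a chart domain the
  arguments can therefore be expanded in the coordinate frame, and the Leibniz rule gives the
  usual coordinate expression.
\<close>

lemma connection_in_chart:
  assumes k: "k \<in> A" and W: "opn W" and X: "vector_field A W X" and Y: "vector_field A W Y"
    and x: "x \<in> fst k" "x \<in> W"
  shows "D X Y k x = chart_deriv k (Y k) x (X k x) + conn_form D k x (X k x) (Y k x)"
proof -
  let ?V = "W \<inter> fst k" and ?c = "coord_field k"
  have V: "opn ?V" by (intro opn_Int W opn_domain k)
  have xV: "x \<in> ?V" using x by blast
  have c: "vector_field A ?V (?c b)" for b
    by (rule vector_field_subset[OF vector_field_coord_field[OF k]]) blast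
  have smooth: "smooth_in k ?V (Z k)" if "vector_field A W Z" for Z
    by (rule smooth_in_subset[OF vector_field_smooth_in[OF that k]]) blast
  have coeff: "smooth_fun A ?V (\<lambda>y. Z k y \<bullet> b)" if "vector_field A W Z" for Z b
    by (rule smooth_fun_in_chart[OF k V _ smooth_in_inner[OF k V smooth[OF that] smooth_in_const]]) blast
  have expand: "field_eq A ?V Z (\<lambda>k' y. \<Sum>b\<in>Basis. (Z k y \<bullet> b) *\<^sub>R ?c b k' y)"
    if Z: "vector_field A W Z" for Z
    unfolding field_eq_def coord_field_def
  proof (intro ballI)
    fix k' y assume y: "k' \<in> A" "y \<in> fst k' \<inter> ?V"
    then have "Z k' y = jac k k' y (Z k y)" using vector_field_jac[OF Z k] by blast
    also have "\<dots> = (\<Sum>b\<in>Basis. (Z k y \<bullet> b) *\<^sub>R jac k k' y b)"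
      using y by (intro linear_eq_sum_Basis linear_jac k) auto
    finally show "Z k' y = (\<Sum>b\<in>Basis. (Z k y \<bullet> b) *\<^sub>R jac k k' y b)" .
  qed
  note X' = vector_field_sum[OF V coeff[OF X] c] and Y' = vector_field_sum[OF V coeff[OF Y] c]
  have sub: "vector_field A ?V X" "vector_field A ?V Y"
    by (rule vector_field_subset[OF X] vector_field_subset[OF Y], blast)+
  have "D X Y k x = D (\<lambda>k' y. \<Sum>b\<in>Basis. (X k y \<bullet> b) *\<^sub>R ?c b k' y)
      (\<lambda>k' y. \<Sum>b\<in>Basis. (Y k y \<bullet> b) *\<^sub>R ?c b k' y) k x"
    by (rule D_cong[OF V sub X' Y' expand[OF X] expand[OF Y] k x(1) xV])
  also have "\<dots> = (\<Sum>b\<in>Basis. (X k x \<bullet> b) *\<^sub>R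
      D (?c b) (\<lambda>k' y. \<Sum>b\<in>Basis. (Y k y \<bullet> b) *\<^sub>R ?c b k' y) k x)"
    by (rule D_sum_left[OF V Y' k x(1) xV coeff[OF X] c])
  also have "\<dots> = (\<Sum>b\<in>Basis. (X k x \<bullet> b) *\<^sub>R
      (chart_deriv k (Y k) x b + conn_form D k x b (Y k x)))"
  proof (rule sum.cong[OF refl], rule arg_cong[where f = "scaleR _"])
    fix b :: 'e
    have "D (?c b) (\<lambda>k' y. \<Sum>b\<in>Basis. (Y k y \<bullet> b) *\<^sub>R ?c b k' y) k x =
        (\<Sum>d\<in>Basis. chart_deriv k (\<lambda>y. Y k y \<bullet> d) x (?c b k x) *\<^sub>R ?c d k x
          + (Y k x \<bullet> d) *\<^sub>R D (?c b) (?c d) k x)"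
      by (rule D_sum_right[OF V c k x(1) xV coeff[OF Y] c])
    also have "\<dots> = (\<Sum>d\<in>Basis. (chart_deriv k (Y k) x b \<bullet> d) *\<^sub>R d
          + (Y k x \<bullet> d) *\<^sub>R conn_form D k x b d)"
      using chart_deriv_inner[OF k W vector_field_smooth_in[OF Y k] x]
      by (simp add: conn_form_def coord_field_own_chart[OF k x(1)])
    also have "\<dots> = chart_deriv k (Y k) x b + conn_form D k x b (Y k x)"
      using bilinear_conn_form[OF k x(1)]
      by (subst linear_eq_sum_Basis[of "conn_form D k x b" "Y k x"])
        (auto simp: sum.distrib euclidean_representation bilinear_def)
    finally show "D (?c b) (\<lambda>k' y. \<Sum>b\<in>Basis. (Y k y \<bullet> b) *\<^sub>R ?c b k' y) k x =
      chart_deriv k (Y k) x b + conn_form D k x b (Y k x)" .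
  qed
  also have "\<dots> = chart_deriv k (Y k) x (X k x) + conn_form D k x (X k x) (Y k x)"
    using bilinear_conn_form[OF k x(1)] linear_chart_deriv[OF k W vector_field_smooth_in[OF Y k] x]
    by (intro linear_eq_sum_Basis[symmetric] linear_compose_add) (auto simp: bilinear_def)
  finally show ?thesis .
qed

text \<open>
  The inhomogeneous transformation law of Christoffel symbols: it says that the covariant
  derivative of one coordinate field of \<open>k\<close> along another is a vector field.
\<close>

lemma conn_form_change_chart:
  assumes "k \<in> A" "k' \<in> A" "x \<in> fst k" "x \<in> fst k'"
  shows "jac k k' x (conn_form D k x u v) =
    chart_deriv k (\<lambda>y. jac k k' y v) x u + conn_form D k' x (jac k k' x u) (jac k k' x v)"
proof -
  note W = opn_domain[OF assms(1)] and vf = vector_field_coord_field[OF assms(1)]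
  have "jac k k' x (conn_form D k x u v) = D (coord_field k u) (coord_field k v) k' x"
    unfolding conn_form_def
    by (rule vector_field_jac[OF vector_field_D[OF W vf vf] assms(1,2,3,4,3), symmetric])
  also have "\<dots> = chart_deriv k' (coord_field k v k') x (jac k k' x u)
      + conn_form D k' x (jac k k' x u) (jac k k' x v)"
    using connection_in_chart[OF assms(2) W vf vf assms(4,3)] by (simp add: coord_field_def)
  also have "chart_deriv k' (coord_field k v k') x (jac k k' x u) =
      chart_deriv k (coord_field k v k') x u"
    using assms by (intro chart_deriv_change_chart[symmetric, OF _ _ W] vector_field_smooth_in[OF vf])
  finally show ?thesis by (simp add: coord_field_def[abs_def])
qed

end

locale torsion_free_connection = connection +
  assumes torsion_free: "torsion_free A D"
begin

lemma torsion_free_at: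
  assumes "opn W" "vector_field A W X" "vector_field A W Y" "k \<in> A" "x \<in> fst k" "x \<in> W"
  shows "lie_bracket X Y k x = D X Y k x - D Y X k x"
  using torsion_free assms unfolding torsion_free_def field_eq_def by simp

lemma vector_field_lie_bracket:
  assumes "opn W" "vector_field A W X" "vector_field A W Y"
  shows "vector_field A W (lie_bracket X Y)"
proof (rule vector_field_cong[OF assms(1)])
  have "vector_field A W (\<lambda>k x. D X Y k x + (\<lambda>_. -1) x *\<^sub>R D Y X k x)"
    by (intro vector_field_add vector_field_scaleR smooth_fun_const vector_field_D assms)
  then show "vector_field A W (\<lambda>k x. D X Y k x - D Y X k x)" by simp
  show "field_eq A W (\<lambda>k x. D X Y k x - D Y X k x) (lie_bracket X Y)"
    using torsion_free assms unfolding torsion_free_def by blast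
qed

lemma conn_form_symmetric:
  assumes k: "k \<in> A" "x \<in> fst k"
  shows "conn_form D k x u v = conn_form D k x v u"
proof -
  note W = opn_domain[OF k(1)] and vf = vector_field_coord_field[OF k(1)]
  have "chart_deriv k (coord_field k v k) x w = 0" for v w
    using chart_deriv_cong[OF k(1) W k(2,2), of "coord_field k v k" "\<lambda>_. v"]
    by (simp add: coord_field_own_chart[OF k(1)])
  then have "lie_bracket (coord_field k u) (coord_field k v) k x = 0"
    by (simp add: lie_bracket_def)
  then show ?thesis
    using torsion_free_at[OF W vf vf k k(2)] by (simp add: conn_form_def)
qed

text \<open>
  The second derivatives of \<open>Z\<close> cancel by symmetry, and its first derivatives are absorbed by the
  bracket term; this is why the curvature at a point depends on the values of the fields only.
\<close>

lemma curvature_in_chart: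
  assumes k: "k \<in> A" and W: "opn W"
    and X: "vector_field A W X" and Y: "vector_field A W Y" and Z: "vector_field A W Z"
    and x: "x \<in> fst k" "x \<in> W"
  shows "curvature D X Y Z k x = curv_form D k x (X k x) (Y k x) (Z k x)"
proof -
  let ?V = "W \<inter> fst k" and ?G = "conn_form D k" and ?d = "chart_deriv k"
  have V: "opn ?V" by (intro opn_Int W opn_domain k)
  have xV: "x \<in> ?V" using x by blast
  have smooth: "smooth_in k ?V (F k)" if "vector_field A W F" for F
    by (rule smooth_in_subset[OF vector_field_smooth_in[OF that k]]) blast
  note sX = smooth[OF X] and sY = smooth[OF Y] and sZ = smooth[OF Z]
  have G: "smooth_in k ?V (\<lambda>y. ?G y u v)" for u v
    by (rule smooth_in_subset[OF smooth_in_conn_form[OF k]]) blast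
  have bil: "bilinear (?G y)" if "y \<in> fst k" for y by (rule bilinear_conn_form[OF k that])
  have lin: "linear (?d (Z k) y)" if "y \<in> fst k" "y \<in> ?V" for y
    by (rule linear_chart_deriv[OF k V sZ that])
  have DD: "D P (D Q Z) k x =
      ?d (\<lambda>y. ?d (Z k) y (Q k x)) x (P k x) + ?d (Z k) x (?d (Q k) x (P k x))
      + ?d (\<lambda>y. ?G y (Q k x) (Z k x)) x (P k x) + ?G x (?d (Q k) x (P k x)) (Z k x)
      + ?G x (Q k x) (?d (Z k) x (P k x))
      + ?G x (P k x) (?d (Z k) x (Q k x)) + ?G x (P k x) (?G x (Q k x) (Z k x))"
    if P: "vector_field A W P" and Q: "vector_field A W Q" for P Q
  proof -
    note sQ = smooth[OF Q]
    have DQZ: "D Q Z k y = ?d (Z k) y (Q k y) + ?G y (Q k y) (Z k y)"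
      if "y \<in> fst k" "y \<in> ?V" for y
      using connection_in_chart[OF k W Q Z, of y] that by blast
    have "?d (D Q Z k) x (P k x) = ?d (\<lambda>y. ?d (Z k) y (Q k y) + ?G y (Q k y) (Z k y)) x (P k x)"
      using chart_deriv_cong[OF k V x(1) xV DQZ] by simp
    also have "\<dots> = ?d (\<lambda>y. ?d (Z k) y (Q k y)) x (P k x) + ?d (\<lambda>y. ?G y (Q k y) (Z k y)) x (P k x)"
      by (rule chart_deriv_add[OF k V smooth_in_chart_deriv[OF k V sZ sQ]
            smooth_in_bilinear_family[OF k V bil G sQ sZ] x(1) xV])
    also have "?d (\<lambda>y. ?d (Z k) y (Q k y)) x (P k x) =
        ?d (\<lambda>y. ?d (Z k) y (Q k x)) x (P k x) + ?d (Z k) x (?d (Q k) x (P k x))"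
      by (rule chart_deriv_linear_family[OF k V x(1) xV lin
            smooth_in_chart_deriv[OF k V sZ smooth_in_const] sQ])
    also have "?d (\<lambda>y. ?G y (Q k y) (Z k y)) x (P k x) =
        ?d (\<lambda>y. ?G y (Q k x) (Z k x)) x (P k x) + ?G x (?d (Q k) x (P k x)) (Z k x)
          + ?G x (Q k x) (?d (Z k) x (P k x))"
      by (rule chart_deriv_bilinear_family[OF k V x(1) xV bil G sQ sZ])
    finally have dDQZ: "?d (D Q Z k) x (P k x) =
        ?d (\<lambda>y. ?d (Z k) y (Q k x)) x (P k x) + ?d (Z k) x (?d (Q k) x (P k x))
        + (?d (\<lambda>y. ?G y (Q k x) (Z k x)) x (P k x) + ?G x (?d (Q k) x (P k x)) (Z k x)
          + ?G x (Q k x) (?d (Z k) x (P k x)))" .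
    have "D P (D Q Z) k x = ?d (D Q Z k) x (P k x) + ?G x (P k x) (D Q Z k x)"
      by (rule connection_in_chart[OF k W P vector_field_D[OF W Q Z] x])
    then show ?thesis
      unfolding dDQZ DQZ[OF x(1) xV] using bilinear_radd[OF bil[OF x(1)]] by (simp add: add.assoc)
  qed
  have bracket: "D (lie_bracket X Y) Z k x =
      ?d (Z k) x (?d (Y k) x (X k x)) - ?d (Z k) x (?d (X k) x (Y k x))
      + ?G x (?d (Y k) x (X k x)) (Z k x) - ?G x (?d (X k) x (Y k x)) (Z k x)"
    using connection_in_chart[OF k W vector_field_lie_bracket[OF W X Y] Z x]
    by (simp add: lie_bracket_def linear_diff[OF lin[OF x(1) xV]] bilinear_lsub[OF bil[OF x(1)]])
  have "?d (\<lambda>y. ?d (Z k) y (Y k x)) x (X k x) = ?d (\<lambda>y. ?d (Z k) y (X k x)) x (Y k x)"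
    by (rule chart_deriv_symmetric[OF k V sZ x(1) xV])
  then show ?thesis
    unfolding curvature_def curv_form_def DD[OF X Y] DD[OF Y X] bracket by (simp add: algebra_simps)
qed

lemma curvature_coord_fields:
  assumes "k \<in> A" "x \<in> fst k"
  shows "curvature D (coord_field k u) (coord_field k v) (coord_field k w) k x = curv_form D k x u v w"
proof -
  note vf = vector_field_coord_field[OF assms(1)]
  show ?thesis
    using curvature_in_chart[OF assms(1) opn_domain[OF assms(1)] vf vf vf assms(2,2)]
    by (simp add: coord_field_own_chart assms)
qed

lemma ricci_in_chart:
  "k \<in> A \<Longrightarrow> x \<in> fst k \<Longrightarrow> ricci D k x u v = (\<Sum>b\<in>Basis. curv_form D k x b u v \<bullet> b)"
  by (simp add: ricci_def curvature_coord_fields)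

lemma vector_field_curvature:
  assumes "opn W" "vector_field A W X" "vector_field A W Y" "vector_field A W Z"
  shows "vector_field A W (curvature D X Y Z)"
proof -
  have "vector_field A W (\<lambda>k x. (D X (D Y Z) k x + (\<lambda>_. -1) x *\<^sub>R D Y (D X Z) k x)
      + (\<lambda>_. -1) x *\<^sub>R D (lie_bracket X Y) Z k x)"
    by (intro vector_field_add vector_field_scaleR smooth_fun_const vector_field_D
        vector_field_lie_bracket assms)
  then show ?thesis by (simp add: curvature_def)
qed

lemma smooth_in_curv_form:
  assumes "k \<in> A" shows "smooth_in k (fst k) (\<lambda>x. curv_form D k x u v w)"
proof -
  note vf = vector_field_coord_field[OF assms]
  have "smooth_in k (fst k) (curvature D (coord_field k u) (coord_field k v) (coord_field k w) k)"
    by (rule vector_field_smooth_in[OF vector_field_curvature[OF opn_domain[OF assms] vf vf vf] assms])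
  then show ?thesis
    by (subst smooth_in_cong[OF assms opn_domain[OF assms] curvature_coord_fields[OF assms, symmetric]])
qed

text \<open>
  The curvature of coordinate fields of \<open>k\<close> is a vector field, which in the chart \<open>k'\<close> depends on the
  components of these fields only.
\<close>

lemma curv_form_change_chart:
  assumes "k \<in> A" "k' \<in> A" "x \<in> fst k" "x \<in> fst k'"
  shows "curv_form D k' x (jac k k' x u) (jac k k' x v) (jac k k' x w) =
    jac k k' x (curv_form D k x u v w)"
proof -
  note W = opn_domain[OF assms(1)] and vf = vector_field_coord_field[OF assms(1)]
  have "jac k k' x (curv_form D k x u v w) =
      curvature D (coord_field k u) (coord_field k v) (coord_field k w) k' x"
    unfolding curvature_coord_fields[OF assms(1,3), symmetric]
    by (rule vector_field_jac[OF vector_field_curvature[OF W vf vf vf] assms(1,2,3,4,3), symmetric])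
  also have "\<dots> = curv_form D k' x (jac k k' x u) (jac k k' x v) (jac k k' x w)"
    using curvature_in_chart[OF assms(2) W vf vf vf assms(4,3)] by (simp add: coord_field_def)
  finally show ?thesis by simp
qed

lemma linear_curv_form:
  assumes "k \<in> A" "x \<in> fst k"
  shows "linear (\<lambda>u. curv_form D k x u v w)" "linear (\<lambda>v. curv_form D k x u v w)"
    "linear (\<lambda>w. curv_form D k x u v w)"
proof -
  note W = opn_domain[OF assms(1)] and bil = bilinear_conn_form[OF assms(1)]
  note s = smooth_in_conn_form[OF assms(1)]
  have d: "linear (chart_deriv k (\<lambda>y. conn_form D k y u v) x)" for u v
    by (rule linear_chart_deriv[OF assms(1) W s assms(2,2)])
  have d': "linear (\<lambda>u. chart_deriv k (\<lambda>y. conn_form D k y u v) x w)"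
    "linear (\<lambda>u. chart_deriv k (\<lambda>y. conn_form D k y v u) x w)" for v w
    using bil s
    by (safe intro!: linear_chart_deriv_family[OF assms(1) W assms(2,2)]) (simp_all add: bilinear_def)
  have b1: "linear (conn_form D k x a)" and b2: "linear (\<lambda>u. conn_form D k x u a)" for a
    using bil[OF assms(2)] by (simp_all add: bilinear_def)
  have b12: "linear (\<lambda>u. conn_form D k x a (conn_form D k x u b))"
    "linear (\<lambda>u. conn_form D k x a (conn_form D k x b u))" for a b
    using linear_compose[OF b2 b1] linear_compose[OF b1 b1] by (simp_all add: comp_def)
  show "linear (\<lambda>u. curv_form D k x u v w)" "linear (\<lambda>v. curv_form D k x u v w)"
    "linear (\<lambda>w. curv_form D k x u v w)"
    unfolding curv_form_def
    by (intro linear_compose_add linear_compose_sub d d' b1 b2 b12)+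
qed

lemma bilinear_ricci:
  assumes "k \<in> A" "x \<in> fst k" shows "bilinear (ricci D k x)"
  unfolding bilinear_def ricci_in_chart[OF assms, abs_def]
  using linear_curv_form[OF assms]
  by (auto intro!: linear_compose_sum linear_compose[OF _ bounded_linear.linear[OF
          bounded_linear_inner_left], unfolded comp_def])

lemma smooth_in_ricci:
  assumes "k \<in> A" shows "smooth_in k (fst k) (\<lambda>x. ricci D k x u v)"
proof -
  note W = opn_domain[OF assms]
  have "smooth_in k (fst k) (\<lambda>x. \<Sum>b\<in>Basis. curv_form D k x b u v \<bullet> b)"
    by (intro smooth_in_sum smooth_in_inner smooth_in_curv_form smooth_in_const W assms)
  then show ?thesis by (subst smooth_in_cong[OF assms W ricci_in_chart[OF assms]])
qed

text \<open>A trace of an endomorphism is the same in the coordinate frames of both charts.\<close>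

lemma ricci_change_chart:
  assumes "k \<in> A" "k' \<in> A" "x \<in> fst k" "x \<in> fst k'"
  shows "ricci D k' x (jac k k' x u) (jac k k' x v) = ricci D k x u v"
proof -
  have "ricci D k' x (jac k k' x u) (jac k k' x v) =
      (\<Sum>b\<in>Basis. jac k k' x (curv_form D k x (jac k' k x b) u v) \<bullet> b)"
    using assms by (simp add: ricci_in_chart curv_form_change_chart[symmetric] jac_inverse)
  also have "\<dots> = ricci D k x u v"
    unfolding ricci_in_chart[OF assms(1,3)]
    by (rule trace_conjugate) (use assms in \<open>auto intro: linear_jac linear_curv_form simp: jac_inverse\<close>)
  finally show ?thesis .
qed

end

section \<open>The Levi-Civita connection from Christoffel symbols\<close>

definition coord_connection ::
  "(('m, 'e::euclidean_space) chart \<Rightarrow> 'm \<Rightarrow> 'e \<Rightarrow> 'e \<Rightarrow> 'e) \<Rightarrow> ('m, 'e) connection" where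
  "coord_connection \<Gamma> X Y = (\<lambda>k x. chart_deriv k (Y k) x (X k x) + \<Gamma> k x (X k x) (Y k x))"

context atlas
begin

lemma chart_deriv_scaleR:
  assumes "k \<in> A" "opn W" "smooth_in k W f" "smooth_in k W g" "x \<in> fst k" "x \<in> W"
  shows "chart_deriv k (\<lambda>y. f y *\<^sub>R g y) x v = f x *\<^sub>R chart_deriv k g x v + chart_deriv k f x v *\<^sub>R g x"
  using has_derivative_scaleR[OF smooth_in_imp_has_derivative[OF assms(1-3,5,6)]
      smooth_in_imp_has_derivative[OF assms(1,2,4-6)]] assms(1,5)
  by (intro chart_deriv_eqI) (simp add: comp_def)

end

text \<open>
  Conversely, symmetric Christoffel symbols in all charts that obey the transformation law define a
  torsion-free connection.
\<close>

locale christoffel_family = atlas A for A :: "('m, 'e::euclidean_space) chart set" +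
  fixes \<Gamma> :: "('m, 'e) chart \<Rightarrow> 'm \<Rightarrow> 'e \<Rightarrow> 'e \<Rightarrow> 'e"
  assumes bilinear_\<Gamma>: "\<And>k x. k \<in> A \<Longrightarrow> x \<in> fst k \<Longrightarrow> bilinear (\<Gamma> k x)"
    and smooth_\<Gamma>: "\<And>k u v. k \<in> A \<Longrightarrow> smooth_in k (fst k) (\<lambda>x. \<Gamma> k x u v)"
    and symmetric_\<Gamma>: "\<And>k x u v. k \<in> A \<Longrightarrow> x \<in> fst k \<Longrightarrow> \<Gamma> k x u v = \<Gamma> k x v u"
    and change_\<Gamma>: "\<And>k k' x u v. k \<in> A \<Longrightarrow> k' \<in> A \<Longrightarrow> x \<in> fst k \<Longrightarrow> x \<in> fst k' \<Longrightarrow>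
      jac k k' x (\<Gamma> k x u v) =
        chart_deriv k (\<lambda>y. jac k k' y v) x u + \<Gamma> k' x (jac k k' x u) (jac k k' x v)"
begin

lemma vector_field_coord_connection:
  assumes W: "opn W" and X: "vector_field A W X" and Y: "vector_field A W Y"
  shows "vector_field A W (coord_connection \<Gamma> X Y)"
  unfolding vector_field_iff coord_connection_def
proof (intro conjI ballI)
  fix k assume k: "k \<in> A"
  let ?V = "W \<inter> fst k"
  have V: "opn ?V" by (intro opn_Int W opn_domain k)
  have smooth: "smooth_in k ?V (Z k)" if "vector_field A W Z" for Z
    by (rule smooth_in_subset[OF vector_field_smooth_in[OF that k]]) blast
  have "smooth_in k ?V (\<lambda>x. chart_deriv k (Y k) x (X k x) + \<Gamma> k x (X k x) (Y k x))"
    by (rule smooth_in_add[OF k V smooth_in_chart_deriv[OF k V smooth[OF Y] smooth[OF X]]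
          smooth_in_bilinear_family[OF k V bilinear_\<Gamma>[OF k] smooth_in_subset[OF smooth_\<Gamma>[OF k]]
            smooth[OF X] smooth[OF Y]]]) auto
  then show "smooth_in k W (\<lambda>x. chart_deriv k (Y k) x (X k x) + \<Gamma> k x (X k x) (Y k x))"
    by (simp add: smooth_in_def Int_absorb2 inf.commute[of W] inf.assoc[symmetric])
next
  fix k k' x assume k: "k \<in> A" "k' \<in> A" and x: "x \<in> fst k \<inter> fst k' \<inter> W"
  let ?V = "W \<inter> fst k \<inter> fst k'" and ?J = "jac k k'"
  have V: "opn ?V" by (intro opn_Int W opn_domain k)
  have xV: "x \<in> fst k" "x \<in> fst k'" "x \<in> W" "x \<in> ?V" using x by auto
  have "chart_deriv k' (Y k') x (?J x (X k x)) = chart_deriv k (Y k') x (X k x)"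
    by (rule chart_deriv_change_chart[OF k W xV(3,1,2) vector_field_smooth_in[OF Y k(2)], symmetric])
  also have "\<dots> = chart_deriv k (\<lambda>y. ?J y (Y k y)) x (X k x)"
    by (rule fun_cong[OF chart_deriv_cong[OF k(1) V xV(1,4)]])
      (use vector_field_jac[OF Y k] in auto)
  also have "\<dots> = chart_deriv k (\<lambda>y. ?J y (Y k x)) x (X k x) + ?J x (chart_deriv k (Y k) x (X k x))"
    by (rule chart_deriv_linear_family[OF k(1) V xV(1,4) linear_jac[OF k]
          smooth_in_subset[OF smooth_in_jac[OF k]]
          smooth_in_subset[OF vector_field_smooth_in[OF Y k(1)]]]) auto
  finally show "chart_deriv k' (Y k') x (X k' x) + \<Gamma> k' x (X k' x) (Y k' x) =
      ?J x (chart_deriv k (Y k) x (X k x) + \<Gamma> k x (X k x) (Y k x))"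
    using vector_field_jac[OF X k xV(1-3)] vector_field_jac[OF Y k xV(1-3)]
    by (simp add: linear_add[OF linear_jac[OF k xV(1,2)]] change_\<Gamma>[OF k xV(1,2)])
qed

lemma affine_connection_coord_connection: "affine_connection A (coord_connection \<Gamma>)"
  unfolding affine_connection_def
proof (intro allI impI conjI)
  fix W X Y assume W: "opn W" and X: "vector_field A W X" and Y: "vector_field A W Y"
  note s = vector_field_smooth_in
  show "vector_field A W (coord_connection \<Gamma> X Y)"
    by (rule vector_field_coord_connection[OF W X Y])
  {
    fix f assume f: "smooth_fun A W f"
    show "field_eq A W (coord_connection \<Gamma> (\<lambda>k x. f x *\<^sub>R X k x) Y)
        (\<lambda>k x. f x *\<^sub>R coord_connection \<Gamma> X Y k x)"
      unfolding field_eq_def coord_connection_def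
    proof (intro ballI)
      fix k x assume *: "k \<in> A" "x \<in> fst k \<inter> W"
      then have x: "x \<in> fst k" "x \<in> W" by auto
      show "chart_deriv k (Y k) x (f x *\<^sub>R X k x) + \<Gamma> k x (f x *\<^sub>R X k x) (Y k x) =
          f x *\<^sub>R (chart_deriv k (Y k) x (X k x) + \<Gamma> k x (X k x) (Y k x))"
        by (simp only: linear_scale[OF linear_chart_deriv[OF *(1) W s[OF Y *(1)] x]]
            bilinear_lmul[OF bilinear_\<Gamma>[OF *(1) x(1)]] scaleR_add_right)
    qed
    show "field_eq A W (coord_connection \<Gamma> X (\<lambda>k x. f x *\<^sub>R Y k x))
        (\<lambda>k x. chart_deriv k f x (X k x) *\<^sub>R Y k x + f x *\<^sub>R coord_connection \<Gamma> X Y k x)"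
      unfolding field_eq_def coord_connection_def
    proof (intro ballI)
      fix k x assume *: "k \<in> A" "x \<in> fst k \<inter> W"
      then have "smooth_in k W f" using f by (simp add: smooth_fun_iff)
      with * show "chart_deriv k (\<lambda>x. f x *\<^sub>R Y k x) x (X k x) + \<Gamma> k x (X k x) (f x *\<^sub>R Y k x) =
          chart_deriv k f x (X k x) *\<^sub>R Y k x
          + f x *\<^sub>R (chart_deriv k (Y k) x (X k x) + \<Gamma> k x (X k x) (Y k x))"
        using bilinear_rmul[OF bilinear_\<Gamma>[OF *(1), of x]]
        by (simp add: chart_deriv_scaleR[OF *(1) W _ s[OF Y *(1)]] scaleR_add_right)
    qed
  }
  fix X' Y' assume X': "vector_field A W X'" and Y': "vector_field A W Y'"
  show "field_eq A W (coord_connection \<Gamma> X Y) (coord_connection \<Gamma> X' Y')"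
    if eq: "field_eq A W X X'" "field_eq A W Y Y'"
    unfolding field_eq_def coord_connection_def
  proof (intro ballI)
    fix k x assume *: "k \<in> A" "x \<in> fst k \<inter> W"
    have "chart_deriv k (Y k) x = chart_deriv k (Y' k) x"
      by (rule chart_deriv_cong[OF *(1) W]) (use eq * in \<open>auto simp: field_eq_def\<close>)
    moreover have "X k x = X' k x" "Y k x = Y' k x"
      using eq * by (auto simp: field_eq_def)
    ultimately show "chart_deriv k (Y k) x (X k x) + \<Gamma> k x (X k x) (Y k x) =
        chart_deriv k (Y' k) x (X' k x) + \<Gamma> k x (X' k x) (Y' k x)" by simp
  qed
  show "field_eq A W (coord_connection \<Gamma> (\<lambda>k x. X k x + X' k x) Y)
      (\<lambda>k x. coord_connection \<Gamma> X Y k x + coord_connection \<Gamma> X' Y k x)"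
    unfolding field_eq_def coord_connection_def
  proof (intro ballI)
    fix k x assume *: "k \<in> A" "x \<in> fst k \<inter> W"
    then have x: "x \<in> fst k" "x \<in> W" by auto
    show "chart_deriv k (Y k) x (X k x + X' k x) + \<Gamma> k x (X k x + X' k x) (Y k x) =
        chart_deriv k (Y k) x (X k x) + \<Gamma> k x (X k x) (Y k x)
        + (chart_deriv k (Y k) x (X' k x) + \<Gamma> k x (X' k x) (Y k x))"
      by (simp only: linear_add[OF linear_chart_deriv[OF *(1) W s[OF Y *(1)] x]]
          bilinear_ladd[OF bilinear_\<Gamma>[OF *(1) x(1)]] ac_simps)
  qed
  show "field_eq A W (coord_connection \<Gamma> X (\<lambda>k x. Y k x + Y' k x))
      (\<lambda>k x. coord_connection \<Gamma> X Y k x + coord_connection \<Gamma> X Y' k x)"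
    unfolding field_eq_def coord_connection_def
  proof (intro ballI)
    fix k x assume *: "k \<in> A" "x \<in> fst k \<inter> W"
    then have x: "x \<in> fst k" "x \<in> W" by auto
    show "chart_deriv k (\<lambda>x. Y k x + Y' k x) x (X k x) + \<Gamma> k x (X k x) (Y k x + Y' k x) =
        chart_deriv k (Y k) x (X k x) + \<Gamma> k x (X k x) (Y k x)
        + (chart_deriv k (Y' k) x (X k x) + \<Gamma> k x (X k x) (Y' k x))"
      unfolding chart_deriv_add[OF *(1) W s[OF Y *(1)] s[OF Y' *(1)] x]
        bilinear_radd[OF bilinear_\<Gamma>[OF *(1) x(1)]]
      by (simp only: ac_simps)
  qed
qed

lemma torsion_free_coord_connection: "torsion_free A (coord_connection \<Gamma>)"
  unfolding torsion_free_def field_eq_def coord_connection_def lie_bracket_def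
proof (intro allI impI ballI)
  fix W X Y k x assume "k \<in> A" "x \<in> fst k \<inter> W"
  then have "\<Gamma> k x (X k x) (Y k x) = \<Gamma> k x (Y k x) (X k x)" by (intro symmetric_\<Gamma>) auto
  then show "chart_deriv k (Y k) x (X k x) + \<Gamma> k x (X k x) (Y k x)
      - (chart_deriv k (X k) x (Y k x) + \<Gamma> k x (Y k x) (X k x)) =
      chart_deriv k (Y k) x (X k x) - chart_deriv k (X k) x (Y k x)" by simp
qed

sublocale coord: torsion_free_connection A "coord_connection \<Gamma>"
  by unfold_locales (rule affine_connection_coord_connection torsion_free_coord_connection)+

lemma conn_form_coord_connection:
  assumes "k \<in> A" "x \<in> fst k"
  shows "conn_form (coord_connection \<Gamma>) k x u v = \<Gamma> k x u v"
proof -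
  have "chart_deriv k (coord_field k v k) x u = 0"
    using chart_deriv_cong[OF assms(1) opn_domain[OF assms(1)] assms(2,2), of "coord_field k v k" "\<lambda>_. v"]
    by (simp add: coord_field_own_chart[OF assms(1)])
  then show ?thesis
    by (simp add: conn_form_def coord_connection_def coord_field_own_chart[OF assms])
qed

lemma ricci_coord_connection:
  assumes k: "k \<in> A" and x: "x \<in> fst k"
  shows "ricci (coord_connection \<Gamma>) k x u v =
    (\<Sum>b\<in>Basis. (chart_deriv k (\<lambda>y. \<Gamma> k y u v) x b - chart_deriv k (\<lambda>y. \<Gamma> k y b v) x u
      + \<Gamma> k x b (\<Gamma> k x u v) - \<Gamma> k x u (\<Gamma> k x b v)) \<bullet> b)"
proof -
  have "chart_deriv k (\<lambda>y. conn_form (coord_connection \<Gamma>) k y a b) x = chart_deriv k (\<lambda>y. \<Gamma> k y a b) x"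
    for a b
    by (rule chart_deriv_cong[OF k opn_domain[OF k] x x conn_form_coord_connection[OF k]])
  then show ?thesis
    by (simp add: coord.ricci_in_chart[OF k x] curv_form_def conn_form_coord_connection[OF k x])
qed

end

text \<open>An orthonormal basis detects every component of a vector.\<close>

lemma has_signature_nondegenerate:
  assumes sig: "has_signature \<beta> p q" and bil: "bilinear \<beta>" and zero: "\<And>v. \<beta> u v = 0"
  shows "u = 0"
proof -
  obtain P Q where PQ: "independent (P \<union> Q)" "span (P \<union> Q) = UNIV"
    and norm: "\<forall>b\<in>P. \<beta> b b = 1" "\<forall>b\<in>Q. \<beta> b b = -1"
    and orth: "\<forall>a \<in> P \<union> Q. \<forall>b \<in> P \<union> Q. a \<noteq> b \<longrightarrow> \<beta> a b = 0"
    using sig unfolding has_signature_def by blast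
  let ?B = "P \<union> Q"
  have fin: "finite ?B" using PQ(1) by (rule independent_imp_finite)
  have "u \<in> span ?B" by (simp only: PQ(2) UNIV_I)
  then obtain c where c: "u = (\<Sum>b\<in>?B. c b *\<^sub>R b)"
    unfolding span_finite[OF fin] by blast
  have "c b = 0" if b: "b \<in> ?B" for b
  proof -
    have "\<beta> u b = (\<Sum>a\<in>?B. c a * \<beta> a b)"
      unfolding c using bil
      by (simp add: linear_sum[of "\<lambda>a. \<beta> a b"] linear_scale[of "\<lambda>a. \<beta> a b"] bilinear_def)
    also have "\<dots> = (\<Sum>a\<in>?B. if a = b then c b * \<beta> b b else 0)"
      using orth b by (intro sum.cong) auto
    also have "\<dots> = c b * \<beta> b b" using fin b by simp
    finally show ?thesis using zero[of b] norm b by auto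
  qed
  then show ?thesis using c by simp
qed

text \<open>
  Symmetric Christoffel symbols that are compatible with the metric in every chart are the
  Levi-Civita ones. That they fit together to a connection is the uniqueness part of the
  fundamental theorem: the defect in the transformation law, contracted with the metric, is a
  trilinear form symmetric in the first two and skew in the last two arguments.
\<close>

locale metric_christoffel_family = atlas A for A :: "('m, 'e::euclidean_space) chart set" +
  fixes g :: "('m, 'e) tensor2" and p q :: nat and \<Gamma> :: "('m, 'e) chart \<Rightarrow> 'm \<Rightarrow> 'e \<Rightarrow> 'e \<Rightarrow> 'e"
  assumes metric: "pseudo_riemannian_manifold A p q g"
    and bilinear_sym: "\<And>k x. k \<in> A \<Longrightarrow> x \<in> fst k \<Longrightarrow> bilinear (\<Gamma> k x)"
    and smooth_sym: "\<And>k u v. k \<in> A \<Longrightarrow> smooth_in k (fst k) (\<lambda>x. \<Gamma> k x u v)"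
    and symmetric_sym: "\<And>k x u v. k \<in> A \<Longrightarrow> x \<in> fst k \<Longrightarrow> \<Gamma> k x u v = \<Gamma> k x v u"
    and compatible: "\<And>k x u v w. k \<in> A \<Longrightarrow> x \<in> fst k \<Longrightarrow>
      chart_deriv k (\<lambda>y. g k y v w) x u = g k x (\<Gamma> k x u v) w + g k x v (\<Gamma> k x u w)"
begin

lemma bilinear_g: "k \<in> A \<Longrightarrow> x \<in> fst k \<Longrightarrow> bilinear (g k x)"
  and symmetric_g: "k \<in> A \<Longrightarrow> x \<in> fst k \<Longrightarrow> g k x u v = g k x v u"
  and signature_g: "k \<in> A \<Longrightarrow> x \<in> fst k \<Longrightarrow> has_signature (g k x) p q"
  and invariant_g: "k \<in> A \<Longrightarrow> k' \<in> A \<Longrightarrow> x \<in> fst k \<Longrightarrow> x \<in> fst k' \<Longrightarrow>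
    g k' x (jac k k' x u) (jac k k' x v) = g k x u v"
  using metric unfolding pseudo_riemannian_manifold_def by blast+

lemma smooth_in_g: "k \<in> A \<Longrightarrow> smooth_in k (fst k) (\<lambda>x. g k x u v)"
  using metric by (simp add: pseudo_riemannian_manifold_def smooth_in_def comp_def)

lemma christoffel_change_chart:
  assumes k: "k \<in> A" "k' \<in> A" and x: "x \<in> fst k" "x \<in> fst k'"
  shows "jac k k' x (\<Gamma> k x u v) =
    chart_deriv k (\<lambda>y. jac k k' y v) x u + \<Gamma> k' x (jac k k' x u) (jac k k' x v)"
proof -
  let ?V = "fst k \<inter> fst k'" and ?J = "jac k k'"
  have V: "opn ?V" by (intro opn_Int opn_domain k)
  have xV: "x \<in> ?V" using x by blast
  define H where "H u v = chart_deriv k (\<lambda>y. ?J y v) x u" for u v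
  define T where "T u v = ?J x (\<Gamma> k x u v) - H u v - \<Gamma> k' x (?J x u) (?J x v)" for u v
  note bg = bilinear_g[OF k(2) x(2)]
  have sym_T: "T u v = T v u" for u v
  proof -
    have "H u v = H v u"
      unfolding H_def jac_eq_chart_deriv
      by (rule chart_deriv_symmetric[OF k(1) opn_domain[OF k(2)] smooth_in_coordinates[OF k] x])
    then show ?thesis
      unfolding T_def
      using symmetric_sym[OF k(1) x(1), of u v] symmetric_sym[OF k(2) x(2), of "?J x u" "?J x v"]
      by simp
  qed
  have skew: "g k' x (T u v) (?J x w) = - g k' x (T u w) (?J x v)" for u v w
  proof -
    have sg: "smooth_in k ?V (\<lambda>y. g k' y a b)" for a b
      by (rule smooth_in_change_chart[OF k(2,1) V _ smooth_in_subset[OF smooth_in_g[OF k(2)]]]) auto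
    have sJ: "smooth_in k ?V (\<lambda>y. ?J y a)" for a
      by (rule smooth_in_subset[OF smooth_in_jac[OF k]]) blast
    have "g k' x (?J x (\<Gamma> k x u v)) (?J x w) + g k' x (?J x v) (?J x (\<Gamma> k x u w))
        = chart_deriv k (\<lambda>y. g k y v w) x u"
      by (simp add: invariant_g[OF k x] compatible[OF k(1) x(1)])
    also have "\<dots> = chart_deriv k (\<lambda>y. g k' y (?J y v) (?J y w)) x u"
      by (rule fun_cong[OF chart_deriv_cong[OF k(1) V x(1) xV]]) (use invariant_g[OF k] in auto)
    also have "\<dots> = chart_deriv k (\<lambda>y. g k' y (?J x v) (?J x w)) x u
        + g k' x (H u v) (?J x w) + g k' x (?J x v) (H u w)"
      unfolding H_def
      by (rule chart_deriv_bilinear_family[OF k(1) V x(1) xV _ sg sJ sJ]) (use bilinear_g[OF k(2)] in auto)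
    also have "chart_deriv k (\<lambda>y. g k' y (?J x v) (?J x w)) x u =
        g k' x (\<Gamma> k' x (?J x u) (?J x v)) (?J x w) + g k' x (?J x v) (\<Gamma> k' x (?J x u) (?J x w))"
      using chart_deriv_change_chart[OF k opn_domain[OF k(2)] x(2,1,2) smooth_in_g[OF k(2)]]
        compatible[OF k(2) x(2)] by simp
    finally have "g k' x (T u v) (?J x w) + g k' x (?J x v) (T u w) = 0"
      by (simp add: T_def bilinear_lsub[OF bg] bilinear_rsub[OF bg])
    then show ?thesis using symmetric_g[OF k(2) x(2), of "?J x v" "T u w"] by simp
  qed
  (* Six alternating uses of the symmetry and the skewness lead back to the same value with
     the opposite sign. *)
  have "g k' x (T u v) (?J x w) = 0" for w
    using skew[of u v w] skew[of w u v] skew[of v w u] sym_T[of u w] sym_T[of v w] sym_T[of u v] by simp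
  then have "g k' x (T u v) z = 0" for z
    using jac_inverse[OF k(2,1) x(2,1), of z] by metis
  then have "T u v = 0"
    by (rule has_signature_nondegenerate[OF signature_g[OF k(2) x(2)] bg])
  then show ?thesis by (simp add: T_def H_def algebra_simps)
qed

sublocale christoffel_family A \<Gamma>
  by unfold_locales (fact bilinear_sym smooth_sym symmetric_sym christoffel_change_chart)+

lemma levi_civita_coord_connection: "levi_civita A g (coord_connection \<Gamma>)"
  unfolding levi_civita_def
proof (intro conjI allI impI ballI)
  fix W X Y Z k x
  assume W: "opn W" and X: "vector_field A W X" and Y: "vector_field A W Y" and Z: "vector_field A W Z"
    and k: "k \<in> A" and x: "x \<in> fst k \<inter> W"
  let ?V = "W \<inter> fst k"
  have V: "opn ?V" by (intro opn_Int W opn_domain k)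
  have "chart_deriv k (\<lambda>y. g k y (Y k y) (Z k y)) x (X k x) =
      chart_deriv k (\<lambda>y. g k y (Y k x) (Z k x)) x (X k x)
      + g k x (chart_deriv k (Y k) x (X k x)) (Z k x) + g k x (Y k x) (chart_deriv k (Z k) x (X k x))"
    by (rule chart_deriv_bilinear_family[OF k V _ _ bilinear_g[OF k] smooth_in_subset[OF smooth_in_g[OF k]]
          smooth_in_subset[OF vector_field_smooth_in[OF Y k]]
          smooth_in_subset[OF vector_field_smooth_in[OF Z k]]]) (use x in auto)
  then show "chart_deriv k (\<lambda>y. g k y (Y k y) (Z k y)) x (X k x) =
      g k x (coord_connection \<Gamma> X Y k x) (Z k x) + g k x (Y k x) (coord_connection \<Gamma> X Z k x)"
    using x k by (simp add: coord_connection_def compatible bilinear_ladd[OF bilinear_g]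
        bilinear_radd[OF bilinear_g])
qed (rule affine_connection_coord_connection torsion_free_coord_connection)+

end

section \<open>Manifold structures on total spaces\<close>

context atlas
begin

lemma topspace_manifold: "topspace (manifold_topology A) = points A"
proof -
  have "opn (points A)"
    unfolding opn_iff points_def
  proof (intro conjI ballI)
    fix k assume "k \<in> A"
    then have "fst k \<inter> (\<Union>k\<in>A. fst k) = fst k" by blast
    then show "open (snd k ` (fst k \<inter> (\<Union>k\<in>A. fst k)))"
      using atlas \<open>k \<in> A\<close> by (simp add: smooth_atlas_def)
  qed simp
  then show ?thesis using opn_iff unfolding topspace_def by blast
qed

lemma opn_chart_preimage:
  assumes k: "k \<in> A" and U: "open U"
  shows "opn {x \<in> fst k. snd k x \<in> U}"
  unfolding opn_iff
proof (intro conjI ballI)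
  show "{x \<in> fst k. snd k x \<in> U} \<subseteq> points A" using k by (auto simp: points_def)
  fix k' assume k': "k' \<in> A"
  let ?S = "snd k' ` (fst k' \<inter> fst k)"
  have "continuous_on ?S (snd k \<circ> chart_inv k')"
    using smooth_on_imp_continuous_on smooth_in_coordinates[OF k' k] unfolding smooth_in_def by blast
  then have "open (?S \<inter> (snd k \<circ> chart_inv k') -` U)"
    by (rule continuous_open_preimage[OF _ open_image[OF k' opn_domain[OF k]] U])
  also have "?S \<inter> (snd k \<circ> chart_inv k') -` U = snd k' ` (fst k' \<inter> {x \<in> fst k. snd k x \<in> U})"
    using k' by auto
  finally show "open (snd k' ` (fst k' \<inter> {x \<in> fst k. snd k x \<in> U}))" .
qed

text \<open>The atlas itself may be uncountable, but a space with a countable basis has the Lindeloef property.\<close>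

lemma countable_subatlas:
  assumes "second_countable (manifold_topology A)"
  obtains C where "C \<subseteq> A" "countable C" "points C = points A"
proof -
  have "Lindelof_space (manifold_topology A)"
    by (rule second_countable_imp_Lindelof_space[OF assms])
  moreover have "opn U" if "U \<in> fst ` A" for U using that opn_domain by blast
  moreover have "\<Union>(fst ` A) = topspace (manifold_topology A)"
    by (simp add: topspace_manifold points_def)
  ultimately obtain V where "countable V" "V \<subseteq> fst ` A" "\<Union>V = topspace (manifold_topology A)"
    using Lindelof_spaceD by (metis (no_types, lifting))
  then obtain C where "C \<subseteq> A" "countable C" "V = fst ` C"
    using countable_subset_image[of V fst A] by blast
  then show thesis
    using that \<open>\<Union>V = _\<close> by (simp add: topspace_manifold points_def)
qed

lemma second_countable_if_countable_subatlas:
  assumes C: "C \<subseteq> A" "countable C" "points C = points A"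
  shows "second_countable (manifold_topology A)"
proof -
  obtain \<B> :: "'e set set" where \<B>: "countable \<B>" "\<And>U. U \<in> \<B> \<Longrightarrow> open U"
    "\<And>S. open S \<Longrightarrow> \<exists>\<U>. \<U> \<subseteq> \<B> \<and> S = \<Union>\<U>"
    using univ_second_countable by blast
  let ?P = "\<lambda>(k, U). {x \<in> fst k. snd k x \<in> U}"
  have "countable (?P ` (C \<times> \<B>))" using C(2) \<B>(1) by simp
  moreover have "opn V" if "V \<in> ?P ` (C \<times> \<B>)" for V
    using that opn_chart_preimage C(1) \<B>(2) by auto
  moreover have "\<exists>V \<in> ?P ` (C \<times> \<B>). x \<in> V \<and> V \<subseteq> W" if W: "opn W" and x: "x \<in> W" for W x
  proof -
    have "x \<in> points C" using W x C(3) by (auto simp: opn_iff)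
    then obtain k where k: "k \<in> C" "x \<in> fst k" by (auto simp: points_def)
    then have "open (snd k ` (fst k \<inter> W))" using open_image W C(1) by blast
    then obtain \<U> where \<U>: "\<U> \<subseteq> \<B>" "snd k ` (fst k \<inter> W) = \<Union>\<U>" using \<B>(3) by blast
    moreover have "snd k x \<in> snd k ` (fst k \<inter> W)" using k(2) x by blast
    ultimately obtain U where U: "U \<in> \<B>" "snd k x \<in> U" "U \<subseteq> snd k ` (fst k \<inter> W)" by blast
    have "inj_on (snd k) (fst k)" using atlas k(1) C(1) by (auto simp: smooth_atlas_def)
    then have "{x \<in> fst k. snd k x \<in> U} \<subseteq> W" using U(3) by (auto dest: inj_onD)
    moreover have "{x \<in> fst k. snd k x \<in> U} \<in> ?P ` (C \<times> \<B>)" using k(1) U(1) by auto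
    ultimately show ?thesis using k(2) U(2) by (intro bexI[of _ "{x \<in> fst k. snd k x \<in> U}"]) auto
  qed
  ultimately show ?thesis
    unfolding second_countable_def by (intro exI[of _ "?P ` (C \<times> \<B>)"] conjI ballI allI impI) auto
qed

end

text \<open>
  If the charts of a total space are indexed by the charts of the base and have the preimages of
  their domains as domains, the base supplies what is needed: two points over different base points
  are separated below, two points of one fibre lie in a common chart, and countably many chart domains
  cover the base by the Lindeloef property.
\<close>

lemma smooth_manifold_total_space:
  fixes A :: "('m, 'e::euclidean_space) chart set"
    and \<psi> :: "('m, 'e) chart \<Rightarrow> ('z, 'f::euclidean_space) chart" and \<pi> :: "'z \<Rightarrow> 'm"
  assumes M: "smooth_manifold A" and B: "smooth_atlas (\<psi> ` A)"
    and dom: "\<And>k. k \<in> A \<Longrightarrow> fst (\<psi> k) = {z \<in> points (\<psi> ` A). \<pi> z \<in> fst k}"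
    and cont: "\<And>k W. k \<in> A \<Longrightarrow> openin (manifold_topology A) W \<Longrightarrow>
      open (snd (\<psi> k) ` {z \<in> fst (\<psi> k). \<pi> z \<in> W})"
  shows "smooth_manifold (\<psi> ` A)"
proof -
  interpret base: atlas A using M by unfold_locales (simp add: smooth_manifold_def)
  interpret total: atlas "\<psi> ` A" by unfold_locales (rule B)
  have domD: "\<pi> z \<in> fst k" if "k \<in> A" "z \<in> fst (\<psi> k)" for k z
    using that(2) unfolding dom[OF that(1)] by blast
  have domI: "z \<in> fst (\<psi> k)" if "k \<in> A" "z \<in> points (\<psi> ` A)" "\<pi> z \<in> fst k" for k z
    unfolding dom[OF that(1)] using that(2,3) by blast
  have base_point: "\<pi> z \<in> points A" if "z \<in> points (\<psi> ` A)" for z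
    using that domD by (auto simp: points_def)
  have preimage: "total.opn {z \<in> points (\<psi> ` A). \<pi> z \<in> W}" if W: "base.opn W" for W
    unfolding total.opn_iff
  proof (intro conjI ballI)
    fix K assume "K \<in> \<psi> ` A"
    then obtain k where k: "k \<in> A" "K = \<psi> k" by blast
    then have "fst K \<inter> {z \<in> points (\<psi> ` A). \<pi> z \<in> W} = {z \<in> fst (\<psi> k). \<pi> z \<in> W}"
      by (auto simp: points_def)
    then show "open (snd K ` (fst K \<inter> {z \<in> points (\<psi> ` A). \<pi> z \<in> W}))"
      using cont[OF k(1) W] k(2) by simp
  qed blast
  have "Hausdorff_space (manifold_topology (\<psi> ` A))"
    unfolding Hausdorff_space_def total.topspace_manifold
  proof (intro allI impI)
    fix z w assume zw: "z \<in> points (\<psi> ` A) \<and> w \<in> points (\<psi> ` A) \<and> z \<noteq> w"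
    show "\<exists>U V. total.opn U \<and> total.opn V \<and> z \<in> U \<and> w \<in> V \<and> disjnt U V"
    proof (cases "\<pi> z = \<pi> w")
      case False
      have "Hausdorff_space (manifold_topology A)" using M by (simp add: smooth_manifold_def)
      then obtain U V where UV: "base.opn U" "base.opn V" "\<pi> z \<in> U" "\<pi> w \<in> V" "disjnt U V"
        unfolding Hausdorff_space_def base.topspace_manifold
        using False base_point[of z] base_point[of w] zw by metis
      show ?thesis
        using preimage[OF UV(1)] preimage[OF UV(2)] UV(3-5) zw
        by (intro exI[of _ "{z \<in> points (\<psi> ` A). \<pi> z \<in> U}"] exI[of _ "{z \<in> points (\<psi> ` A). \<pi> z \<in> V}"])
          (auto simp: disjnt_def)
    next
      case True
      obtain k where k: "k \<in> A" "z \<in> fst (\<psi> k)" using zw by (auto simp: points_def)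
      let ?K = "\<psi> k"
      have w: "w \<in> fst ?K" using domI[OF k(1)] domD[OF k] True zw by simp
      have "inj_on (snd ?K) (fst ?K)" using B k(1) by (simp add: smooth_atlas_def)
      then have "snd ?K z \<noteq> snd ?K w" using k(2) w zw by (auto dest: inj_onD)
      then obtain U V where UV: "open U" "open V" "snd ?K z \<in> U" "snd ?K w \<in> V" "U \<inter> V = {}"
        using hausdorff by metis
      have K: "?K \<in> \<psi> ` A" using k(1) by blast
      show ?thesis
        using total.opn_chart_preimage[OF K UV(1)] total.opn_chart_preimage[OF K UV(2)] UV(3-5) k(2) w
        by (intro exI[of _ "{x \<in> fst ?K. snd ?K x \<in> U}"] exI[of _ "{x \<in> fst ?K. snd ?K x \<in> V}"])
          (auto simp: disjnt_def)
    qed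
  qed
  moreover obtain C where C: "C \<subseteq> A" "countable C" "points C = points A"
    using base.countable_subatlas M by (metis smooth_manifold_def)
  have "second_countable (manifold_topology (\<psi> ` A))"
  proof (rule total.second_countable_if_countable_subatlas)
    show "\<psi> ` C \<subseteq> \<psi> ` A" "countable (\<psi> ` C)" using C by auto
    show "points (\<psi> ` C) = points (\<psi> ` A)"
    proof (intro subset_antisym subsetI)
      fix z assume z: "z \<in> points (\<psi> ` A)"
      then have "\<pi> z \<in> points C" using base_point C(3) by simp
      then obtain k where k: "k \<in> C" "\<pi> z \<in> fst k" by (auto simp: points_def)
      then have "z \<in> fst (\<psi> k)" using domI z C(1) by blast
      then show "z \<in> points (\<psi> ` C)" using k(1) by (auto simp: points_def)
    qed (use C(1) in \<open>auto simp: points_def\<close>)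
  qed
  ultimately show ?thesis using B by (simp add: smooth_manifold_def)
qed


section \<open>The product with a half-line and a line\<close>

lemma fst_ambient_chart: "fst (ambient_chart k) = {0<..} \<times> fst k \<times> UNIV"
  and snd_ambient_chart [simp]: "snd (ambient_chart k) (t, x, \<rho>) = (t, snd k x, \<rho>)"
  by (simp_all add: ambient_chart_def)

lemma image_ambient_chart:
  "snd (ambient_chart k) ` ({0<..} \<times> W \<times> UNIV) = {0<..} \<times> snd k ` W \<times> UNIV"
  by (force simp: ambient_chart_def)

context atlas
begin

lemma chart_inv_ambient_chart:
  assumes k: "k \<in> A" and "t > 0" "y \<in> snd k ` fst k"
  shows "chart_inv (ambient_chart k) (t, y, \<rho>) = (t, chart_inv k y, \<rho>)"
proof -
  have "inj_on (snd k) (fst k)" using atlas k by (simp add: smooth_atlas_def)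
  then have "inj_on (snd (ambient_chart k)) (fst (ambient_chart k))"
    by (auto simp: inj_on_def ambient_chart_def)
  from inv_into_f_f[OF this, of "(t, chart_inv k y, \<rho>)"] show ?thesis
    using assms by (simp add: fst_ambient_chart inv_into_into)
qed

lemma domain_Int_ambient_chart:
  "fst (ambient_chart k) \<inter> fst (ambient_chart k') = {0<..} \<times> (fst k \<inter> fst k') \<times> UNIV"
  by (auto simp: fst_ambient_chart)

lemma smooth_atlas_ambient: "smooth_atlas (ambient_atlas A)"
  unfolding smooth_atlas_def ambient_atlas_def
proof (intro conjI ballI; (elim imageE)?)
  fix K k assume k: "k \<in> A" and K: "K = ambient_chart k"
  have "inj_on (snd k) (fst k)" "open (snd k ` fst k)" using atlas k by (simp_all add: smooth_atlas_def)
  then show "inj_on (snd K) (fst K)" "open (snd K ` fst K)"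
    unfolding K fst_ambient_chart image_ambient_chart
    by (auto simp: inj_on_def intro!: open_Times)
  fix K' k' assume k': "k' \<in> A" and K': "K' = ambient_chart k'"
  let ?S = "snd k ` (fst k \<inter> fst k')"
  have S: "open ?S" by (rule open_image[OF k opn_domain[OF k']])
  then show op: "open (snd K ` (fst K \<inter> fst K'))"
    unfolding K K' domain_Int_ambient_chart image_ambient_chart by (intro open_Times) auto
  let ?T = "{0<..} \<times> ?S \<times> UNIV :: (real \<times> 'e \<times> real) set"
  have T: "snd K ` (fst K \<inter> fst K') = ?T"
    unfolding K K' domain_Int_ambient_chart image_ambient_chart ..
  have opT: "open ?T" using op T by simp
  have "smooth_on ?T (\<lambda>z. (snd k' \<circ> chart_inv k) (fst (snd z)))"
    by (rule smooth_on_compose[OF opT S smooth_on_bounded_linear[OF opT]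
          smooth_in_coordinates[OF k k', unfolded smooth_in_def]])
      (auto intro: bounded_linear_compose[OF bounded_linear_fst bounded_linear_snd])
  then have "smooth_on ?T (\<lambda>z. (fst z, (snd k' \<circ> chart_inv k) (fst (snd z)), snd (snd z)))"
    by (intro smooth_on_Pair[OF opT smooth_on_bounded_linear[OF opT bounded_linear_fst]]
        smooth_on_Pair[OF opT _ smooth_on_bounded_linear[OF opT
          bounded_linear_compose[OF bounded_linear_snd bounded_linear_snd]]])
  then show "smooth_on (snd K ` (fst K \<inter> fst K')) (snd K' \<circ> chart_inv K)"
    unfolding T
    by (rule smooth_on_transform[OF opT]) (use k in \<open>auto simp: K K' chart_inv_ambient_chart\<close>)
qed

lemma jac_ambient_chart:
  assumes k: "k \<in> A" "k' \<in> A" and x: "x \<in> fst k" "x \<in> fst k'" and t: "t > 0"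
  shows "jac (ambient_chart k) (ambient_chart k') (t, x, \<rho>) (a, u, r) = (a, jac k k' x u, r)"
proof -
  let ?S = "snd k ` (fst k \<inter> fst k')"
  let ?T = "{0<..} \<times> ?S \<times> UNIV :: (real \<times> 'e \<times> real) set"
  have T: "open ?T" by (intro open_Times open_image[OF k(1) opn_domain[OF k(2)]]) auto
  have z: "(t, snd k x, \<rho>) \<in> ?T" using x t by auto
  have "((snd k' \<circ> chart_inv k) has_derivative jac k k' x) (at (fst (snd (t, snd k x, \<rho>))))"
    using smooth_in_imp_has_derivative[OF k(1) opn_domain[OF k(2)] smooth_in_coordinates[OF k] x]
    by (simp add: jac_eq_chart_deriv[abs_def])
  then have "((\<lambda>z. (fst z, (snd k' \<circ> chart_inv k) (fst (snd z)), snd (snd z))) has_derivative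
      (\<lambda>v. (fst v, jac k k' x (fst (snd v)), snd (snd v)))) (at (t, snd k x, \<rho>))"
    by (rule has_derivative_Pair[OF has_derivative_fst[OF has_derivative_ident]
          has_derivative_Pair[OF has_derivative_compose[OF
              has_derivative_fst[OF has_derivative_snd[OF has_derivative_ident]]]
            has_derivative_snd[OF has_derivative_snd[OF has_derivative_ident]]]])
  then have "((snd (ambient_chart k') \<circ> chart_inv (ambient_chart k)) has_derivative
      (\<lambda>v. (fst v, jac k k' x (fst (snd v)), snd (snd v)))) (at (t, snd k x, \<rho>))"
    by (rule has_derivative_transform_within_open[OF _ T z])
      (use k in \<open>auto simp: chart_inv_ambient_chart\<close>)
  from frechet_derivative_at[OF this, symmetric] show ?thesis
    by (simp add: jac_def)
qed

end

lemma smooth_manifold_ambient: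
  assumes "smooth_manifold A" shows "smooth_manifold (ambient_atlas A)"
proof -
  interpret atlas A using assms by unfold_locales (simp add: smooth_manifold_def)
  show ?thesis
    unfolding ambient_atlas_def
  proof (rule smooth_manifold_total_space[OF assms, where \<pi> = "\<lambda>(t, x, \<rho>). x"])
    show "smooth_atlas (ambient_chart ` A)" using smooth_atlas_ambient by (simp add: ambient_atlas_def)
    fix k assume k: "k \<in> A"
    then show "fst (ambient_chart k) =
        {z \<in> points (ambient_chart ` A). (case z of (t, x, \<rho>) \<Rightarrow> x) \<in> fst k}"
      by (auto simp: points_def fst_ambient_chart)
    fix W assume W: "opn W"
    have "{z \<in> fst (ambient_chart k). (case z of (t, x, \<rho>) \<Rightarrow> x) \<in> W} = {0<..} \<times> (fst k \<inter> W) \<times> UNIV"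
      by (auto simp: fst_ambient_chart)
    then show "open (snd (ambient_chart k) ` {z \<in> fst (ambient_chart k). (case z of (t, x, \<rho>) \<Rightarrow> x) \<in> W})"
      using open_image[OF k W] by (simp add: image_ambient_chart open_Times)
  qed
qed


section \<open>The cotangent bundle\<close>

context atlas
begin

text \<open>The covector at \<open>x\<close> with components \<open>p\<close> in the chart \<open>k\<close>.\<close>

definition covector_of :: "('m, 'e) chart \<Rightarrow> 'm \<Rightarrow> 'e \<Rightarrow> ('m, 'e) covector" where
  "covector_of k x p =
     (\<lambda>k'. if k' \<in> A \<and> x \<in> fst k' then \<Sum>b\<in>Basis. (p \<bullet> jac k' k x b) *\<^sub>R b else 0)"

lemma inner_covector_of:
  assumes "k \<in> A" "k' \<in> A" "x \<in> fst k" "x \<in> fst k'"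
  shows "covector_of k x p k' \<bullet> v = p \<bullet> jac k' k x v"
  using assms linear_eq_sum_Basis[OF linear_jac[OF assms(2,1,4,3)], of v]
  by (simp add: covector_of_def inner_sum_left inner_sum_right inner_commute[of v] mult.commute)

lemma covector_of_mem:
  assumes "k \<in> A" "x \<in> fst k" shows "covector_of k x p \<in> cotangent_space A x"
  unfolding cotangent_space_def
proof (intro CollectI conjI ballI impI allI)
  fix k' k'' v assume "k' \<in> A" "k'' \<in> A" "x \<in> fst k' \<inter> fst k''"
  then show "covector_of k x p k'' \<bullet> jac k' k'' x v = covector_of k x p k' \<bullet> v"
    using assms by (simp add: inner_covector_of jac_compose)
qed (auto simp: covector_of_def)

lemma covector_of_own_chart:
  assumes "k \<in> A" "x \<in> fst k" shows "covector_of k x p k = p"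
  by (rule euclidean_eqI) (simp add: inner_covector_of assms)

lemma cotangent_space_jac:
  assumes "\<xi> \<in> cotangent_space A x" "k \<in> A" "k' \<in> A" "x \<in> fst k" "x \<in> fst k'"
  shows "\<xi> k' \<bullet> jac k k' x v = \<xi> k \<bullet> v"
  using assms unfolding cotangent_space_def by blast

lemma covector_of_components:
  assumes "k \<in> A" "x \<in> fst k" "\<xi> \<in> cotangent_space A x" shows "covector_of k x (\<xi> k) = \<xi>"
proof
  fix k'
  show "covector_of k x (\<xi> k) k' = \<xi> k'"
  proof (cases "k' \<in> A \<and> x \<in> fst k'")
    case True
    then have k': "k' \<in> A" "x \<in> fst k'" by auto
    show ?thesis
      by (rule euclidean_eqI) (simp only: inner_covector_of[OF assms(1) k'(1) assms(2) k'(2)]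
          cotangent_space_jac[OF assms(3) k'(1) assms(1) k'(2) assms(2)])
  next
    case False
    moreover have "\<xi> k' = 0" using assms(3) False unfolding cotangent_space_def by blast
    ultimately show ?thesis by (simp only: covector_of_def if_False)
  qed
qed

lemma fst_cotangent_chart: "(x, \<xi>) \<in> fst (cotangent_chart A k) \<longleftrightarrow> x \<in> fst k \<and> \<xi> \<in> cotangent_space A x"
  and snd_cotangent_chart [simp]: "snd (cotangent_chart A k) (x, \<xi>) = (snd k x, \<xi> k)"
  by (simp_all add: cotangent_chart_def)

lemma image_cotangent_chart:
  assumes "k \<in> A"
  shows "snd (cotangent_chart A k) ` {z \<in> fst (cotangent_chart A k). fst z \<in> W} =
    snd k ` (fst k \<inter> W) \<times> UNIV" (is "?L = ?R")
proof
  show "?L \<subseteq> ?R" by (auto simp: fst_cotangent_chart)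
  show "?R \<subseteq> ?L"
  proof
    fix z assume "z \<in> ?R"
    then obtain x p where x: "x \<in> fst k" "x \<in> W" "z = (snd k x, p)" by auto
    then have "z = snd (cotangent_chart A k) (x, covector_of k x p)"
      by (simp add: covector_of_own_chart[OF assms])
    moreover have "(x, covector_of k x p) \<in> {z \<in> fst (cotangent_chart A k). fst z \<in> W}"
      using x(1,2) by (simp add: fst_cotangent_chart covector_of_mem assms)
    ultimately show "z \<in> ?L" by (rule image_eqI)
  qed
qed

lemma image_cotangent_chart_UNIV:
  "k \<in> A \<Longrightarrow> snd (cotangent_chart A k) ` fst (cotangent_chart A k) = snd k ` fst k \<times> UNIV"
  using image_cotangent_chart[of k UNIV] by simp

lemma inj_on_cotangent_chart:
  assumes k: "k \<in> A"
  shows "inj_on (snd (cotangent_chart A k)) (fst (cotangent_chart A k))"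
proof (rule inj_onI)
  fix z w assume zw: "z \<in> fst (cotangent_chart A k)" "w \<in> fst (cotangent_chart A k)"
    and eq: "snd (cotangent_chart A k) z = snd (cotangent_chart A k) w"
  obtain x \<xi> y \<eta> where [simp]: "z = (x, \<xi>)" "w = (y, \<eta>)" by (cases z, cases w)
  have inj: "inj_on (snd k) (fst k)" using atlas k by (simp add: smooth_atlas_def)
  have "x = y" using zw eq inj by (auto simp: fst_cotangent_chart dest: inj_onD)
  have "\<xi> = covector_of k x (\<xi> k)"
    using zw(1) by (intro covector_of_components[OF k, symmetric]) (simp_all add: fst_cotangent_chart)
  also have "\<dots> = covector_of k y (\<eta> k)" using \<open>x = y\<close> eq by simp
  also have "\<dots> = \<eta>"
    using zw(2) by (intro covector_of_components[OF k]) (simp_all add: fst_cotangent_chart)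
  finally have "\<xi> = \<eta>" .
  with \<open>x = y\<close> show "z = w" by simp
qed

lemma chart_inv_cotangent_chart:
  assumes k: "k \<in> A" and y: "y \<in> snd k ` fst k"
  shows "chart_inv (cotangent_chart A k) (y, p) = (chart_inv k y, covector_of k (chart_inv k y) p)"
proof -
  have x: "chart_inv k y \<in> fst k" using y by (rule inv_into_into)
  show ?thesis
  proof (rule inv_into_f_eq[OF inj_on_cotangent_chart[OF k]])
    show "(chart_inv k y, covector_of k (chart_inv k y) p) \<in> fst (cotangent_chart A k)"
      using x covector_of_mem[OF k x] by (simp only: fst_cotangent_chart)
    show "snd (cotangent_chart A k) (chart_inv k y, covector_of k (chart_inv k y) p) = (y, p)"
      by (simp only: snd_cotangent_chart covector_of_own_chart[OF k x] field_chart_inv[OF y])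
  qed
qed

lemma domain_Int_cotangent_chart:
  "fst (cotangent_chart A k) \<inter> fst (cotangent_chart A k') =
    {z \<in> fst (cotangent_chart A k). fst z \<in> fst k'}"
  by (auto simp: cotangent_chart_def)

lemma smooth_atlas_cotangent: "smooth_atlas (cotangent_atlas A)"
  unfolding smooth_atlas_def cotangent_atlas_def
proof (intro conjI ballI; (elim imageE)?)
  fix K k assume k: "k \<in> A" and K: "K = cotangent_chart A k"
  show "inj_on (snd K) (fst K)" unfolding K by (rule inj_on_cotangent_chart[OF k])
  have "open (snd k ` fst k)" using atlas k by (simp add: smooth_atlas_def)
  then show "open (snd K ` fst K)"
    unfolding K image_cotangent_chart_UNIV[OF k] by (intro open_Times) auto
  fix K' k' assume k': "k' \<in> A" and K': "K' = cotangent_chart A k'"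
  let ?S = "snd k ` (fst k \<inter> fst k')"
  have S: "open ?S" by (rule open_image[OF k opn_domain[OF k']])
  let ?T = "?S \<times> UNIV :: ('e \<times> 'e) set"
  have T: "snd K ` (fst K \<inter> fst K') = ?T"
    unfolding K K' domain_Int_cotangent_chart image_cotangent_chart[OF k] ..
  have opT: "open ?T" using S by (intro open_Times) auto
  then show "open (snd K ` (fst K \<inter> fst K'))" using T by simp
  have fst: "smooth_on ?T fst" and snd: "smooth_on ?T snd"
    by (intro smooth_on_bounded_linear opT bounded_linear_fst bounded_linear_snd)+
  have base: "smooth_on ?T (\<lambda>z. (snd k' \<circ> chart_inv k) (fst z))"
    by (rule smooth_on_compose[OF opT S fst smooth_in_coordinates[OF k k', unfolded smooth_in_def]]) auto
  have "smooth_on ?S (\<lambda>y. jac k' k (chart_inv k y) b)" for b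
    using vector_field_smooth_in[OF vector_field_coord_field[OF k'] k, of b]
    by (simp add: smooth_in_def coord_field_def comp_def)
  from smooth_on_compose[OF opT S fst this]
  have "smooth_on ?T (\<lambda>z. jac k' k (chart_inv k (fst z)) b)" for b by auto
  then have "smooth_on ?T (\<lambda>z. \<Sum>b\<in>Basis. (snd z \<bullet> jac k' k (chart_inv k (fst z)) b) *\<^sub>R b)"
    by (intro smooth_on_sum smooth_on_scaleR smooth_on_inner snd opT smooth_on_const)
  from smooth_on_Pair[OF opT base this]
  show "smooth_on (snd K ` (fst K \<inter> fst K')) (snd K' \<circ> chart_inv K)"
    unfolding T
  proof (rule smooth_on_transform[OF opT])
    fix z assume "z \<in> ?T"
    then obtain x p where x: "x \<in> fst k" "x \<in> fst k'" and z: "z = (snd k x, p)" by auto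
    have "chart_inv K z = (x, covector_of k x p)"
      using chart_inv_cotangent_chart[OF k imageI[OF x(1)]] by (simp add: z K k x(1))
    then show "((snd k' \<circ> chart_inv k) (fst z),
        \<Sum>b\<in>Basis. (snd z \<bullet> jac k' k (chart_inv k (fst z)) b) *\<^sub>R b) = (snd K' \<circ> chart_inv K) z"
      by (simp add: K' covector_of_def k k' x z)
  qed
qed

text \<open>
  The fibre part of the derivative of a transition map is described by its pairings with all vectors.
  They result from differentiating the invariance of the pairing of covectors with vectors, and this is
  where the second derivatives of the transition map of the base come in.
\<close>

lemma jac_cotangent_chart:
  assumes k: "k \<in> A" "k' \<in> A" and x: "x \<in> fst k" "x \<in> fst k'" and \<xi>: "\<xi> \<in> cotangent_space A x"
  shows "fst (jac (cotangent_chart A k) (cotangent_chart A k') (x, \<xi>) v) = jac k k' x (fst v)"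
    and "snd (jac (cotangent_chart A k) (cotangent_chart A k') (x, \<xi>) v) \<bullet> jac k k' x w =
      snd v \<bullet> w - \<xi> k' \<bullet> chart_deriv k (\<lambda>y. jac k k' y w) x (fst v)"
proof -
  let ?K = "cotangent_chart A k" and ?K' = "cotangent_chart A k'" and ?y = "snd k x"
  let ?S = "snd k ` (fst k \<inter> fst k')" and ?\<Phi> = "snd ?K' \<circ> chart_inv ?K"
  let ?T = "?S \<times> UNIV :: ('e \<times> 'e) set"
  interpret cot: atlas "cotangent_atlas A" by unfold_locales (rule smooth_atlas_cotangent)
  have S: "open ?S" by (rule open_image[OF k(1) opn_domain[OF k(2)]])
  have T: "open ?T" using S by (intro open_Times) auto
  have z: "(?y, \<xi> k) \<in> ?T" using x by auto
  have K: "?K \<in> cotangent_atlas A" "?K' \<in> cotangent_atlas A"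
    using k by (auto simp: cotangent_atlas_def)
  have d: "(?\<Phi> has_derivative jac ?K ?K' (x, \<xi>)) (at (?y, \<xi> k))"
    using cot.smooth_in_imp_has_derivative[OF K(1) cot.opn_domain[OF K(2)] cot.smooth_in_coordinates[OF K],
        of "(x, \<xi>)"] x \<xi>
    by (simp add: cot.jac_eq_chart_deriv[abs_def] fst_cotangent_chart)
  have \<Phi>: "snd ?K' (chart_inv ?K (snd k a, p)) = (snd k' a, covector_of k a p k')"
    if "a \<in> fst k" "a \<in> fst k'" for a p
    using chart_inv_cotangent_chart[OF k(1) imageI[OF that(1)]] by (simp add: k(1) that)
  have "((\<lambda>z. (snd k' \<circ> chart_inv k) (fst z)) has_derivative (\<lambda>v. jac k k' x (fst v))) (at (?y, \<xi> k))"
  proof (rule has_derivative_compose[OF has_derivative_fst[OF has_derivative_ident]])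
    show "((snd k' \<circ> chart_inv k) has_derivative jac k k' x) (at (fst (?y, \<xi> k)))"
      using smooth_in_imp_has_derivative[OF k(1) opn_domain[OF k(2)] smooth_in_coordinates[OF k] x]
      by (simp add: jac_eq_chart_deriv[abs_def])
  qed
  then have "((\<lambda>z. fst (?\<Phi> z)) has_derivative (\<lambda>v. jac k k' x (fst v))) (at (?y, \<xi> k))"
    by (rule has_derivative_transform_within_open[OF _ T z]) (use k(1) in \<open>auto simp: \<Phi>\<close>)
  from has_derivative_unique[OF has_derivative_fst[OF d] this]
  show "fst (jac ?K ?K' (x, \<xi>) v) = jac k k' x (fst v)" by (rule fun_cong)
  have J: "((\<lambda>y. jac k k' (chart_inv k y) w) has_derivative
      chart_deriv k (\<lambda>y. jac k k' y w) x) (at (fst (?y, \<xi> k)))"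
    using smooth_in_imp_has_derivative[OF k(1) opn_domain[OF k(2)] smooth_in_jac[OF k] x]
    by (simp add: comp_def)
  have "((\<lambda>z. snd (?\<Phi> z) \<bullet> jac k k' (chart_inv k (fst z)) w) has_derivative
      (\<lambda>v. snd (?\<Phi> (?y, \<xi> k)) \<bullet> chart_deriv k (\<lambda>y. jac k k' y w) x (fst v)
        + snd (jac ?K ?K' (x, \<xi>) v) \<bullet> jac k k' (chart_inv k (fst (?y, \<xi> k))) w)) (at (?y, \<xi> k))"
    by (rule has_derivative_inner[OF has_derivative_snd[OF d]
          has_derivative_compose[OF has_derivative_fst[OF has_derivative_ident] J]])
  moreover have "((\<lambda>z. snd z \<bullet> w) has_derivative (\<lambda>v. snd v \<bullet> w)) (at (?y, \<xi> k))"
    by (intro has_derivative_inner_left has_derivative_snd has_derivative_ident)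
  then have "((\<lambda>z. snd (?\<Phi> z) \<bullet> jac k k' (chart_inv k (fst z)) w) has_derivative (\<lambda>v. snd v \<bullet> w))
      (at (?y, \<xi> k))"
    by (rule has_derivative_transform_within_open[OF _ T z])
      (use k in \<open>auto simp: \<Phi> inner_covector_of jac_inverse\<close>)
  ultimately have "snd (?\<Phi> (?y, \<xi> k)) \<bullet> chart_deriv k (\<lambda>y. jac k k' y w) x (fst v)
        + snd (jac ?K ?K' (x, \<xi>) v) \<bullet> jac k k' (chart_inv k (fst (?y, \<xi> k))) w = snd v \<bullet> w"
    by (rule fun_cong[OF has_derivative_unique])
  moreover have "snd (?\<Phi> (?y, \<xi> k)) = \<xi> k'"
    using x k(1) by (simp add: \<Phi> covector_of_components[OF k(1) x(1) \<xi>])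
  ultimately show "snd (jac ?K ?K' (x, \<xi>) v) \<bullet> jac k k' x w =
      snd v \<bullet> w - \<xi> k' \<bullet> chart_deriv k (\<lambda>y. jac k k' y w) x (fst v)"
    using x(1) k(1) by simp
qed

end

lemma smooth_manifold_cotangent:
  assumes "smooth_manifold A" shows "smooth_manifold (cotangent_atlas A)"
proof -
  interpret atlas A using assms by unfold_locales (simp add: smooth_manifold_def)
  show ?thesis
    unfolding cotangent_atlas_def
  proof (rule smooth_manifold_total_space[OF assms, where \<pi> = fst])
    show "smooth_atlas (cotangent_chart A ` A)"
      using smooth_atlas_cotangent by (simp add: cotangent_atlas_def)
    fix k assume k: "k \<in> A"
    then show "fst (cotangent_chart A k) = {z \<in> points (cotangent_chart A ` A). fst z \<in> fst k}"
      by (auto simp: points_def cotangent_chart_def)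
    fix W assume "opn W"
    then show "open (snd (cotangent_chart A k) ` {z \<in> fst (cotangent_chart A k). fst z \<in> W})"
      unfolding image_cotangent_chart[OF k] by (intro open_Times open_image[OF k]) auto
  qed
qed

section \<open>Split signature\<close>

text \<open>
  Neutral signature is most easily recognised from a hyperbolic basis, two complementary isotropic
  families in duality; \<open>E i \<plusminus> F i / 2\<close> is then an orthonormal basis.
\<close>

definition hyperbolic_basis ::
  "('e::euclidean_space \<Rightarrow> 'e \<Rightarrow> real) \<Rightarrow> 'i set \<Rightarrow> ('i \<Rightarrow> 'e) \<Rightarrow> ('i \<Rightarrow> 'e) \<Rightarrow> bool" where
  "hyperbolic_basis \<beta> I E F \<longleftrightarrow>
     (\<forall>i\<in>I. \<forall>j\<in>I. \<beta> (E i) (E j) = 0 \<and> \<beta> (F i) (F j) = 0 \<and> \<beta> (E i) (F j) = (if i = j then 1 else 0))"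

lemma has_signature_hyperbolic_basis:
  fixes \<beta> :: "'e::euclidean_space \<Rightarrow> 'e \<Rightarrow> real"
  assumes bil: "bilinear \<beta>" and sym: "\<And>u v. \<beta> u v = \<beta> v u"
    and hyp: "hyperbolic_basis \<beta> I E F" and I: "finite I" and dim: "DIM('e) = 2 * card I"
  shows "has_signature \<beta> (card I) (card I)"
proof -
  define P where "P i = E i + (1/2) *\<^sub>R F i" for i
  define Q where "Q i = E i + (-1/2) *\<^sub>R F i" for i
  note b = bilinear_ladd[OF bil] bilinear_radd[OF bil] bilinear_lmul[OF bil] bilinear_rmul[OF bil]
    bilinear_lsub[OF bil] bilinear_rsub[OF bil]
  have EF: "\<beta> (E i) (E j) = 0" "\<beta> (F i) (F j) = 0" "\<beta> (E i) (F j) = (if i = j then 1 else 0)"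
    "\<beta> (F i) (E j) = (if i = j then 1 else 0)" if "i \<in> I" "j \<in> I" for i j
    using hyp that sym[of "F i" "E j"] by (auto simp: hyperbolic_basis_def)
  have PP: "\<beta> (P i) (P j) = (if i = j then 1 else 0)"
    and QQ: "\<beta> (Q i) (Q j) = (if i = j then -1 else 0)"
    and PQ: "\<beta> (P i) (Q j) = 0" and QP: "\<beta> (Q i) (P j) = 0" if "i \<in> I" "j \<in> I" for i j
    using EF[OF that] by (simp_all add: P_def Q_def b)
  have inj: "inj_on P I" "inj_on Q I"
    using PP QQ by (auto simp: inj_on_def) (metis zero_neq_one, metis zero_neq_neg_one)
  have disj: "P ` I \<inter> Q ` I = {}"
    using PP PQ by (auto) (metis zero_neq_one)
  let ?B = "P ` I \<union> Q ` I"
  have orth: "\<beta> u v = 0" if "u \<in> ?B" "v \<in> ?B" "u \<noteq> v" for u v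
    using that PP QQ PQ QP by auto
  have norm: "\<beta> u u \<noteq> 0" if "u \<in> ?B" for u using that PP QQ by auto
  have ind: "independent ?B"
  proof (rule independent_if_scalars_zero)
    show "finite ?B" using I by simp
    fix f u assume sum: "(\<Sum>v\<in>?B. f v *\<^sub>R v) = 0" and u: "u \<in> ?B"
    have "0 = \<beta> (\<Sum>v\<in>?B. f v *\<^sub>R v) u" using sum bilinear_lzero[OF bil] by simp
    also have "\<dots> = (\<Sum>v\<in>?B. f v * \<beta> v u)"
      using bil by (simp add: linear_sum[of "\<lambda>v. \<beta> v u"] linear_scale[of "\<lambda>v. \<beta> v u"] bilinear_def)
    also have "\<dots> = (\<Sum>v\<in>?B. if v = u then f u * \<beta> u u else 0)"
      using orth u by (intro sum.cong) auto
    also have "\<dots> = f u * \<beta> u u" using u I by simp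
    finally show "f u = 0" using norm[OF u] by simp
  qed
  have "card ?B = DIM('e)"
    using dim I inj disj by (simp add: card_Un_disjoint card_image)
  then have "span ?B = UNIV"
    using card_ge_dim_independent[of ?B UNIV] ind by auto
  moreover have "card (P ` I) = card I" "card (Q ` I) = card I" using inj by (simp_all add: card_image)
  ultimately show ?thesis
    unfolding has_signature_def using disj ind orth PP QQ
    by (intro exI[of _ "P ` I"] exI[of _ "Q ` I"]) auto
qed

lemma inner_sum_Basis_functional:
  fixes f :: "'e::euclidean_space \<Rightarrow> real"
  assumes "linear f" shows "v \<bullet> (\<Sum>b\<in>Basis. f b *\<^sub>R b) = f v"
  by (subst (2) linear_eq_sum_Basis[OF assms]) (simp add: inner_sum_right mult.commute)

text \<open>
  The metrics of interest are built in two steps: a Walker metric on a cotangent space, whose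
  horizontal part \<open>k\<close> is arbitrary, and the cone-like extension by the coordinates \<open>t\<close>, \<open>\<rho>\<close>.
\<close>

definition walker_form ::
  "('e \<Rightarrow> 'e \<Rightarrow> real) \<Rightarrow> 'e::euclidean_space \<times> 'e \<Rightarrow> 'e \<times> 'e \<Rightarrow> real" where
  "walker_form k = (\<lambda>(u, \<pi>) (v, \<sigma>). u \<bullet> \<sigma> + v \<bullet> \<pi> + k u v)"

definition cone_form ::
  "('w \<Rightarrow> 'w \<Rightarrow> real) \<Rightarrow> real \<Rightarrow> real \<Rightarrow> real \<times> 'w \<times> real \<Rightarrow> real \<times> 'w \<times> real \<Rightarrow> real" where
  "cone_form \<beta> t \<rho> = (\<lambda>(a, w, r) (b, z, s). 2 * \<rho> * a * b + t * (a * s + b * r) + t\<^sup>2 * \<beta> w z)"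

lemma bilinear_walker_form:
  assumes "bilinear k" shows "bilinear (walker_form k)"
  unfolding bilinear_def linear_iff walker_form_def
  by (auto simp: algebra_simps inner_add_left inner_add_right bilinear_ladd[OF assms] bilinear_radd[OF assms]
      bilinear_lmul[OF assms] bilinear_rmul[OF assms])

lemma bilinear_cone_form:
  fixes \<beta> :: "'w::real_vector \<Rightarrow> 'w \<Rightarrow> real"
  assumes "bilinear \<beta>" shows "bilinear (cone_form \<beta> t \<rho>)"
  unfolding bilinear_def linear_iff cone_form_def
  by (auto simp: algebra_simps bilinear_ladd[OF assms] bilinear_radd[OF assms]
      bilinear_lmul[OF assms] bilinear_rmul[OF assms])

lemma walker_form_symmetric: "(\<And>u v. k u v = k v u) \<Longrightarrow> walker_form k w z = walker_form k z w"
  by (cases w, cases z) (simp add: walker_form_def)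

lemma cone_form_symmetric: "(\<And>u v. \<beta> u v = \<beta> v u) \<Longrightarrow> cone_form \<beta> t \<rho> w z = cone_form \<beta> t \<rho> z w"
  by (cases w, cases z) (simp add: cone_form_def mult.commute)

text \<open>Subtracting half of \<open>k\<close> makes the horizontal vectors isotropic.\<close>

lemma hyperbolic_basis_walker_form:
  fixes k :: "'e::euclidean_space \<Rightarrow> 'e \<Rightarrow> real"
  assumes bil: "bilinear k" and sym: "\<And>u v. k u v = k v u"
  shows "hyperbolic_basis (walker_form k) Basis
    (\<lambda>b. (b, (-1/2) *\<^sub>R (\<Sum>c\<in>Basis. k b c *\<^sub>R c))) (\<lambda>b. (0, b))"
  unfolding hyperbolic_basis_def walker_form_def
proof (intro ballI)
  fix i j :: 'e assume "i \<in> Basis" "j \<in> Basis"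
  moreover have "linear (k i)" "linear (k j)" using bil by (simp_all add: bilinear_def)
  ultimately show "(case (i, (-1/2) *\<^sub>R (\<Sum>c\<in>Basis. k i c *\<^sub>R c)) of (u, \<pi>) \<Rightarrow>
        \<lambda>(v, \<sigma>). u \<bullet> \<sigma> + v \<bullet> \<pi> + k u v) (j, (-1/2) *\<^sub>R (\<Sum>c\<in>Basis. k j c *\<^sub>R c)) = 0 \<and>
      (case (0, i) of (u, \<pi>) \<Rightarrow> \<lambda>(v, \<sigma>). u \<bullet> \<sigma> + v \<bullet> \<pi> + k u v) (0, j) = 0 \<and>
      (case (i, (-1/2) *\<^sub>R (\<Sum>c\<in>Basis. k i c *\<^sub>R c)) of (u, \<pi>) \<Rightarrow>
        \<lambda>(v, \<sigma>). u \<bullet> \<sigma> + v \<bullet> \<pi> + k u v) (0, j) = (if i = j then 1 else 0)"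
    using sym[of i j] bilinear_lzero[OF bil] bilinear_rzero[OF bil]
    by (simp add: inner_Basis inner_sum_Basis_functional)
qed

lemma hyperbolic_basis_cone_form:
  fixes \<beta> :: "'w::euclidean_space \<Rightarrow> 'w \<Rightarrow> real"
  assumes bil: "bilinear \<beta>" and hyp: "hyperbolic_basis \<beta> I E F" and t: "t > 0"
  shows "hyperbolic_basis (cone_form \<beta> t \<rho>) (insert None (Some ` I))
    (\<lambda>i. case i of None \<Rightarrow> (1, 0, - \<rho> / t) | Some i \<Rightarrow> (0, (1/t) *\<^sub>R E i, 0))
    (\<lambda>i. case i of None \<Rightarrow> (0, 0, 1 / t) | Some i \<Rightarrow> (0, (1/t) *\<^sub>R F i, 0))"
  unfolding hyperbolic_basis_def cone_form_def
  using hyp t bilinear_lzero[OF bil] bilinear_rzero[OF bil]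
  by (auto simp: hyperbolic_basis_def bilinear_lmul[OF bil] bilinear_rmul[OF bil] power2_eq_square)

lemma has_signature_walker_form:
  fixes k :: "'e::euclidean_space \<Rightarrow> 'e \<Rightarrow> real"
  assumes "bilinear k" "\<And>u v. k u v = k v u"
  shows "has_signature (walker_form k) DIM('e) DIM('e)"
  by (rule has_signature_hyperbolic_basis[OF bilinear_walker_form walker_form_symmetric
        hyperbolic_basis_walker_form]) (use assms in auto)

lemma has_signature_cone_walker_form:
  fixes k :: "'e::euclidean_space \<Rightarrow> 'e \<Rightarrow> real"
  assumes "bilinear k" "\<And>u v. k u v = k v u" "t > 0"
  shows "has_signature (cone_form (walker_form k) t \<rho>) (DIM('e) + 1) (DIM('e) + 1)"
proof -
  have "card (insert None (Some ` (Basis :: 'e set))) = DIM('e) + 1"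
    by (simp add: card_insert_if card_image)
  moreover have "has_signature (cone_form (walker_form k) t \<rho>)
      (card (insert None (Some ` (Basis :: 'e set)))) (card (insert None (Some ` (Basis :: 'e set))))"
    by (rule has_signature_hyperbolic_basis[OF bilinear_cone_form cone_form_symmetric
          hyperbolic_basis_cone_form[OF _ hyperbolic_basis_walker_form]])
      (use assms in \<open>auto intro: bilinear_walker_form walker_form_symmetric simp: card_insert_if card_image\<close>)
  ultimately show ?thesis by simp
qed


section \<open>The ambient metric in canonical coordinates\<close>

lemma frechet_derivative_along_line:
  fixes f :: "'a::real_normed_vector \<Rightarrow> real"
  assumes "f differentiable at z" "((\<lambda>h. f (z + h *\<^sub>R b)) has_real_derivative d) (at 0)"
  shows "frechet_derivative f (at z) b = d"
proof -
  have "(f has_derivative frechet_derivative f (at z)) (at (z + 0 *\<^sub>R b))"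
    using assms(1) by (simp add: frechet_derivative_works)
  from DERIV_unique[OF line_has_real_derivative[OF this] assms(2)] show ?thesis .
qed

lemma sum_Basis_prod:
  fixes f :: "'a::euclidean_space \<times> 'b::euclidean_space \<Rightarrow> 'c::comm_monoid_add"
  shows "sum f Basis = (\<Sum>i\<in>Basis. f (i, 0)) + (\<Sum>i\<in>Basis. f (0, i))"
proof -
  have "inj_on (\<lambda>u. (u::'a, 0::'b)) Basis" "inj_on (\<lambda>u. (0::'a, u::'b)) Basis"
    by (auto intro!: inj_onI)
  then show ?thesis
    unfolding Basis_prod_def by (subst sum.union_disjoint) (auto simp: sum.reindex)
qed

lemma sum_Basis_cone:
  fixes f :: "real \<times> ('e::euclidean_space \<times> 'e) \<times> real \<Rightarrow> real"
  shows "sum f Basis =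
    f (1, 0, 0) + (\<Sum>e\<in>Basis. f (0, (e, 0), 0)) + (\<Sum>e\<in>Basis. f (0, (0, e), 0)) + f (0, 0, 1)"
  by (simp add: sum_Basis_prod zero_prod_def add.assoc)

text \<open>
  \<open>G\<close> and \<open>S\<close> stand for the Christoffel symbols of a connection and for \<open>2/(n-1)\<close> times its symmetrised
  Ricci curvature in a chart with image \<open>U\<close>; for the computation they are arbitrary smooth families of
  symmetric bilinear maps. A point has the coordinates \<open>(t, (y, p), \<rho>)\<close>.
\<close>

locale walker_chart =
  fixes U :: "'e::euclidean_space set" and G :: "'e \<Rightarrow> 'e \<Rightarrow> 'e \<Rightarrow> 'e" and S :: "'e \<Rightarrow> 'e \<Rightarrow> 'e \<Rightarrow> real"
  assumes open_U: "open U"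
    and bil_G: "\<And>y. y \<in> U \<Longrightarrow> bilinear (G y)" and bil_S: "\<And>y. y \<in> U \<Longrightarrow> bilinear (S y)"
    and sym_G: "\<And>y u v. y \<in> U \<Longrightarrow> G y u v = G y v u" and sym_S: "\<And>y u v. y \<in> U \<Longrightarrow> S y u v = S y v u"
    and smooth_G: "\<And>u v. smooth_on U (\<lambda>y. G y u v)" and smooth_S: "\<And>u v. smooth_on U (\<lambda>y. S y u v)"
begin

definition horizontal :: "'e \<Rightarrow> 'e \<Rightarrow> real \<Rightarrow> 'e \<Rightarrow> 'e \<Rightarrow> real" where
  "horizontal y p \<rho> u v = \<rho> * S y u v - 2 * (p \<bullet> G y u v)"

definition ambient :: "real \<times> ('e \<times> 'e) \<times> real \<Rightarrow>
    real \<times> ('e \<times> 'e) \<times> real \<Rightarrow> real \<times> ('e \<times> 'e) \<times> real \<Rightarrow> real" where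
  "ambient z = cone_form (walker_form (horizontal (fst (fst (snd z))) (snd (fst (snd z))) (snd (snd z))))
     (fst z) (snd (snd z))"

definition dG :: "'e \<Rightarrow> 'e \<Rightarrow> 'e \<Rightarrow> 'e \<Rightarrow> 'e" where
  "dG y w u v = frechet_derivative (\<lambda>y. G y u v) (at y) w"

definition dS :: "'e \<Rightarrow> 'e \<Rightarrow> 'e \<Rightarrow> 'e \<Rightarrow> real" where
  "dS y w u v = frechet_derivative (\<lambda>y. S y u v) (at y) w"

text \<open>
  The Christoffel symbols of the ambient metric. As the inverse metric pairs \<open>y\<close> with \<open>p\<close>, the
  \<open>y\<close>-component is half the negative derivative of the horizontal form in the direction of \<open>p\<close>, hence
  \<open>G\<close>. The \<open>p\<close>-component is a covector, whose value on \<open>e\<close> is \<open>cov\<close> up to terms with \<open>1/t\<close>: the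
  symbols of the first kind of the horizontal form, diminished by its value on \<open>G u v\<close> and \<open>e\<close> because of the \<open>pp\<close>-part
  of the inverse metric. The terms with \<open>1/t\<close> are those of a cone.
\<close>

definition cov :: "'e \<Rightarrow> 'e \<Rightarrow> real \<Rightarrow> 'e \<times> 'e \<times> real \<Rightarrow> 'e \<times> 'e \<times> real \<Rightarrow> 'e \<Rightarrow> real" where
  "cov y p \<rho> = (\<lambda>(u, \<pi>, r) (v, \<sigma>, s) e.
     - (\<pi> \<bullet> G y v e) - \<sigma> \<bullet> G y u e - p \<bullet> (dG y u v e + dG y v u e - dG y e u v)
     + \<rho> / 2 * (dS y u v e + dS y v u e - dS y e u v)
     + 2 * (p \<bullet> G y (G y u v) e) - \<rho> * S y (G y u v) e + (r * S y v e + s * S y u e) / 2)"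

definition chr :: "real \<times> ('e \<times> 'e) \<times> real \<Rightarrow>
    real \<times> ('e \<times> 'e) \<times> real \<Rightarrow> real \<times> ('e \<times> 'e) \<times> real \<Rightarrow> real \<times> ('e \<times> 'e) \<times> real" where
  "chr = (\<lambda>(t, (y, p), \<rho>) (a, (u, \<pi>), r) (b, (v, \<sigma>), s).
     (- (t / 2) * S y u v,
      ((a / t) *\<^sub>R v + (b / t) *\<^sub>R u + G y u v,
       (a / t) *\<^sub>R \<sigma> + (b / t) *\<^sub>R \<pi> + (\<Sum>e\<in>Basis. cov y p \<rho> (u, \<pi>, r) (v, \<sigma>, s) e *\<^sub>R e)),
      (a * s + b * r) / t - u \<bullet> \<sigma> - v \<bullet> \<pi> + 2 * (p \<bullet> G y u v)))"

definition dom :: "(real \<times> ('e \<times> 'e) \<times> real) set" where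
  "dom = {0<..} \<times> (U \<times> UNIV) \<times> UNIV"

lemma open_dom: "open dom"
  unfolding dom_def by (intro open_Times open_U) auto

lemma differentiable_G: "y \<in> U \<Longrightarrow> (\<lambda>y. G y u v) differentiable at y"
  and differentiable_S: "y \<in> U \<Longrightarrow> (\<lambda>y. S y u v) differentiable at y"
  using smooth_on_imp_differentiable[OF open_U] smooth_G smooth_S by blast+

lemma has_derivative_G: "y \<in> U \<Longrightarrow> ((\<lambda>y. G y u v) has_derivative (\<lambda>w. dG y w u v)) (at y)"
  and has_derivative_S: "y \<in> U \<Longrightarrow> ((\<lambda>y. S y u v) has_derivative (\<lambda>w. dS y w u v)) (at y)"
  using differentiable_G differentiable_S by (simp_all add: dG_def dS_def frechet_derivative_works)

lemma sym_dG: "y \<in> U \<Longrightarrow> dG y w u v = dG y w v u"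
  unfolding dG_def by (rule fun_cong[OF frechet_derivative_cong[OF open_U]]) (auto intro: sym_G)

lemma sym_dS: "y \<in> U \<Longrightarrow> dS y w u v = dS y w v u"
  unfolding dS_def by (rule fun_cong[OF frechet_derivative_cong[OF open_U]]) (auto intro: sym_S)

lemma linear_dG:
  assumes y: "y \<in> U"
  shows "linear (\<lambda>w. dG y w u v)" "linear (\<lambda>u. dG y w u v)" "linear (\<lambda>v. dG y w u v)"
proof -
  show "linear (\<lambda>w. dG y w u v)" by (rule has_derivative_linear[OF has_derivative_G[OF y]])
  show "linear (\<lambda>u. dG y w u v)" for v
    unfolding dG_def by (rule linear_derivative_of_linear_family[OF open_U y _ differentiable_G[OF y]])
      (use bil_G in \<open>simp add: bilinear_def\<close>)
  then show "linear (\<lambda>v. dG y w u v)" by (simp add: sym_dG[OF y, of w u])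
qed

lemma linear_dS:
  assumes y: "y \<in> U"
  shows "linear (\<lambda>w. dS y w u v)" "linear (\<lambda>u. dS y w u v)" "linear (\<lambda>v. dS y w u v)"
proof -
  show "linear (\<lambda>w. dS y w u v)" by (rule has_derivative_linear[OF has_derivative_S[OF y]])
  show "linear (\<lambda>u. dS y w u v)" for v
    unfolding dS_def by (rule linear_derivative_of_linear_family[OF open_U y _ differentiable_S[OF y]])
      (use bil_S in \<open>simp add: bilinear_def\<close>)
  then show "linear (\<lambda>v. dS y w u v)" by (simp add: sym_dS[OF y, of w u])
qed

lemmas add_simps = bilinear_ladd[OF bil_G] bilinear_radd[OF bil_G] bilinear_ladd[OF bil_S]
  bilinear_radd[OF bil_S] linear_add[OF linear_dG(1)] linear_add[OF linear_dG(2)]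
  linear_add[OF linear_dG(3)] linear_add[OF linear_dS(1)] linear_add[OF linear_dS(2)]
  linear_add[OF linear_dS(3)] inner_add_left inner_add_right inner_diff_left inner_diff_right

lemmas scale_simps = bilinear_lmul[OF bil_G] bilinear_rmul[OF bil_G] bilinear_lmul[OF bil_S]
  bilinear_rmul[OF bil_S] linear_scale[OF linear_dG(1)] linear_scale[OF linear_dG(2)]
  linear_scale[OF linear_dG(3)] linear_scale[OF linear_dS(1)] linear_scale[OF linear_dS(2)]
  linear_scale[OF linear_dS(3)]

lemmas zero_simps = bilinear_lzero[OF bil_G] bilinear_rzero[OF bil_G] bilinear_lzero[OF bil_S]
  bilinear_rzero[OF bil_S] linear_0[OF linear_dG(1)] linear_0[OF linear_dG(2)]
  linear_0[OF linear_dG(3)] linear_0[OF linear_dS(1)] linear_0[OF linear_dS(2)]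
  linear_0[OF linear_dS(3)]

lemma bilinear_horizontal: "y \<in> U \<Longrightarrow> bilinear (horizontal y p \<rho>)"
  unfolding bilinear_def linear_iff horizontal_def
  by (auto simp: add_simps scale_simps algebra_simps)

lemma symmetric_horizontal: "y \<in> U \<Longrightarrow> horizontal y p \<rho> u v = horizontal y p \<rho> v u"
  using sym_G[of y u v] sym_S[of y u v] by (simp add: horizontal_def)

lemma linear_cov: "y \<in> U \<Longrightarrow> linear (cov y p \<rho> V W)"
  by (cases V; cases W)
    (auto simp: linear_iff cov_def add_simps scale_simps algebra_simps add_divide_distrib)

lemma cov_symmetric: "y \<in> U \<Longrightarrow> cov y p \<rho> V W e = cov y p \<rho> W V e"
proof -
  assume y: "y \<in> U"
  obtain u \<pi> r v \<sigma> s where "V = (u, \<pi>, r)" "W = (v, \<sigma>, s)" by (cases V, cases W)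
  then show ?thesis
    using sym_G[OF y, of u v] sym_dG[OF y, of e u v] sym_dS[OF y, of e u v]
    by (simp add: cov_def algebra_simps)
qed

lemma cov_add: "y \<in> U \<Longrightarrow> cov y p \<rho> (u + u', \<pi> + \<pi>', r + r') W e =
    cov y p \<rho> (u, \<pi>, r) W e + cov y p \<rho> (u', \<pi>', r') W e"
  by (cases W) (simp add: cov_def add_simps algebra_simps add_divide_distrib)

lemma cov_scaleR: "y \<in> U \<Longrightarrow> cov y p \<rho> (c *\<^sub>R u, c *\<^sub>R \<pi>, c * r) W e = c * cov y p \<rho> (u, \<pi>, r) W e"
  by (cases W) (simp add: cov_def scale_simps algebra_simps add_divide_distrib)

lemma chr_symmetric: "z \<in> dom \<Longrightarrow> chr z V W = chr z W V"
proof -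
  assume z: "z \<in> dom"
  obtain t y p \<rho> where [simp]: "z = (t, (y, p), \<rho>)" and y: "y \<in> U" using z by (auto simp: dom_def)
  obtain a u \<pi> r where [simp]: "V = (a, (u, \<pi>), r)" by (cases V) auto
  obtain b v \<sigma> s where [simp]: "W = (b, (v, \<sigma>), s)" by (cases W) auto
  show ?thesis
    using sym_G[OF y, of u v] sym_S[OF y, of u v]
    by (simp add: chr_def cov_symmetric[OF y, of p \<rho> "(u, \<pi>, r)"] algebra_simps)
qed

lemma bilinear_chr: "z \<in> dom \<Longrightarrow> bilinear (chr z)"
proof -
  assume z: "z \<in> dom"
  obtain t y p \<rho> where [simp]: "z = (t, (y, p), \<rho>)" and y: "y \<in> U" using z by (auto simp: dom_def)
  have "linear (\<lambda>V. chr z V W)" for W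
  proof -
    obtain b v \<sigma> s where [simp]: "W = (b, (v, \<sigma>), s)" by (cases W) auto
    show ?thesis
      unfolding linear_iff chr_def
      using y by (auto simp: cov_add cov_scaleR add_simps scale_simps algebra_simps
          add_divide_distrib scaleR_add_left sum.distrib scaleR_sum_right)
  qed
  then show ?thesis
    using chr_symmetric[OF z] by (simp add: bilinear_def)
qed

lemma smooth_on_dom:
  "smooth_on dom (\<lambda>z. fst z)" "smooth_on dom (\<lambda>z. snd (fst (snd z)))" "smooth_on dom (\<lambda>z. snd (snd z))"
  by (intro smooth_on_bounded_linear open_dom bounded_linear_intros)+

lemma smooth_on_dom_base:
  assumes "smooth_on U f" shows "smooth_on dom (\<lambda>z. f (fst (fst (snd z))))"
  by (rule smooth_on_compose[OF open_dom open_U smooth_on_bounded_linear[OF open_dom] assms])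
    (auto simp: dom_def intro: bounded_linear_compose[OF bounded_linear_fst
        bounded_linear_compose[OF bounded_linear_fst bounded_linear_snd]])

lemma smooth_dG: "smooth_on U (\<lambda>y. dG y w u v)" and smooth_dS: "smooth_on U (\<lambda>y. dS y w u v)"
  unfolding dG_def dS_def by (intro smooth_on_derivative smooth_G smooth_S)+

lemma smooth_GG: "smooth_on U (\<lambda>y. G y (G y u v) e)" and smooth_SG: "smooth_on U (\<lambda>y. S y (G y u v) e)"
proof -
  have s: "smooth_on U (\<lambda>y. \<Sum>b\<in>Basis. (G y u v \<bullet> b) *\<^sub>R G y b e)"
    "smooth_on U (\<lambda>y. \<Sum>b\<in>Basis. (G y u v \<bullet> b) *\<^sub>R S y b e)"
    by (intro smooth_on_sum smooth_on_scaleR smooth_on_inner smooth_G smooth_S smooth_on_const open_U)+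
  have lin: "linear (\<lambda>w. G y w e)" "linear (\<lambda>w. S y w e)" if "y \<in> U" for y
    using bil_G[OF that] bil_S[OF that] by (simp_all add: bilinear_def)
  show "smooth_on U (\<lambda>y. G y (G y u v) e)"
    by (rule smooth_on_transform[OF open_U s(1) linear_eq_sum_Basis[OF lin(1), symmetric]])
  show "smooth_on U (\<lambda>y. S y (G y u v) e)"
    by (rule smooth_on_transform[OF open_U s(2) linear_eq_sum_Basis[OF lin(2), symmetric]])
qed

lemma smooth_cov:
  "smooth_on dom (\<lambda>z. cov (fst (fst (snd z))) (snd (fst (snd z))) (snd (snd z)) V W e)"
proof -
  obtain u \<pi> r v \<sigma> s where VW: "V = (u, \<pi>, r)" "W = (v, \<sigma>, s)" by (cases V, cases W)
  show ?thesis
    unfolding cov_def VW prod.case divide_inverse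
    by (intro smooth_on_add smooth_on_diff smooth_on_uminus smooth_on_mult smooth_on_inner smooth_on_const
        smooth_on_dom smooth_on_dom_base[OF smooth_G] smooth_on_dom_base[OF smooth_S]
        smooth_on_dom_base[OF smooth_dG] smooth_on_dom_base[OF smooth_dS]
        smooth_on_dom_base[OF smooth_GG] smooth_on_dom_base[OF smooth_SG] open_dom)
qed

lemma smooth_chr: "smooth_on dom (\<lambda>z. chr z V W)"
proof -
  obtain a u \<pi> r where V: "V = (a, (u, \<pi>), r)" by (cases V) auto
  obtain b v \<sigma> s where W: "W = (b, (v, \<sigma>), s)" by (cases W) auto
  have t: "smooth_on dom (\<lambda>z. inverse (fst z))"
    by (rule smooth_on_inverse[OF open_dom _ smooth_on_dom(1)]) (auto simp: dom_def)
  let ?y = "\<lambda>z. fst (fst (snd z)) :: 'e" and ?p = "\<lambda>z. snd (fst (snd z)) :: 'e"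
  note intros = smooth_on_const smooth_on_dom smooth_on_dom_base[OF smooth_G] smooth_on_dom_base[OF smooth_S]
    t open_dom
  have c1: "smooth_on dom (\<lambda>z. ((-1/2) * fst z) * S (?y z) u v)"
    by (intro smooth_on_mult intros)
  have c2: "smooth_on dom (\<lambda>z. (a * inverse (fst z)) *\<^sub>R v + (b * inverse (fst z)) *\<^sub>R u + G (?y z) u v)"
    by (intro smooth_on_add smooth_on_scaleR smooth_on_mult intros)
  have c: "smooth_on dom (\<lambda>z. \<Sum>e\<in>Basis. cov (?y z) (?p z) (snd (snd z)) (u, \<pi>, r) (v, \<sigma>, s) e *\<^sub>R e)"
    by (intro smooth_on_sum smooth_on_scaleR smooth_cov intros)
  have c3: "smooth_on dom (\<lambda>z. (a * inverse (fst z)) *\<^sub>R \<sigma> + (b * inverse (fst z)) *\<^sub>R \<pi>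
      + (\<Sum>e\<in>Basis. cov (?y z) (?p z) (snd (snd z)) (u, \<pi>, r) (v, \<sigma>, s) e *\<^sub>R e))"
    by (intro smooth_on_add smooth_on_scaleR smooth_on_mult c intros)
  have c4: "smooth_on dom (\<lambda>z. (a * s + b * r) * inverse (fst z) - (u \<bullet> \<sigma> + v \<bullet> \<pi>) + 2 * (?p z \<bullet> G (?y z) u v))"
    by (intro smooth_on_add smooth_on_diff smooth_on_mult smooth_on_inner intros)
  show ?thesis
  proof (rule smooth_on_transform[OF open_dom
        smooth_on_Pair[OF open_dom c1 smooth_on_Pair[OF open_dom smooth_on_Pair[OF open_dom c2 c3] c4]]])
    fix z assume "z \<in> dom"
    obtain \<tau> y p \<rho> where z: "z = (\<tau>, (y, p), \<rho>)" by (cases z) auto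
    show "(((-1/2) * fst z) * S (?y z) u v,
        ((a * inverse (fst z)) *\<^sub>R v + (b * inverse (fst z)) *\<^sub>R u + G (?y z) u v,
         (a * inverse (fst z)) *\<^sub>R \<sigma> + (b * inverse (fst z)) *\<^sub>R \<pi>
           + (\<Sum>e\<in>Basis. cov (?y z) (?p z) (snd (snd z)) (u, \<pi>, r) (v, \<sigma>, s) e *\<^sub>R e)),
        (a * s + b * r) * inverse (fst z) - (u \<bullet> \<sigma> + v \<bullet> \<pi>) + 2 * (?p z \<bullet> G (?y z) u v)) = chr z V W"
      by (simp add: z V W chr_def divide_inverse[of _ \<tau>])
  qed
qed

lemma smooth_ambient: "smooth_on dom (\<lambda>z. ambient z V W)"
proof -
  obtain a u \<pi> r where V: "V = (a, (u, \<pi>), r)" by (cases V) auto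
  obtain b v \<sigma> s where W: "W = (b, (v, \<sigma>), s)" by (cases W) auto
  show ?thesis
    unfolding ambient_def cone_form_def walker_form_def horizontal_def V W prod.case power2_eq_square
    by (intro smooth_on_add smooth_on_diff smooth_on_mult smooth_on_inner smooth_on_const smooth_on_dom
        smooth_on_dom_base[OF smooth_G] smooth_on_dom_base[OF smooth_S] open_dom)
qed

lemma ambient_compatible:
  assumes z: "z \<in> dom"
  shows "frechet_derivative (\<lambda>z. ambient z V W) (at z) X = ambient z (chr z X V) W + ambient z V (chr z X W)"
proof -
  obtain t y p \<rho> where z_def: "z = (t, (y, p), \<rho>)" and y: "y \<in> U" and t: "t > 0"
    using z by (auto simp: dom_def)
  (* Scaling the first components by t makes the identity polynomial. *)
  have split: "\<exists>a u \<pi> r. Z = (t * a, (u, \<pi>), r)" for Z :: "real \<times> ('e \<times> 'e) \<times> real"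
  proof -
    obtain a u \<pi> r where "Z = (a, (u, \<pi>), r)" by (cases Z) auto
    then show ?thesis using t by (intro exI[of _ "a / t"] exI[of _ u] exI[of _ \<pi>] exI[of _ r]) simp
  qed
  obtain a u \<pi> r where X: "X = (t * a, (u, \<pi>), r)" using split[of X] by blast
  obtain b v \<sigma> s where V: "V = (t * b, (v, \<sigma>), s)" using split[of V] by blast
  obtain c w \<omega> q where W: "W = (t * c, (w, \<omega>), q)" using split[of W] by blast
  have GD: "((\<lambda>z. G (fst (fst (snd z))) v w) has_derivative (\<lambda>X. dG y (fst (fst (snd X))) v w)) (at z)"
    by (rule has_derivative_compose[OF has_derivative_fst[OF has_derivative_fst[OF
            has_derivative_snd[OF has_derivative_ident]]]]) (simp add: z_def has_derivative_G[OF y])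
  have SD: "((\<lambda>z. S (fst (fst (snd z))) v w) has_derivative (\<lambda>X. dS y (fst (fst (snd X))) v w)) (at z)"
    by (rule has_derivative_compose[OF has_derivative_fst[OF has_derivative_fst[OF
            has_derivative_snd[OF has_derivative_ident]]]]) (simp add: z_def has_derivative_S[OF y])
  have "((\<lambda>z. ambient z V W) has_derivative (\<lambda>X.
      2 * snd (snd X) * (t * b) * (t * c) + fst X * (t * b * q + t * c * s)
      + (2 * t * fst X * (v \<bullet> \<omega> + w \<bullet> \<sigma> + horizontal y p \<rho> v w)
      + t\<^sup>2 * (snd (snd X) * S y v w + \<rho> * dS y (fst (fst (snd X))) v w
        - 2 * (snd (fst (snd X)) \<bullet> G y v w + p \<bullet> dG y (fst (fst (snd X))) v w))))) (at z)"
    unfolding ambient_def cone_form_def walker_form_def horizontal_def V W prod.case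
    by (rule derivative_eq_intros GD SD refl)+ (simp add: z_def fun_eq_iff algebra_simps power2_eq_square)
  from frechet_derivative_at[OF this, symmetric]
  have "frechet_derivative (\<lambda>z. ambient z V W) (at z) X =
      2 * r * (t * b) * (t * c) + t * a * (t * b * q + t * c * s) + (2 * t * (t * a) * (v \<bullet> \<omega> + w \<bullet> \<sigma> + horizontal y p \<rho> v w)
      + t\<^sup>2 * (r * S y v w + \<rho> * dS y u v w - 2 * (\<pi> \<bullet> G y v w + p \<bullet> dG y u v w)))"
    by (simp add: X)
  also have "\<dots> = ambient z (chr z X V) W + ambient z V (chr z X W)"
  proof -
    have Gs: "G y w v = G y v w" "G y w u = G y u w" "S y w v = S y v w" "S y w u = S y u w"
      "S y v u = S y u v" "G y v u = G y u v"
      using sym_G[OF y] sym_S[OF y] by blast+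
    have ds: "dG y u w v = dG y u v w" "dG y w u v = dG y w v u" "dG y v w u = dG y v u w"
      "dS y u w v = dS y u v w" "dS y w u v = dS y w v u" "dS y v w u = dS y v u w"
      using sym_dG[OF y] sym_dS[OF y] by blast+
    have GG: "G y v (G y u w) = G y (G y u w) v" "S y v (G y u w) = S y (G y u w) v"
      using sym_G[OF y] sym_S[OF y] by blast+
    have vert: "w' \<bullet> (\<Sum>e\<in>Basis. cov y p \<rho> A B e *\<^sub>R e) = cov y p \<rho> A B w'" for A B w'
      by (rule inner_sum_Basis_functional[OF linear_cov[OF y]])
    have quot: "t * m / t = m" "(t * m * l + t * m' * l') / t = m * l + m' * l'" for m l m' l'
      using t by (simp_all add: add_divide_distrib)
    show ?thesis
      unfolding z_def X V W ambient_def cone_form_def walker_form_def chr_def prod.case fst_conv snd_conv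
        inner_add_left inner_add_right inner_scaleR_left inner_scaleR_right vert quot
      unfolding cov_def horizontal_def prod.case
      by (simp add: add_simps(1-4)[OF y] scale_simps(1-4)[OF y] inner_add_right inner_diff_right Gs ds GG
          algebra_simps add_divide_distrib power2_eq_square inner_commute[of \<omega>] inner_commute[of \<sigma>] inner_commute[of \<pi>])
  qed
  finally show ?thesis .
qed

end

context walker_chart
begin

definition ric :: "'e \<Rightarrow> 'e \<Rightarrow> 'e \<Rightarrow> real" where
  "ric y u v = (\<Sum>e\<in>Basis. (dG y e u v - dG y u e v + G y e (G y u v) - G y u (G y e v)) \<bullet> e)"

lemma inner_cov: "y \<in> U \<Longrightarrow> w \<bullet> (\<Sum>e\<in>Basis. cov y p \<rho> V W e *\<^sub>R e) = cov y p \<rho> V W w"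
  and inner_cov': "y \<in> U \<Longrightarrow> (\<Sum>e\<in>Basis. cov y p \<rho> V W e *\<^sub>R e) \<bullet> w = cov y p \<rho> V W w"
  using inner_sum_Basis_functional[OF linear_cov] by (simp_all add: inner_commute)

text \<open>
  The trace of the Christoffel symbols is the logarithmic derivative of the density of the metric,
  which is a constant multiple of \<open>t ^ (2 * n + 1)\<close>.
\<close>

lemma trace_chr:
  assumes z: "z \<in> dom"
  shows "(\<Sum>B\<in>Basis. chr z B W \<bullet> B) = (2 * real DIM('e) + 1) * (fst W / fst z)"
proof -
  obtain t y p \<rho> where z_def: "z = (t, (y, p), \<rho>)" and y: "y \<in> U" using z by (auto simp: dom_def)
  obtain b v \<sigma> s where W: "W = (b, (v, \<sigma>), s)" by (cases W) auto
  have "(\<Sum>e\<in>Basis. chr z (0, (e, 0), 0) W \<bullet> (0, (e, 0), 0)) = (\<Sum>e\<in>Basis. b / t + G y e v \<bullet> e)"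
    by (intro sum.cong) (simp_all add: z_def W chr_def inner_add_left inner_Basis)
  moreover have "(\<Sum>e\<in>Basis. chr z (0, (0, e), 0) W \<bullet> (0, (0, e), 0)) = (\<Sum>e\<in>Basis. b / t - G y e v \<bullet> e)"
  proof (intro sum.cong refl)
    fix e :: 'e assume "e \<in> Basis"
    then show "chr z (0, (0, e), 0) W \<bullet> (0, (0, e), 0) = b / t - G y e v \<bullet> e"
      using sym_G[OF y, of v e]
      by (simp add: z_def W chr_def inner_add_left inner_Basis inner_cov'[OF y])
        (simp add: cov_def zero_simps[OF y] inner_commute)
  qed
  moreover have "chr z (1, 0, 0) W \<bullet> (1, 0, 0) = 0" "chr z (0, 0, 1) W \<bullet> (0, 0, 1) = b / t"
    by (simp_all add: z_def W chr_def zero_prod_def zero_simps[OF y])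
  ultimately show ?thesis
    by (simp add: sum_Basis_cone sum.distrib sum_subtractf z_def W algebra_simps add_divide_distrib)
qed

lemma differentiable_chr: "z \<in> dom \<Longrightarrow> (\<lambda>z. chr z V W) differentiable at z"
  by (rule smooth_on_imp_differentiable[OF open_dom smooth_chr])

lemma derivative_trace_chr:
  assumes z: "z \<in> dom"
  shows "(\<Sum>B\<in>Basis. frechet_derivative (\<lambda>z. chr z B W) (at z) V \<bullet> B) =
    - (2 * real DIM('e) + 1) * (fst V * fst W / (fst z)\<^sup>2)"
proof -
  have t: "fst z > 0" using z by (auto simp: dom_def)
  have "((\<lambda>z. \<Sum>B\<in>Basis. chr z B W \<bullet> B) has_derivative
      (\<lambda>V. \<Sum>B\<in>Basis. frechet_derivative (\<lambda>z. chr z B W) (at z) V \<bullet> B)) (at z)"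
    by (rule has_derivative_sum, rule has_derivative_inner_left,
        rule frechet_derivative_works[THEN iffD1, OF differentiable_chr[OF z]])
  moreover have "((\<lambda>z. (2 * real DIM('e) + 1) * (fst W / fst z)) has_derivative
      (\<lambda>V. - (2 * real DIM('e) + 1) * (fst V * fst W / (fst z)\<^sup>2))) (at z)"
    using t by (auto intro!: derivative_eq_intros simp: power2_eq_square divide_inverse fun_eq_iff algebra_simps)
  then have "((\<lambda>z. \<Sum>B\<in>Basis. chr z B W \<bullet> B) has_derivative
      (\<lambda>V. - (2 * real DIM('e) + 1) * (fst V * fst W / (fst z)\<^sup>2))) (at z)"
    by (rule has_derivative_transform_within_open[OF _ open_dom z]) (simp add: trace_chr)
  ultimately show ?thesis by (rule fun_cong[OF has_derivative_unique])
qed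

lemma chr_derivative_along_line:
  assumes "z \<in> dom" "((\<lambda>h. chr (z + h *\<^sub>R B) V W \<bullet> B) has_real_derivative d) (at 0)"
  shows "frechet_derivative (\<lambda>z. chr z V W) (at z) B \<bullet> B = d"
proof -
  have "(\<lambda>z. chr z V W \<bullet> B) differentiable at z"
    by (intro smooth_on_imp_differentiable[OF open_dom _ assms(1)] smooth_on_inner open_dom smooth_chr
        smooth_on_const)
  from frechet_derivative_along_line[OF this assms(2)] show ?thesis
    by (simp add: frechet_derivative_inner_left differentiable_chr[OF assms(1)])
qed

text \<open>
  Every component of \<open>chr\<close> is differentiated in its own direction only. In the directions of \<open>t\<close>, \<open>p\<close> and
  \<open>\<rho>\<close> this is the derivative of an affine function.
\<close>

lemma divergence_chr:
  assumes z: "z \<in> dom" and z_def: "z = (t, (y, p), \<rho>)"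
    and V: "V = (a, (u, \<pi>), r)" and W: "W = (b, (v, \<sigma>), s)"
  shows "(\<Sum>B\<in>Basis. frechet_derivative (\<lambda>z. chr z V W) (at z) B \<bullet> B) =
    - S y u v / 2 + (\<Sum>e\<in>Basis. 2 * (dG y e u v \<bullet> e) - dG y u v e \<bullet> e - dG y v u e \<bullet> e
      + 2 * (G y (G y u v) e \<bullet> e))"
proof -
  have y: "y \<in> U" and t: "t > 0" using z by (auto simp: dom_def z_def)
  note line = chr_derivative_along_line[OF z, of _ V W]
  have T: "frechet_derivative (\<lambda>z. chr z V W) (at z) (1, 0, 0) \<bullet> (1, 0, 0) = - S y u v / 2"
  proof (rule line)
    have "((\<lambda>h. - ((t + h) / 2) * S y u v) has_real_derivative - S y u v / 2) (at 0)"
      by (auto intro!: derivative_eq_intros)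
    then show "((\<lambda>h. chr (z + h *\<^sub>R (1, 0, 0)) V W \<bullet> (1, 0, 0)) has_real_derivative - S y u v / 2) (at 0)"
      by (simp add: z_def V W chr_def zero_prod_def)
  qed
  have R: "frechet_derivative (\<lambda>z. chr z V W) (at z) (0, 0, 1) \<bullet> (0, 0, 1) = 0"
    by (rule line) (simp add: z_def V W chr_def zero_prod_def)
  have X: "frechet_derivative (\<lambda>z. chr z V W) (at z) (0, (e, 0), 0) \<bullet> (0, (e, 0), 0) = dG y e u v \<bullet> e"
    for e
  proof (rule line)
    have "((\<lambda>y. G y u v \<bullet> e) has_derivative (\<lambda>w. dG y w u v \<bullet> e)) (at (y + 0 *\<^sub>R e))"
      using has_derivative_inner_left[OF has_derivative_G[OF y]] by simp
    from line_has_real_derivative[OF this]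
    have "((\<lambda>h. ((a / t) *\<^sub>R v + (b / t) *\<^sub>R u) \<bullet> e + G (y + h *\<^sub>R e) u v \<bullet> e) has_real_derivative
        dG y e u v \<bullet> e) (at 0)"
      by (auto intro!: derivative_eq_intros)
    then show "((\<lambda>h. chr (z + h *\<^sub>R (0, (e, 0), 0)) V W \<bullet> (0, (e, 0), 0)) has_real_derivative
        dG y e u v \<bullet> e) (at 0)"
      by (simp add: z_def V W chr_def inner_add_left)
  qed
  have P: "frechet_derivative (\<lambda>z. chr z V W) (at z) (0, (0, e), 0) \<bullet> (0, (0, e), 0) =
      dG y e u v \<bullet> e - dG y u v e \<bullet> e - dG y v u e \<bullet> e + 2 * (G y (G y u v) e \<bullet> e)" for e
  proof (rule line)
    let ?c = "- dG y u v e - dG y v u e + dG y e u v + 2 *\<^sub>R G y (G y u v) e"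
    have "cov y (p + h *\<^sub>R e) \<rho> (u, \<pi>, r) (v, \<sigma>, s) e = cov y p \<rho> (u, \<pi>, r) (v, \<sigma>, s) e + h * (e \<bullet> ?c)" for h
      by (simp add: cov_def inner_add_left inner_add_right inner_diff_right algebra_simps)
    then have lin: "chr (z + h *\<^sub>R (0, (0, e), 0)) V W \<bullet> (0, (0, e), 0) =
        chr z V W \<bullet> (0, (0, e), 0) + h * (e \<bullet> ?c)" for h
      by (simp add: z_def V W chr_def inner_add_left inner_cov'[OF y])
    have d: "dG y e u v \<bullet> e - dG y u v e \<bullet> e - dG y v u e \<bullet> e + 2 * (G y (G y u v) e \<bullet> e) = e \<bullet> ?c"
      by (simp add: inner_add_right inner_diff_right inner_commute[of e])
    show "((\<lambda>h. chr (z + h *\<^sub>R (0, (0, e), 0)) V W \<bullet> (0, (0, e), 0)) has_real_derivative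
        dG y e u v \<bullet> e - dG y u v e \<bullet> e - dG y v u e \<bullet> e + 2 * (G y (G y u v) e \<bullet> e)) (at 0)"
      unfolding lin d by (auto intro!: derivative_eq_intros)
  qed
  show ?thesis
    by (simp add: sum_Basis_cone T R X P sum.distrib sum_subtractf sum_distrib_left)
qed

text \<open>
  Each of the four blocks \<open>t\<close>, \<open>y\<close>, \<open>p\<close> and \<open>\<rho>\<close> contributes \<open>- S u v / 2\<close>. The terms linear in \<open>G\<close> cancel
  between the blocks \<open>y\<close> and \<open>p\<close>, on which \<open>chr z W\<close> acts as \<open>b/t\<close> plus \<open>G v\<close> and as \<open>b/t\<close> minus its transpose.
\<close>

lemma trace_chr_chr:
  assumes z: "z \<in> dom" and z_def: "z = (t, (y, p), \<rho>)"
    and V: "V = (a, (u, \<pi>), r)" and W: "W = (b, (v, \<sigma>), s)"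
  shows "(\<Sum>B\<in>Basis. chr z V (chr z B W) \<bullet> B) =
    (2 * real DIM('e) + 1) * (a * b / t\<^sup>2) - 2 * S y u v
      + (\<Sum>e\<in>Basis. G y u (G y e v) \<bullet> e + G y v (G y e u) \<bullet> e)"
proof -
  have y: "y \<in> U" and t: "t > 0" using z by (auto simp: dom_def z_def)
  note zero = zero_simps(1-4)[OF y] and scale = scale_simps(1-4)[OF y] and add = add_simps(1-4)[OF y]
  have cov_zero: "cov y p \<rho> (0, 0, 0) A e = 0" for A e
    using cov_scaleR[OF y, of p \<rho> 0 0 0 0 A e] by simp
  have T: "chr z V (chr z (1, 0, 0) W) \<bullet> (1, 0, 0) = - S y u v / 2"
    using t by (simp add: z_def V W chr_def zero_prod_def zero scale)
  have R: "chr z V (chr z (0, 0, 1) W) \<bullet> (0, 0, 1) = a * b / t\<^sup>2 - S y u v / 2"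
  proof -
    have "chr z (0, 0, 1) W = (0, (0, \<Sum>e\<in>Basis. cov y p \<rho> (0, 0, 1) (v, \<sigma>, s) e *\<^sub>R e), b / t)"
      by (simp add: z_def W chr_def zero_prod_def zero)
    moreover have "cov y p \<rho> (0, 0, 1) (v, \<sigma>, s) u = S y u v / 2"
      by (simp add: cov_def zero zero_simps[OF y] sym_S[OF y, of v u])
    ultimately show ?thesis
      using t by (simp add: z_def V chr_def zero_prod_def zero inner_cov[OF y] power2_eq_square)
  qed
  have X: "chr z V (chr z (0, (e, 0), 0) W) \<bullet> (0, (e, 0), 0) =
      a * b / t\<^sup>2 + a / t * (G y e v \<bullet> e) - (u \<bullet> e) * S y e v / 2 + b / t * (G y u e \<bullet> e) + G y u (G y e v) \<bullet> e"
    if e: "e \<in> Basis" for e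
    using t e by (simp add: z_def V W chr_def inner_add_left inner_Basis add scale power2_eq_square algebra_simps)
  have P: "chr z V (chr z (0, (0, e), 0) W) \<bullet> (0, (0, e), 0) =
      a * b / t\<^sup>2 - a / t * (G y e v \<bullet> e) - b / t * (G y u e \<bullet> e) + G y v (G y e u) \<bullet> e - (v \<bullet> e) * S y e u / 2"
    if e: "e \<in> Basis" for e
  proof -
    define \<eta> where "\<eta> = (b / t) *\<^sub>R e + (\<Sum>c\<in>Basis. cov y p \<rho> (0, e, 0) (v, \<sigma>, s) c *\<^sub>R c)"
    have \<eta>: "\<eta> \<bullet> w = b / t * (e \<bullet> w) - e \<bullet> G y v w" for w
      unfolding \<eta>_def inner_add_left inner_cov'[OF y] by (simp add: cov_def zero zero_simps[OF y])
    have "chr z (0, (0, e), 0) W = (0, (0, \<eta>), - (v \<bullet> e))"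
      by (simp add: z_def W chr_def zero \<eta>_def)
    moreover have "cov y p \<rho> (u, \<pi>, r) (0, \<eta>, - (v \<bullet> e)) e = - (\<eta> \<bullet> G y u e) - (v \<bullet> e) * S y u e / 2"
      by (simp add: cov_def zero zero_simps[OF y])
    ultimately have "chr z V (chr z (0, (0, e), 0) W) \<bullet> (0, (0, e), 0) =
        a / t * (\<eta> \<bullet> e) - \<eta> \<bullet> G y u e - (v \<bullet> e) * S y u e / 2"
      by (simp add: z_def V chr_def zero inner_add_left inner_cov'[OF y])
    note eq = this
    show ?thesis
    proof -
      have "e \<bullet> e = 1" using e by simp
      moreover have "e \<bullet> G y v e = G y e v \<bullet> e" by (subst sym_G[OF y]) (rule inner_commute)
      moreover have "e \<bullet> G y v (G y u e) = G y v (G y e u) \<bullet> e"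
        unfolding sym_G[OF y, of u e] by (rule inner_commute)
      ultimately show ?thesis
        unfolding eq \<eta> sym_S[OF y, of u e] inner_commute[of e "G y u e"]
        by (simp add: power2_eq_square algebra_simps)
    qed
  qed
  have S_sum: "(\<Sum>e\<in>Basis. (x \<bullet> e) * S y e w) = S y x w" for x w
    using linear_eq_sum_Basis[of "\<lambda>x. S y x w" x] bil_S[OF y] by (simp add: bilinear_def)
  have "(\<Sum>B\<in>Basis. chr z V (chr z B W) \<bullet> B) = - S y u v / 2 + (a * b / t\<^sup>2 - S y u v / 2)
      + ((\<Sum>e\<in>Basis. chr z V (chr z (0, (e, 0), 0) W) \<bullet> (0, (e, 0), 0))
        + (\<Sum>e\<in>Basis. chr z V (chr z (0, (0, e), 0) W) \<bullet> (0, (0, e), 0)))"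
    unfolding sum_Basis_cone T R by simp
  also have "(\<Sum>e\<in>Basis. chr z V (chr z (0, (e, 0), 0) W) \<bullet> (0, (e, 0), 0))
        + (\<Sum>e\<in>Basis. chr z V (chr z (0, (0, e), 0) W) \<bullet> (0, (0, e), 0)) =
      (\<Sum>e\<in>Basis. 2 * (a * b / t\<^sup>2) - (u \<bullet> e) * S y e v / 2 - (v \<bullet> e) * S y e u / 2
          + (G y u (G y e v) \<bullet> e + G y v (G y e u) \<bullet> e))"
    unfolding sum.distrib[symmetric] by (rule sum.cong) (simp_all add: X P)
  also have "- S y u v / 2 + (a * b / t\<^sup>2 - S y u v / 2) + \<dots> =
      (2 * real DIM('e) + 1) * (a * b / t\<^sup>2) - 2 * S y u v + (\<Sum>e\<in>Basis. G y u (G y e v) \<bullet> e + G y v (G y e u) \<bullet> e)"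
    using sym_S[OF y, of v u]
    by (simp add: sum.distrib sum_subtractf S_sum sum_divide_distrib[symmetric] algebra_simps
        add_divide_distrib)
  finally show ?thesis .
qed

text \<open>
  The coefficients of \<open>S\<close> are \<open>-1/2\<close> from the divergence, \<open>-(2n+1)/2\<close> from the trace of \<open>chr\<close> on
  \<open>chr z V W\<close>, whose \<open>t\<close>-component is \<open>- t S u v / 2\<close>, and \<open>2\<close> from the quadratic term. The terms with
  \<open>1/t\<^sup>2\<close> of the second and the last summand cancel.
\<close>

lemma ricci_chr:
  assumes z: "z \<in> dom" and z_def: "z = (t, (y, p), \<rho>)"
    and V: "V = (a, (u, \<pi>), r)" and W: "W = (b, (v, \<sigma>), s)"
  shows "(\<Sum>B\<in>Basis. (frechet_derivative (\<lambda>z. chr z V W) (at z) B - frechet_derivative (\<lambda>z. chr z B W) (at z) V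
      + chr z B (chr z V W) - chr z V (chr z B W)) \<bullet> B) =
    ric y u v + ric y v u - (real DIM('e) - 1) * S y u v"
proof -
  have y: "y \<in> U" and t: "t > 0" using z by (auto simp: dom_def z_def)
  have tr: "(\<Sum>B\<in>Basis. chr z B (chr z V W) \<bullet> B) = - (2 * real DIM('e) + 1) * S y u v / 2"
  proof -
    have q: "fst (chr z V W) / fst z = - S y u v / 2" using t by (simp add: z_def V W chr_def)
    show ?thesis unfolding trace_chr[OF z] q by (simp add: algebra_simps)
  qed
  have "(\<Sum>e\<in>Basis. 2 * (dG y e u v \<bullet> e) - dG y u v e \<bullet> e - dG y v u e \<bullet> e + 2 * (G y (G y u v) e \<bullet> e))
      - (\<Sum>e\<in>Basis. G y u (G y e v) \<bullet> e + G y v (G y e u) \<bullet> e) = ric y u v + ric y v u"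
    using sym_dG[OF y, of u v] sym_dG[OF y, of v u] sym_dG[OF y, of _ v u] sym_G[OF y, of v u]
      sym_G[OF y, of "G y u v"]
    unfolding ric_def sum.distrib[symmetric] sum_subtractf[symmetric]
    by (intro sum.cong) (simp_all add: inner_add_left inner_diff_left)
  moreover have "- c / 2 + d - (- (2 * m + 1) * e) + - (2 * m + 1) * c / 2 - ((2 * m + 1) * e - 2 * c + l) =
      k - (m - 1) * c" if "d - l = k" for c d e k l m :: real
    using that by (simp add: algebra_simps add_divide_distrib diff_divide_distrib)
  ultimately show ?thesis
    unfolding inner_add_left inner_diff_left sum.distrib sum_subtractf divergence_chr[OF z z_def V W]
      derivative_trace_chr[OF z] tr trace_chr_chr[OF z z_def V W]
    by (simp only: z_def V W fst_conv sum.distrib sum_subtractf)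
qed

end

section \<open>The ambient metric of a Patterson--Walker metric\<close>

text \<open>A symmetric bilinear form is recovered from its coefficients, also when these multiply symmetrised products.\<close>

lemma bilinear_sum_sym_prod:
  fixes \<beta> :: "'e::euclidean_space \<Rightarrow> 'e \<Rightarrow> real"
  assumes bil: "bilinear \<beta>" and sym: "\<And>u v. \<beta> u v = \<beta> v u"
  shows "(\<Sum>i\<in>Basis. \<Sum>j\<in>Basis. \<beta> i j * ((\<lambda>w. w \<bullet> i) \<odot> (\<lambda>w. w \<bullet> j)) u v) = \<beta> u v"
proof -
  have expand: "\<beta> u v = (\<Sum>i\<in>Basis. \<Sum>j\<in>Basis. \<beta> i j * ((u \<bullet> i) * (v \<bullet> j)))" for u v
  proof -
    have "\<beta> u v = (\<Sum>i\<in>Basis. (u \<bullet> i) * \<beta> i v)"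
      using linear_eq_sum_Basis[of "\<lambda>u. \<beta> u v" u] bil by (simp add: bilinear_def)
    also have "\<dots> = (\<Sum>i\<in>Basis. (u \<bullet> i) * (\<Sum>j\<in>Basis. (v \<bullet> j) * \<beta> i j))"
    proof (rule sum.cong[OF refl])
      fix i show "(u \<bullet> i) * \<beta> i v = (u \<bullet> i) * (\<Sum>j\<in>Basis. (v \<bullet> j) * \<beta> i j)"
        using linear_eq_sum_Basis[of "\<beta> i" v] bil by (simp add: bilinear_def)
    qed
    finally show ?thesis by (simp add: sum_distrib_left mult_ac)
  qed
  have "(\<Sum>i\<in>Basis. \<Sum>j\<in>Basis. \<beta> i j * ((\<lambda>w. w \<bullet> i) \<odot> (\<lambda>w. w \<bullet> j)) u v) = (\<beta> u v + \<beta> v u) / 2"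
    unfolding expand[of u v] expand[of v u] sum.distrib[symmetric] sum_divide_distrib
    by (intro sum.cong refl) (simp add: sym_prod_def algebra_simps add_divide_distrib)
  then show ?thesis using sym[of v u] by simp
qed

context torsion_free_connection
begin

definition chart_christoffel :: "('a, 'b) chart \<Rightarrow> 'b \<Rightarrow> 'b \<Rightarrow> 'b \<Rightarrow> 'b" where
  "chart_christoffel k y = conn_form D k (chart_inv k y)"

definition chart_ricci :: "('a, 'b) chart \<Rightarrow> 'b \<Rightarrow> 'b \<Rightarrow> 'b \<Rightarrow> real" where
  "chart_ricci k y u v =
     (ricci D k (chart_inv k y) u v + ricci D k (chart_inv k y) v u) / (real DIM('b) - 1)"

lemma walker_chart:
  assumes k: "k \<in> A"
  shows "walker_chart (snd k ` fst k) (chart_christoffel k) (chart_ricci k)"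
proof
  show op: "open (snd k ` fst k)" using atlas k by (simp add: smooth_atlas_def)
  fix u v
  have G: "smooth_on (snd k ` fst k) (\<lambda>y. conn_form D k (chart_inv k y) u v)"
    using smooth_in_conn_form[OF k] by (simp add: smooth_in_def comp_def)
  then show "smooth_on (snd k ` fst k) (\<lambda>y. chart_christoffel k y u v)"
    by (simp add: chart_christoffel_def)
  have R: "smooth_on (snd k ` fst k) (\<lambda>y. ricci D k (chart_inv k y) u v)" for u v
    using smooth_in_ricci[OF k] by (simp add: smooth_in_def comp_def)
  show "smooth_on (snd k ` fst k) (\<lambda>y. chart_ricci k y u v)"
    unfolding chart_ricci_def divide_inverse
    by (intro smooth_on_mult smooth_on_add smooth_on_const R op)
  fix y assume "y \<in> snd k ` fst k"
  then have x: "chart_inv k y \<in> fst k" by (rule inv_into_into)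
  show "bilinear (chart_christoffel k y)"
    unfolding chart_christoffel_def by (rule bilinear_conn_form[OF k x])
  show "chart_christoffel k y u v = chart_christoffel k y v u"
    unfolding chart_christoffel_def by (rule conn_form_symmetric[OF k x])
  note R = bilinear_ricci[OF k x]
  show "bilinear (chart_ricci k y)"
    unfolding bilinear_def linear_iff chart_ricci_def
    by (auto simp: bilinear_ladd[OF R] bilinear_radd[OF R] bilinear_lmul[OF R] bilinear_rmul[OF R]
        algebra_simps add_divide_distrib diff_divide_distrib)
  show "chart_ricci k y u v = chart_ricci k y v u" by (simp add: chart_ricci_def add.commute)
qed

definition walker_metric :: "('a, 'b) chart \<Rightarrow> 'a \<times> ('a, 'b) covector \<Rightarrow> real \<Rightarrow> 'b \<times> 'b \<Rightarrow> 'b \<times> 'b \<Rightarrow> real"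
  where "walker_metric k z \<rho> =
    walker_form (walker_chart.horizontal (chart_christoffel k) (chart_ricci k) (snd k (fst z)) (snd z k) \<rho>)"

lemma walker_metric_eq:
  assumes k: "k \<in> A" "x \<in> fst k"
  shows "walker_metric k (x, \<xi>) \<rho> (u, \<pi>) (v, \<sigma>) = u \<bullet> \<sigma> + v \<bullet> \<pi>
    + \<rho> * ((ricci D k x u v + ricci D k x v u) / (real DIM('b) - 1)) - 2 * (\<xi> k \<bullet> conn_form D k x u v)"
proof -
  interpret w: walker_chart "snd k ` fst k" "chart_christoffel k" "chart_ricci k"
    by (rule walker_chart[OF k(1)])
  show ?thesis
    using k by (simp add: walker_metric_def walker_form_def w.horizontal_def chart_ricci_def chart_christoffel_def)
qed

text \<open>
  Invariance of the metric: the second derivatives of the transition map that enter through the fibre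
  coordinates are exactly the inhomogeneous term in the transformation law of the Christoffel symbols.
\<close>

lemma walker_metric_change_chart:
  assumes k: "k \<in> A" "k' \<in> A" and x: "x \<in> fst k" "x \<in> fst k'" and \<xi>: "\<xi> \<in> cotangent_space A x"
  shows "walker_metric k' (x, \<xi>) \<rho> (jac (cotangent_chart A k) (cotangent_chart A k') (x, \<xi>) w)
      (jac (cotangent_chart A k) (cotangent_chart A k') (x, \<xi>) z) = walker_metric k (x, \<xi>) \<rho> w z"
proof -
  let ?J = "jac k k' x" and ?K = "jac (cotangent_chart A k) (cotangent_chart A k') (x, \<xi>)"
  define H where "H u v = chart_deriv k (\<lambda>y. jac k k' y v) x u" for u v
  obtain u \<pi> where w: "w = (u, \<pi>)" by (cases w)
  obtain v \<sigma> where z: "z = (v, \<sigma>)" by (cases z)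
  have fst_K: "fst (?K w) = ?J u" "fst (?K z) = ?J v"
    using jac_cotangent_chart(1)[OF k x \<xi>] by (simp_all add: w z)
  have snd_K: "snd (?K w) \<bullet> ?J v = \<pi> \<bullet> v - \<xi> k' \<bullet> H u v" "snd (?K z) \<bullet> ?J u = \<sigma> \<bullet> u - \<xi> k' \<bullet> H v u"
    using jac_cotangent_chart(2)[OF k x \<xi>] by (simp_all add: w z H_def)
  have G: "conn_form D k' x (?J u) (?J v) = ?J (conn_form D k x u v) - H u v" for u v
    using conn_form_change_chart[OF k x, of u v] by (simp add: H_def)
  have H: "H v u = H u v"
    using G[of u v] G[of v u] conn_form_symmetric[OF k(1) x(1), of u v]
      conn_form_symmetric[OF k(2) x(2), of "?J u" "?J v"] by simp
  have pairing: "\<xi> k' \<bullet> ?J (conn_form D k x u v) = \<xi> k \<bullet> conn_form D k x u v"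
    by (rule cotangent_space_jac[OF \<xi> k x])
  have "walker_metric k' (x, \<xi>) \<rho> (?K w) (?K z) = ?J u \<bullet> snd (?K z) + ?J v \<bullet> snd (?K w)
    + \<rho> * ((ricci D k' x (?J u) (?J v) + ricci D k' x (?J v) (?J u)) / (real DIM('b) - 1))
    - 2 * (\<xi> k' \<bullet> conn_form D k' x (?J u) (?J v))"
    using walker_metric_eq[OF k(2) x(2), of \<xi> \<rho> "?J u" "snd (?K w)" "?J v" "snd (?K z)"]
    by (metis fst_K prod.collapse)
  also have "\<dots> = walker_metric k (x, \<xi>) \<rho> w z"
    unfolding w z walker_metric_eq[OF k(1) x(1)] ricci_change_chart[OF k x] G
    using snd_K[unfolded w z] by (simp add: inner_diff_right pairing H inner_commute[of "?J _"] inner_commute[of _ \<sigma>] inner_commute[of _ \<pi>])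
  finally show ?thesis .
qed

lemma ambient_charts:
  "K \<in> ambient_atlas (cotangent_atlas A) \<longleftrightarrow> (\<exists>k\<in>A. K = ambient_chart (cotangent_chart A k))"
  by (auto simp: ambient_atlas_def cotangent_atlas_def)

lemma ambient_domain:
  "z \<in> fst (ambient_chart (cotangent_chart A k)) \<longleftrightarrow>
    (\<exists>t x \<xi> \<rho>. z = (t, (x, \<xi>), \<rho>) \<and> t > 0 \<and> x \<in> fst k \<and> \<xi> \<in> cotangent_space A x)"
  by (auto simp: fst_ambient_chart cotangent_chart_def)

lemma ambient_image:
  assumes "k \<in> A"
  shows "snd (ambient_chart (cotangent_chart A k)) ` fst (ambient_chart (cotangent_chart A k)) =
    walker_chart.dom (snd k ` fst k)"
proof -
  interpret w: walker_chart "snd k ` fst k" "chart_christoffel k" "chart_ricci k"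
    by (rule walker_chart[OF assms])
  show ?thesis
    by (simp add: fst_ambient_chart image_ambient_chart image_cotangent_chart_UNIV[OF assms] w.dom_def)
qed

text \<open>
  Two tensors given by their components in the canonical charts, in the basis-free form above.
\<close>

context
  fixes g :: "('a \<times> ('a, 'b) covector, 'b \<times> 'b) tensor2"
    and gA :: "(real \<times> ('a \<times> ('a, 'b) covector) \<times> real, real \<times> ('b \<times> 'b) \<times> real) tensor2"
  assumes manifold: "smooth_manifold A" and dim: "DIM('b) \<ge> 2"
    and g: "\<And>k x \<xi>. k \<in> A \<Longrightarrow> x \<in> fst k \<Longrightarrow> \<xi> \<in> cotangent_space A x \<Longrightarrow>
      g (cotangent_chart A k) (x, \<xi>) = walker_metric k (x, \<xi>) 0"
    and gA: "\<And>k t x \<xi> \<rho>. k \<in> A \<Longrightarrow> t > 0 \<Longrightarrow> x \<in> fst k \<Longrightarrow> \<xi> \<in> cotangent_space A x \<Longrightarrow>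
      gA (ambient_chart (cotangent_chart A k)) (t, (x, \<xi>), \<rho>) = cone_form (walker_metric k (x, \<xi>) \<rho>) t \<rho>"
begin

lemma ambient_coordinates:
  assumes k: "k \<in> A" and z: "z \<in> fst (ambient_chart (cotangent_chart A k))"
  shows "gA (ambient_chart (cotangent_chart A k)) z =
    walker_chart.ambient (chart_christoffel k) (chart_ricci k) (snd (ambient_chart (cotangent_chart A k)) z)"
proof -
  interpret w: walker_chart "snd k ` fst k" "chart_christoffel k" "chart_ricci k"
    by (rule walker_chart[OF k])
  obtain t x \<xi> \<rho> where "z = (t, (x, \<xi>), \<rho>)" "t > 0" "x \<in> fst k" "\<xi> \<in> cotangent_space A x"
    using z by (auto simp: ambient_domain)
  then show ?thesis using k by (simp add: gA w.ambient_def walker_metric_def)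
qed

lemma bilinear_walker_metric:
  assumes "k \<in> A" "x \<in> fst k"
  shows "bilinear (walker_metric k (x, \<xi>) \<rho>)" "walker_metric k (x, \<xi>) \<rho> w z = walker_metric k (x, \<xi>) \<rho> z w"
    "has_signature (walker_metric k (x, \<xi>) \<rho>) DIM('b) DIM('b)"
    "t > 0 \<Longrightarrow> has_signature (cone_form (walker_metric k (x, \<xi>) \<rho>) t \<rho>) (DIM('b) + 1) (DIM('b) + 1)"
proof -
  interpret w: walker_chart "snd k ` fst k" "chart_christoffel k" "chart_ricci k"
    by (rule walker_chart[OF assms(1)])
  have "snd k x \<in> snd k ` fst k" using assms(2) by blast
  note h = w.bilinear_horizontal[OF this] w.symmetric_horizontal[OF this]
  show "bilinear (walker_metric k (x, \<xi>) \<rho>)"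
    unfolding walker_metric_def fst_conv by (rule bilinear_walker_form[OF h(1)])
  show "walker_metric k (x, \<xi>) \<rho> w z = walker_metric k (x, \<xi>) \<rho> z w"
    unfolding walker_metric_def fst_conv by (rule walker_form_symmetric[OF h(2)])
  show "has_signature (walker_metric k (x, \<xi>) \<rho>) DIM('b) DIM('b)"
    unfolding walker_metric_def fst_conv by (rule has_signature_walker_form[OF h])
  show "has_signature (cone_form (walker_metric k (x, \<xi>) \<rho>) t \<rho>) (DIM('b) + 1) (DIM('b) + 1)" if "t > 0"
    unfolding walker_metric_def fst_conv by (rule has_signature_cone_walker_form[OF h that])
qed

lemma pseudo_riemannian_walker:
  "pseudo_riemannian_manifold (cotangent_atlas A) DIM('b) DIM('b) g"
  unfolding pseudo_riemannian_manifold_def cotangent_atlas_def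
proof (intro conjI ballI allI; (elim imageE)?)
  show "smooth_manifold (cotangent_chart A ` A)"
    using smooth_manifold_cotangent[OF manifold] by (simp add: cotangent_atlas_def)
  fix K k assume k: "k \<in> A" and K: "K = cotangent_chart A k"
  interpret w: walker_chart "snd k ` fst k" "chart_christoffel k" "chart_ricci k"
    by (rule walker_chart[OF k])
  {
    fix u v
    let ?T = "snd k ` fst k \<times> UNIV :: ('b \<times> 'b) set"
    have T: "open ?T" using w.open_U by (intro open_Times) auto
    have "smooth_on ?T (\<lambda>y. (1 :: real, y, 0 :: real))"
      by (intro smooth_on_Pair T smooth_on_const smooth_on_bounded_linear[OF T bounded_linear_ident])
    from smooth_on_compose[OF T w.open_dom this w.smooth_ambient[of "(0, u, 0)" "(0, v, 0)"]]
    have "smooth_on ?T (\<lambda>y. w.ambient (1, y, 0) (0, u, 0) (0, v, 0))"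
      by (auto simp: w.dom_def)
    moreover have "w.ambient (1, y, 0) (0, u, 0) (0, v, 0) = g K (chart_inv K y) u v" if y: "y \<in> ?T" for y
    proof -
      obtain x p where x: "x \<in> fst k" and y: "y = (snd k x, p)" using y by auto
      have "chart_inv K y = (x, covector_of k x p)"
        using chart_inv_cotangent_chart[OF k imageI[OF x]] by (simp add: y K k x)
      then show ?thesis
        using g[OF k x covector_of_mem[OF k x]]
        by (simp add: K y w.ambient_def cone_form_def walker_metric_def covector_of_own_chart[OF k x])
    qed
    ultimately show "smooth_on (snd K ` fst K) (\<lambda>y. g K (chart_inv K y) u v)"
      unfolding K image_cotangent_chart_UNIV[OF k] by (rule smooth_on_transform[OF T])
  }
  {
    fix K' k' z u v assume k': "k' \<in> A" and K': "K' = cotangent_chart A k'" and z: "z \<in> fst K \<inter> fst K'"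
    obtain x \<xi> where "z = (x, \<xi>)" "x \<in> fst k" "x \<in> fst k'" "\<xi> \<in> cotangent_space A x"
      using z by (cases z) (auto simp: K K' fst_cotangent_chart)
    then show "g K' z (jac K K' z u) (jac K K' z v) = g K z u v"
      by (simp add: K K' g k k' walker_metric_change_chart)
  }
  fix z assume z: "z \<in> fst K"
  obtain x \<xi> where x: "z = (x, \<xi>)" "x \<in> fst k" "\<xi> \<in> cotangent_space A x"
    using z by (cases z) (auto simp: K fst_cotangent_chart)
  then show "bilinear (g K z)" "has_signature (g K z) DIM('b) DIM('b)"
    by (simp_all add: K g k bilinear_walker_metric)
  show "g K z u v = g K z v u" for u v
    using x bilinear_walker_metric(2)[OF k x(2)] by (simp add: K g k)
qed

lemma smooth_manifold_total: "smooth_manifold (ambient_atlas (cotangent_atlas A))"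
  by (rule smooth_manifold_ambient[OF smooth_manifold_cotangent[OF manifold]])

lemma pseudo_riemannian_ambient:
  "pseudo_riemannian_manifold (ambient_atlas (cotangent_atlas A)) (DIM('b) + 1) (DIM('b) + 1) gA"
  unfolding pseudo_riemannian_manifold_def
proof (intro conjI ballI allI)
  show "smooth_manifold (ambient_atlas (cotangent_atlas A))" by (rule smooth_manifold_total)
  interpret cot: atlas "cotangent_atlas A" by unfold_locales (rule smooth_atlas_cotangent)
  interpret amb: atlas "ambient_atlas (cotangent_atlas A)" by unfold_locales (rule cot.smooth_atlas_ambient)
  fix K assume K_mem: "K \<in> ambient_atlas (cotangent_atlas A)"
  then obtain k where k: "k \<in> A" and K: "K = ambient_chart (cotangent_chart A k)"
    by (auto simp: ambient_charts)
  interpret w: walker_chart "snd k ` fst k" "chart_christoffel k" "chart_ricci k"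
    by (rule walker_chart[OF k])
  have image: "snd K ` fst K = w.dom" unfolding K by (rule ambient_image[OF k])
  show "smooth_on (snd K ` fst K) (\<lambda>y. gA K (chart_inv K y) u v)" for u v
    unfolding image
  proof (rule smooth_on_transform[OF w.open_dom w.smooth_ambient[of u v]])
    fix y assume y: "y \<in> w.dom"
    then have "y \<in> snd K ` fst K" by (simp add: image)
    then show "w.ambient y u v = gA K (chart_inv K y) u v"
      using ambient_coordinates[OF k, of "chart_inv K y"] inv_into_into[of y "snd K" "fst K"]
      by (simp add: K)
  qed
  {
    fix K' z and u v :: "real \<times> ('b \<times> 'b) \<times> real"
    assume "K' \<in> ambient_atlas (cotangent_atlas A)" and z: "z \<in> fst K \<inter> fst K'"
    then obtain k' where k': "k' \<in> A" and K': "K' = ambient_chart (cotangent_chart A k')"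
      by (auto simp: ambient_charts)
    obtain t x \<xi> \<rho> where x: "z = (t, (x, \<xi>), \<rho>)" "t > 0" "x \<in> fst k" "x \<in> fst k'" "\<xi> \<in> cotangent_space A x"
      using z by (auto simp: K K' ambient_domain)
    obtain a u' r b v' s where uv: "u = (a, u', r)" "v = (b, v', s)" by (cases u, cases v)
    have "jac K K' z (a, w, r) = (a, jac (cotangent_chart A k) (cotangent_chart A k') (x, \<xi>) w, r)" for a w r
      unfolding K K' x(1)
      by (rule cot.jac_ambient_chart) (use k k' x in \<open>auto simp: cotangent_atlas_def fst_cotangent_chart\<close>)
    then show "gA K' z (jac K K' z u) (jac K K' z v) = gA K z u v"
      using x by (simp add: K K' uv gA k k' cone_form_def walker_metric_change_chart)
  }
  fix z assume z: "z \<in> fst K"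
  obtain t x \<xi> \<rho> where x: "z = (t, (x, \<xi>), \<rho>)" "t > 0" "x \<in> fst k" "\<xi> \<in> cotangent_space A x"
    using z by (auto simp: K ambient_domain)
  then show "bilinear (gA K z)" "has_signature (gA K z) (DIM('b) + 1) (DIM('b) + 1)"
    using bilinear_walker_metric(4)[OF k x(3,2)]
    by (simp_all add: K gA k bilinear_walker_metric bilinear_cone_form)
  show "gA K z u v = gA K z v u" for u v
    using x cone_form_symmetric[OF bilinear_walker_metric(2)[OF k x(3)]] by (simp add: K gA k)
qed

lemma ricci_flat_ambient: "ricci_flat (ambient_atlas (cotangent_atlas A)) gA"
proof -
  interpret cot: atlas "cotangent_atlas A" by unfold_locales (rule smooth_atlas_cotangent)
  interpret amb: atlas "ambient_atlas (cotangent_atlas A)" by unfold_locales (rule cot.smooth_atlas_ambient)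
  define \<Gamma> where "\<Gamma> K z = (let k = inv (cotangent_chart A) (inv ambient_chart K) in
    walker_chart.chr (chart_christoffel k) (chart_ricci k) (snd K z))" for K z
  have \<Gamma>: "\<Gamma> (ambient_chart (cotangent_chart A k)) z = walker_chart.chr (chart_christoffel k) (chart_ricci k)
      (snd (ambient_chart (cotangent_chart A k)) z)" for k z
    by (simp add: \<Gamma>_def inv_f_f[OF inj_cotangent_chart] inv_f_f[OF inj_ambient_chart])
  interpret M: metric_christoffel_family "ambient_atlas (cotangent_atlas A)" gA "DIM('b) + 1" "DIM('b) + 1" \<Gamma>
  proof unfold_locales
    show "pseudo_riemannian_manifold (ambient_atlas (cotangent_atlas A)) (DIM('b) + 1) (DIM('b) + 1) gA"
      by (rule pseudo_riemannian_ambient)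
    fix K assume K_mem: "K \<in> ambient_atlas (cotangent_atlas A)"
    then obtain k where k: "k \<in> A" and K: "K = ambient_chart (cotangent_chart A k)"
      by (auto simp: ambient_charts)
    interpret w: walker_chart "snd k ` fst k" "chart_christoffel k" "chart_ricci k"
      by (rule walker_chart[OF k])
    have image: "snd K ` fst K = w.dom" unfolding K by (rule ambient_image[OF k])
    have \<Gamma>K: "\<Gamma> K z = w.chr (snd K z)" for z unfolding K by (rule \<Gamma>)
    show "smooth_in K (fst K) (\<lambda>z. \<Gamma> K z u v)" for u v
      unfolding \<Gamma>K
      by (rule amb.smooth_in_coordinate_function[OF K_mem, of "\<lambda>q. w.chr q u v"])
        (simp only: image w.smooth_chr)
    fix z assume z: "z \<in> fst K"
    then have q: "snd K z \<in> w.dom" using image by blast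
    show "bilinear (\<Gamma> K z)" unfolding \<Gamma>K by (rule w.bilinear_chr[OF q])
    show "\<Gamma> K z u v = \<Gamma> K z v u" for u v unfolding \<Gamma>K by (rule w.chr_symmetric[OF q])
    have gK: "gA K z' = w.ambient (snd K z')" if "z' \<in> fst K" for z'
      using ambient_coordinates[OF k, of z'] that by (simp add: K)
    show "chart_deriv K (\<lambda>z. gA K z v w) z u = gA K z (\<Gamma> K z u v) w + gA K z v (\<Gamma> K z u w)" for u v w
    proof -
      have "chart_deriv K (\<lambda>z. gA K z v w) z u = chart_deriv K (\<lambda>z. w.ambient (snd K z) v w) z u"
        by (rule fun_cong[OF amb.chart_deriv_cong[OF K_mem amb.opn_domain[OF K_mem] z z]]) (simp add: gK)
      also have "\<dots> = frechet_derivative (\<lambda>q. w.ambient q v w) (at (snd K z)) u"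
        by (rule amb.chart_deriv_coordinate_function[OF K_mem z, of "\<lambda>q. w.ambient q v w"])
      also have "\<dots> = gA K z (\<Gamma> K z u v) w + gA K z v (\<Gamma> K z u w)"
        unfolding \<Gamma>K gK[OF z] by (rule w.ambient_compatible[OF q])
      finally show ?thesis .
    qed
  qed
  have "ricci (coord_connection \<Gamma>) K z V W = 0"
    if K_mem: "K \<in> ambient_atlas (cotangent_atlas A)" and z: "z \<in> fst K" for K z V W
  proof -
    obtain k where k: "k \<in> A" and K: "K = ambient_chart (cotangent_chart A k)"
      using K_mem by (auto simp: ambient_charts)
    interpret w: walker_chart "snd k ` fst k" "chart_christoffel k" "chart_ricci k"
      by (rule walker_chart[OF k])
    have \<Gamma>K: "\<Gamma> K z = w.chr (snd K z)" for z unfolding K by (rule \<Gamma>)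
    obtain t x \<xi> \<rho> where x: "z = (t, (x, \<xi>), \<rho>)" "t > 0" "x \<in> fst k" "\<xi> \<in> cotangent_space A x"
      using z by (auto simp: K ambient_domain)
    have q: "snd K z = (t, (snd k x, \<xi> k), \<rho>)" by (simp add: K x(1))
    then have dom: "snd K z \<in> w.dom" using x(2,3) by (simp add: w.dom_def)
    obtain a u \<pi> r where V: "V = (a, (u, \<pi>), r)" by (cases V) auto
    obtain b v \<sigma> s where W: "W = (b, (v, \<sigma>), s)" by (cases W) auto
    have ric: "w.ric (snd k x) u v = ricci D k x u v" for u v
      using k x(3) by (simp add: w.ric_def ricci_in_chart curv_form_def w.dG_def chart_deriv_def comp_def
          chart_christoffel_def)
    have "ricci (coord_connection \<Gamma>) K z V W = (\<Sum>B\<in>Basis.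
        (frechet_derivative (\<lambda>q. w.chr q V W) (at (snd K z)) B - frechet_derivative (\<lambda>q. w.chr q B W) (at (snd K z)) V
          + w.chr (snd K z) B (w.chr (snd K z) V W) - w.chr (snd K z) V (w.chr (snd K z) B W)) \<bullet> B)"
      unfolding M.ricci_coord_connection[OF K_mem z] \<Gamma>K
        amb.chart_deriv_coordinate_function[OF K_mem z, of "\<lambda>q. w.chr q _ _"] ..
    also have "\<dots> = w.ric (snd k x) u v + w.ric (snd k x) v u - (real DIM('b) - 1) * chart_ricci k (snd k x) u v"
      by (rule w.ricci_chr[OF dom q V W])
    also have "\<dots> = 0"
      using dim k x(3) by (simp add: ric chart_ricci_def)
    finally show ?thesis .
  qed
  then show ?thesis
    unfolding ricci_flat_def using M.levi_civita_coord_connection by blast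
qed

lemma FG_ambient_metric: "ricci_flat_FG_ambient_metric (cotangent_atlas A) DIM('b) DIM('b) g gA"
  unfolding ricci_flat_FG_ambient_metric_def
proof (intro conjI pseudo_riemannian_walker pseudo_riemannian_ambient ricci_flat_ambient)
  let ?h = "\<lambda>K z \<rho> i j. gA (ambient_chart K) (1, z, \<rho>) (0, i, 0) (0, j, 0)"
  show "\<exists>h. \<forall>k\<in>cotangent_atlas A. \<forall>x \<in> fst k.
      (\<forall>u v. g k x u v = (\<Sum>i\<in>Basis. \<Sum>j\<in>Basis. h k x 0 i j * ((\<lambda>w. w \<bullet> i) \<odot> (\<lambda>w. w \<bullet> j)) u v)) \<and>
      (\<forall>t>0. \<forall>\<rho> u v. gA (ambient_chart k) (t, x, \<rho>) u v =
         t\<^sup>2 * (\<Sum>i\<in>Basis. \<Sum>j\<in>Basis. h k x \<rho> i j * ((\<lambda>w. d_base w \<bullet> i) \<odot> (\<lambda>w. d_base w \<bullet> j)) u v)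
         + 2 * \<rho> * (d_t \<odot> d_t) u v + 2 * t * (d_t \<odot> d_rho) u v)"
  proof (intro exI[of _ ?h] ballI)
    fix K z assume "K \<in> cotangent_atlas A" and z: "z \<in> fst K"
    then obtain k where k: "k \<in> A" and K: "K = cotangent_chart A k" by (auto simp: cotangent_atlas_def)
    obtain x \<xi> where x: "z = (x, \<xi>)" "x \<in> fst k" "\<xi> \<in> cotangent_space A x"
      using z by (cases z) (auto simp: K fst_cotangent_chart)
    have h: "?h K z \<rho> i j = walker_metric k z \<rho> i j" for \<rho> i j
      using x by (simp add: K gA[OF k] cone_form_def)
    have sum: "(\<Sum>i\<in>Basis. \<Sum>j\<in>Basis. walker_metric k z \<rho> i j * ((\<lambda>w. w \<bullet> i) \<odot> (\<lambda>w. w \<bullet> j)) u v) =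
        walker_metric k z \<rho> u v" for \<rho> u v
      unfolding x(1) by (rule bilinear_sum_sym_prod[OF bilinear_walker_metric(1,2)[OF k x(2)]])
    have base: "((\<lambda>w. d_base w \<bullet> i) \<odot> (\<lambda>w. d_base w \<bullet> j)) u v =
        ((\<lambda>w. w \<bullet> i) \<odot> (\<lambda>w. w \<bullet> j)) (d_base u) (d_base v)" for i j and u v :: "real \<times> ('b \<times> 'b) \<times> real"
      by (simp add: sym_prod_def)
    show "(\<forall>u v. g K z u v = (\<Sum>i\<in>Basis. \<Sum>j\<in>Basis. ?h K z 0 i j * ((\<lambda>w. w \<bullet> i) \<odot> (\<lambda>w. w \<bullet> j)) u v)) \<and>
      (\<forall>t>0. \<forall>\<rho> u v. gA (ambient_chart K) (t, z, \<rho>) u v =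
         t\<^sup>2 * (\<Sum>i\<in>Basis. \<Sum>j\<in>Basis. ?h K z \<rho> i j * ((\<lambda>w. d_base w \<bullet> i) \<odot> (\<lambda>w. d_base w \<bullet> j)) u v)
         + 2 * \<rho> * (d_t \<odot> d_t) u v + 2 * t * (d_t \<odot> d_rho) u v)"
      unfolding h base sum
    proof (intro conjI allI impI)
      show "g K z u v = walker_metric k z 0 u v" for u v using x by (simp add: K g[OF k])
      fix t \<rho> :: real and u v :: "real \<times> ('b \<times> 'b) \<times> real" assume "t > 0"
      obtain a u' r b v' s where "u = (a, u', r)" "v = (b, v', s)" by (cases u, cases v)
      then show "gA (ambient_chart K) (t, z, \<rho>) u v = t\<^sup>2 * walker_metric k z \<rho> (d_base u) (d_base v)
          + 2 * \<rho> * (d_t \<odot> d_t) u v + 2 * t * (d_t \<odot> d_rho) u v"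
        using x \<open>t > 0\<close>
        by (simp add: K gA[OF k] cone_form_def sym_prod_def d_t_def d_rho_def d_base_def algebra_simps)
    qed
  qed
qed

end

end


section \<open>Components in the coordinate frame\<close>

lemma sum_dx_dp: "(\<Sum>a\<in>UNIV. 2 * (dx a \<odot> dp a) w z) = fst w \<bullet> snd z + fst z \<bullet> snd w"
  by (cases w; cases z) (simp add: sym_prod_def dx_def dp_def inner_vec_def sum.distrib add_divide_distrib mult.commute)

lemma linear_eq_sum_axis:
  fixes f :: "real^'n \<Rightarrow> 'b::real_vector"
  assumes "linear f" shows "f v = (\<Sum>a\<in>UNIV. (v $ a) *\<^sub>R f (axis a 1))"
proof -
  have "f v = f (\<Sum>a\<in>UNIV. (v $ a) *\<^sub>R axis a 1)"
    using basis_expansion[of v] by (simp add: scalar_mult_eq_scaleR)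
  then show ?thesis by (simp add: linear_sum[OF assms] linear_scale[OF assms])
qed

lemma sum_dx_dx:
  fixes k :: "real^'n \<Rightarrow> real^'n \<Rightarrow> real"
  assumes bil: "bilinear k"
  shows "(\<Sum>a\<in>UNIV. \<Sum>b\<in>UNIV. k (axis a 1) (axis b 1) * (dx a \<odot> dx b) w z) =
    (k (fst w) (fst z) + k (fst z) (fst w)) / 2"
proof -
  have expand: "k u v = (\<Sum>a\<in>UNIV. \<Sum>b\<in>UNIV. k (axis a 1) (axis b 1) * (u $ a * v $ b))" for u v
  proof -
    have "k u v = (\<Sum>a\<in>UNIV. u $ a * k (axis a 1) v)"
      using linear_eq_sum_axis[of "\<lambda>u. k u v" u] bil by (simp add: bilinear_def)
    also have "\<dots> = (\<Sum>a\<in>UNIV. u $ a * (\<Sum>b\<in>UNIV. v $ b * k (axis a 1) (axis b 1)))"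
    proof (rule sum.cong[OF refl])
      fix a show "u $ a * k (axis a 1) v = u $ a * (\<Sum>b\<in>UNIV. v $ b * k (axis a 1) (axis b 1))"
        using linear_eq_sum_axis[of "k (axis a 1)" v] bil by (simp add: bilinear_def)
    qed
    finally show ?thesis by (simp add: sum_distrib_left mult_ac)
  qed
  show ?thesis
    unfolding expand[of "fst w" "fst z"] expand[of "fst z" "fst w"] sum.distrib[symmetric] sum_divide_distrib
    by (intro sum.cong refl)
      (simp add: sym_prod_def dx_def case_prod_beta algebra_simps add_divide_distrib)
qed

lemma (in torsion_free_connection) bilinear_inner_conn_form:
  assumes "k \<in> A" "x \<in> fst k"
  shows "bilinear (\<lambda>u v. \<xi> \<bullet> conn_form D k x u v)"
  using bilinear_conn_form[OF assms]
  by (auto simp: bilinear_def linear_iff inner_add_right)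

theorem theorem1:
  fixes A :: "('m, real^'n) chart set"
    and D :: "('m, real^'n) connection"
  assumes "CARD('n) \<ge> 2"
    and "smooth_manifold A"
    and "affine_connection A D"
    and "torsion_free A D"
    and "\<exists>\<omega>. volume_form A \<omega> \<and> preserves_form A D \<omega>"
  shows "ricci_flat_FG_ambient_metric (cotangent_atlas A) CARD('n) CARD('n)
           (patterson_walker A D) (patterson_walker_ambient A D)"
proof -
  interpret torsion_free_connection A D
    by unfold_locales (use assms in \<open>simp_all add: smooth_manifold_def\<close>)
  have christoffel: "(\<Sum>a\<in>UNIV. \<Sum>b\<in>UNIV. \<Sum>c\<in>UNIV.
        2 * christoffel D k x a c b * (p $ c) * (dx a \<odot> dx b) w z) = 2 * (p \<bullet> conn_form D k x (fst w) (fst z))"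
    if k: "k \<in> A" "x \<in> fst k" for k x p w z
  proof -
    have "(\<Sum>c\<in>UNIV. 2 * christoffel D k x a c b * (p $ c) * (dx a \<odot> dx b) w z) =
        2 * ((p \<bullet> conn_form D k x (axis a 1) (axis b 1)) * (dx a \<odot> dx b) w z)" for a b
      by (simp add: christoffel_def conn_form_def inner_vec_def sum_distrib_left sum_distrib_right mult_ac)
    then show ?thesis
      using sum_dx_dx[OF bilinear_inner_conn_form[OF k], of p w z] conn_form_symmetric[OF k, of "fst z" "fst w"]
      by (simp add: sum_distrib_left[symmetric])
  qed
  (* The symmetric products of the coordinate differentials symmetrise the Ricci curvature. *)
  have ricci: "(\<Sum>a\<in>UNIV. \<Sum>b\<in>UNIV.
        2 * \<rho> / (real CARD('n) - 1) * ricci_comp D k x a b * (dx a \<odot> dx b) w z) =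
      \<rho> * ((ricci D k x (fst w) (fst z) + ricci D k x (fst z) (fst w)) / (real CARD('n) - 1))"
    if k: "k \<in> A" "x \<in> fst k" for k x \<rho> w z
  proof -
    have "(\<Sum>a\<in>UNIV. \<Sum>b\<in>UNIV. 2 * \<rho> / (real CARD('n) - 1) * ricci_comp D k x a b * (dx a \<odot> dx b) w z) =
        2 * \<rho> / (real CARD('n) - 1) *
          (\<Sum>a\<in>UNIV. \<Sum>b\<in>UNIV. ricci D k x (axis a 1) (axis b 1) * (dx a \<odot> dx b) w z)"
      by (simp add: ricci_comp_def sum_distrib_left mult.assoc)
    moreover have "2 * \<rho> / c * (s / 2) = \<rho> * (s / c)" for c s :: real by simp
    ultimately show ?thesis unfolding sum_dx_dx[OF bilinear_ricci[OF k]] by (simp only:)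
  qed
  have "patterson_walker A D (cotangent_chart A k) (x, \<xi>) = walker_metric k (x, \<xi>) 0"
    if k: "k \<in> A" "x \<in> fst k" for k x \<xi>
  proof (intro ext)
    fix w z :: "(real^'n) \<times> (real^'n)"
    show "patterson_walker A D (cotangent_chart A k) (x, \<xi>) w z = walker_metric k (x, \<xi>) 0 w z"
      unfolding patterson_walker_cotangent_chart christoffel[OF k] sum_dx_dp
      by (cases w; cases z) (simp add: walker_metric_eq[OF k])
  qed
  moreover have "patterson_walker_ambient A D (ambient_chart (cotangent_chart A k)) (t, (x, \<xi>), \<rho>) =
      cone_form (walker_metric k (x, \<xi>) \<rho>) t \<rho>" if k: "k \<in> A" "x \<in> fst k" for k t x \<xi> \<rho>
  proof (intro ext)
    fix V W :: "real \<times> ((real^'n) \<times> (real^'n)) \<times> real"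
    obtain a u \<pi> r b v \<sigma> s where VW: "V = (a, (u, \<pi>), r)" "W = (b, (v, \<sigma>), s)" by (cases V, cases W) auto
    have "(\<Sum>a\<in>UNIV. \<Sum>b\<in>UNIV. \<Sum>c\<in>UNIV.
        2 * (\<xi> k $ c) * christoffel D k x a c b * (dx a \<odot> dx b) (d_base V) (d_base W)) =
        2 * (\<xi> k \<bullet> conn_form D k x u v)"
      using christoffel[OF k, of "\<xi> k" "d_base V" "d_base W"] by (simp add: VW d_base_def mult_ac)
    then show "patterson_walker_ambient A D (ambient_chart (cotangent_chart A k)) (t, (x, \<xi>), \<rho>) V W =
        cone_form (walker_metric k (x, \<xi>) \<rho>) t \<rho> V W"
      unfolding patterson_walker_ambient_chart ricci[OF k] sum_dx_dp
      by (simp add: VW d_base_def d_t_def d_rho_def sym_prod_def cone_form_def walker_metric_eq[OF k]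
          algebra_simps)
  qed
  ultimately show ?thesis
    using FG_ambient_metric[of "patterson_walker A D" "patterson_walker_ambient A D"] assms(1,2) by simp
qed

end
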